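(* Let $\Omega_2=\mathbb{R}\times(0,1)=\{x=(x_1,x_2)\in\mathbb{R}^2:\ 0<x_2<1\}$ and let $v=(v^1,v^2):\overline{\Omega_2}\to\mathbb{R}^2$ be a $C^2(\overline{\Omega_2})$ vector field which, together with some scalar pressure function $p$, solves the steady Euler equations $$v\cdot\nabla v+\nabla p=0\quad\text{and}\quad \operatorname{div} v=0\quad\text{in }\Omega_2.$$ Suppose that $v^2=0$ on $\partial\Omega_2$ and that $\inf_{\Omega_2}|v|>0$. Then $v$ is a shear flow, that is, $v(x)=(v^1(x_2),0)$ in $\overline{\Omega_2}$: the second component $v^2$ vanishes identically on $\overline{\Omega_2}$ and the first component $v^1$ depends on the variable $x_2$ only.
   Context: $|\cdot|$ is the Euclidean norm. $C^2(\overline{\Omega_2})$ means that all partial derivatives up to order $2$ exist and are continuous up to the boundary; $v$ is not assumed to be bounded. $v\cdot\nabla v$ is the vector field with components $\sum_j v^j\,\partial_{x_j}v^i$. The equations are understood in the classical pointwise sense. *)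

theory Defs
  imports "HOL-Analysis.Analysis"
begin

definition strip :: "(real ^ 2) set" where
  "strip = {x. 0 < x $ 2 \<and> x $ 2 < 1}"

definition has_partial :: "(real ^ 'n \<Rightarrow> real) \<Rightarrow> 'n \<Rightarrow> real \<Rightarrow> real ^ 'n \<Rightarrow> bool" where
  "has_partial f i D x \<longleftrightarrow> ((\<lambda>t. f (x + t *\<^sub>R axis i 1)) has_real_derivative D) (at 0)"

text \<open>As usual for \<^term>\<open>deriv\<close>, the value is meaningful only where the derivative exists.\<close>

definition partial :: "'n \<Rightarrow> (real ^ 'n \<Rightarrow> real) \<Rightarrow> real ^ 'n \<Rightarrow> real" where
  "partial i f x = deriv (\<lambda>t. f (x + t *\<^sub>R axis i 1)) 0"

text \<open>
  \<^term>\<open>C2_closure \<Omega> f\<close>, for open \<open>\<Omega>\<close>, is membership in \<open>C\<^sup>2\<close> of the closure of \<open>\<Omega>\<close>: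
  the partial derivatives up to order two exist in \<open>\<Omega>\<close>, and \<open>f\<close> and each of these derivatives
  extend continuously to the closure (no boundedness is required). Here \<open>g i\<close> and \<open>h i j\<close> are
  the extended first and second derivatives. Since \<open>\<Omega>\<close> is open, the values of \<open>f\<close> outside the
  closure are irrelevant.
\<close>

definition C2_closure :: "(real ^ 'n) set \<Rightarrow> (real ^ 'n \<Rightarrow> real) \<Rightarrow> bool" where
  "C2_closure \<Omega> f \<longleftrightarrow>
     continuous_on (closure \<Omega>) f \<and>
     (\<exists>g h.
        (\<forall>i. continuous_on (closure \<Omega>) (g i) \<and> (\<forall>x\<in>\<Omega>. has_partial f i (g i x) x)) \<and>
        (\<forall>i j. continuous_on (closure \<Omega>) (h i j) \<and> (\<forall>x\<in>\<Omega>. has_partial (g i) j (h i j x) x)))"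

definition advection :: "(real ^ 'n \<Rightarrow> real ^ 'n) \<Rightarrow> real ^ 'n \<Rightarrow> real ^ 'n" where
  "advection v x = (\<chi> i. \<Sum>j\<in>UNIV. v x $ j * partial j (\<lambda>y. v y $ i) x)"

definition gradient :: "(real ^ 'n \<Rightarrow> real) \<Rightarrow> real ^ 'n \<Rightarrow> real ^ 'n" where
  "gradient p x = (\<chi> i. partial i p x)"

definition divergence :: "(real ^ 'n \<Rightarrow> real ^ 'n) \<Rightarrow> real ^ 'n \<Rightarrow> real" where
  "divergence v x = (\<Sum>i\<in>UNIV. partial i (\<lambda>y. v y $ i) x)"

text \<open>
  The pressure is only required to have partial derivatives in \<open>\<Omega>\<close>. When \<open>v\<close> is \<open>C\<^sup>2\<close> the
  momentum equation makes them continuous, so that \<open>p\<close> is then automatically \<open>C\<^sup>1\<close> in \<open>\<Omega>\<close>.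
\<close>

definition steady_euler ::
  "(real ^ 'n) set \<Rightarrow> (real ^ 'n \<Rightarrow> real ^ 'n) \<Rightarrow> (real ^ 'n \<Rightarrow> real) \<Rightarrow> bool" where
  "steady_euler \<Omega> v p \<longleftrightarrow>
     (\<forall>x\<in>\<Omega>. \<forall>i. \<exists>D. has_partial p i D x) \<and>
     (\<forall>x\<in>\<Omega>. advection v x + gradient p x = 0) \<and>
     (\<forall>x\<in>\<Omega>. divergence v x = 0)"

end

theory Submission
  imports Defs
begin

text \<open>
  Write \<open>v = (a, b)\<close>, let \<open>u\<close> be the stream function (\<open>\<nabla>u = (- b, a)\<close>) and \<open>W = b\<^sub>1 - a\<^sub>2\<close> the vorticity.

  Extended affinely across the boundary, \<open>u\<close> is a \<open>C\<^sup>1\<close> function on the plane with \<open>\<bar>\<nabla>u\<bar>\<close> bounded below,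
  so all its level sets are connected. Hence the two boundary lines are full level sets, \<open>u\<close> is
  strictly between its boundary values inside, every level crosses the axis \<open>x\<^sub>1 = 0\<close>, and \<open>W\<close>, being
  constant along levels, is a \<open>C\<^sup>1\<close> function of \<open>u\<close>. Its size and slope are therefore controlled on the axis, so that
  \<open>W\<close> and \<open>\<bar>\<nabla>W\<bar> / \<bar>v\<bar>\<close> are bounded. Comparison arguments for \<open>\<Delta>u = - b\<^sub>1 + a\<^sub>2\<close> and then for
  \<open>\<Delta>b = W\<^sub>1\<close>, both with Dirichlet data, bound \<open>v\<close> and \<open>\<nabla>v\<close>.

  The polar angle \<open>\<theta>\<close> of \<open>v\<close> satisfies \<open>div (\<bar>v\<bar>\<^sup>2 \<nabla>\<theta>) = 0\<close>, an elliptic equation with bounded drift, and is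
  constant on each boundary line. A nonzero difference \<open>k\<close> of these constants would bound \<open>\<bar>\<theta>\<^sub>2\<bar>\<close> below on
  \<open>x\<^sub>2 = 0\<close>, where \<open>a\<^sup>2 \<theta>\<^sub>2 = a b\<^sub>2 = - a a\<^sub>1\<close>, contradicting the boundedness of \<open>a\<close>. So \<open>k = 0\<close>, and the maximum
  principle gives \<open>\<theta> = 0\<close>.
\<close>

section \<open>Maximum principle and gradient bounds\<close>

text \<open>The obstacle is that \<open>v\<close> is not assumed bounded. On the unbounded strip a
  maximum principle for the angle needs a barrier growing at infinity, and the barrier used here
  tolerates a first-order term because the drift, the gradient of log \<open>|v|^2\<close>, is
  bounded. Bounds on \<open>v\<close> and its gradient must therefore come before the angle. Their
  source is the compactness of a single cross-section: every streamline meets it, and both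
  \<open>W\<close> and its rate of change with respect to \<open>u\<close> are constant along
  streamlines. Connectedness is proved on the whole plane because pushing a set along the gradient
  of \<open>u\<close>, which is vertical on the boundary, could leave the strip. Only continuity of
  the gradient is assumed there, for which a gradient flow need not be unique; finite steps replace
  the flow.\<close>

lemma second_deriv_nonpos_at_max:
  fixes f f' :: "real \<Rightarrow> real"
  assumes e: "e > 0"
    and f: "\<And>x. \<bar>x - z\<bar> < e \<Longrightarrow> (f has_real_derivative f' x) (at x)"
    and f': "(f' has_real_derivative D) (at z)"
    and mx: "\<And>x. \<bar>x - z\<bar> < e \<Longrightarrow> f x \<le> f z"
  shows "f' z = 0" "D \<le> 0"
proof -
  show z: "f' z = 0"
  proof (rule DERIV_local_max[of f "f' z" z e])
    show "(f has_real_derivative f' z) (at z)" using f[of z] e by simp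
    show "\<forall>y. \<bar>z - y\<bar> < e \<longrightarrow> f y \<le> f z" using mx by (simp add: abs_minus_commute)
  qed (rule e)
  show "D \<le> 0"
  proof (rule ccontr)
    assume "\<not> D \<le> 0"
    then obtain d where d: "d > 0" "\<And>h. 0 < h \<Longrightarrow> h < d \<Longrightarrow> f' z < f' (z + h)"
      using DERIV_pos_inc_right[OF f'] by auto
    define h where "h = min d e / 2"
    have h: "0 < h" "h < d" "h < e" using d(1) e by (auto simp: h_def)
    have "\<exists>\<xi>. z < \<xi> \<and> \<xi> < z + h \<and> f (z + h) - f z = (z + h - z) * f' \<xi>"
      by (rule MVT2) (use h in \<open>auto intro!: f\<close>)
    then obtain \<xi> where \<xi>: "z < \<xi>" "\<xi> < z + h" "f (z + h) - f z = h * f' \<xi>" by auto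
    have "f' \<xi> > 0" using d(2)[of "\<xi> - z"] \<xi> h z by auto
    then have "f (z + h) > f z" using \<xi>(3) h(1) by (metis diff_gt_0_iff_gt mult_pos_pos)
    then show False using mx[of "z + h"] h by auto
  qed
qed

text \<open>At a positive interior maximum the gradient vanishes and both second derivatives are
  nonpositive. Asking for strictness only at critical points lets first-order terms be evaluated
  there, so the same lemma serves the Laplacian and the equation with drift.\<close>

lemma rectangle_max_principle:
  fixes F Fx Fy Fxx Fyy :: "real \<Rightarrow> real \<Rightarrow> real"
  assumes cont: "continuous_on ({x1..x2} \<times> {y1..y2}) (\<lambda>z. F (fst z) (snd z))"
    and Fx: "\<And>x y. \<lbrakk>x1 < x; x < x2; y1 < y; y < y2\<rbrakk> \<Longrightarrow> ((\<lambda>s. F s y) has_real_derivative Fx x y) (at x)"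
    and Fy: "\<And>x y. \<lbrakk>x1 < x; x < x2; y1 < y; y < y2\<rbrakk> \<Longrightarrow> ((\<lambda>s. F x s) has_real_derivative Fy x y) (at y)"
    and Fxx: "\<And>x y. \<lbrakk>x1 < x; x < x2; y1 < y; y < y2\<rbrakk> \<Longrightarrow> ((\<lambda>s. Fx s y) has_real_derivative Fxx x y) (at x)"
    and Fyy: "\<And>x y. \<lbrakk>x1 < x; x < x2; y1 < y; y < y2\<rbrakk> \<Longrightarrow> ((\<lambda>s. Fy x s) has_real_derivative Fyy x y) (at y)"
    and bd: "\<And>x y. \<lbrakk>x1 \<le> x; x \<le> x2; y1 \<le> y; y \<le> y2; x = x1 \<or> x = x2 \<or> y = y1 \<or> y = y2\<rbrakk> \<Longrightarrow> F x y \<le> 0"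
    and sub: "\<And>x y. \<lbrakk>x1 < x; x < x2; y1 < y; y < y2; Fx x y = 0; Fy x y = 0\<rbrakk> \<Longrightarrow> Fxx x y + Fyy x y > 0"
    and xy: "x1 \<le> x" "x \<le> x2" "y1 \<le> y" "y \<le> y2"
  shows "F x y \<le> 0"
proof (rule ccontr)
  assume neg: "\<not> F x y \<le> 0"
  have "compact ({x1..x2} \<times> {y1..y2})" by (intro compact_Times compact_Icc)
  moreover have "{x1..x2} \<times> {y1..y2} \<noteq> {}" using xy by auto
  ultimately obtain m where m: "m \<in> {x1..x2} \<times> {y1..y2}"
      "\<And>z. z \<in> {x1..x2} \<times> {y1..y2} \<Longrightarrow> F (fst z) (snd z) \<le> F (fst m) (snd m)"
    using continuous_attains_sup[OF _ _ cont] by blast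
  obtain p q where mpq: "m = (p, q)" by (cases m)
  have pq: "x1 \<le> p" "p \<le> x2" "y1 \<le> q" "q \<le> y2" using m mpq by auto
  have mx: "F s t \<le> F p q" if "x1 \<le> s" "s \<le> x2" "y1 \<le> t" "t \<le> y2" for s t
    using m(2)[of "(s,t)"] that mpq by auto
  have "F p q > 0" using mx[OF xy] neg by auto
  then have int: "x1 < p" "p < x2" "y1 < q" "q < y2"
    using bd[OF pq] pq by (auto simp: order.strict_iff_order)
  define e where "e = min (min (p - x1) (x2 - p)) (min (q - y1) (y2 - q))"
  have e: "e > 0" "e \<le> p - x1" "e \<le> x2 - p" "e \<le> q - y1" "e \<le> y2 - q" using int by (auto simp: e_def)
  have "((\<lambda>s. F s q) has_real_derivative Fx x q) (at x) \<and> F x q \<le> F p q" if "\<bar>x - p\<bar> < e" for x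
    using that e int by (auto intro!: Fx mx)
  then have "Fx p q = 0 \<and> Fxx p q \<le> 0"
    using second_deriv_nonpos_at_max[OF e(1), of p "\<lambda>s. F s q" "\<lambda>s. Fx s q"] Fxx[OF int] by blast
  moreover have "((\<lambda>s. F p s) has_real_derivative Fy p y) (at y) \<and> F p y \<le> F p q" if "\<bar>y - q\<bar> < e" for y
    using that e int by (auto intro!: Fy mx)
  then have "Fy p q = 0 \<and> Fyy p q \<le> 0"
    using second_deriv_nonpos_at_max[OF e(1), of q "\<lambda>s. F p s" "\<lambda>s. Fy p s"] Fyy[OF int] by blast
  ultimately show False using sub[OF int] by auto
qed

text \<open>Turns a barrier that touches a function at \<open>z\<close> into a bound on the
  derivative of the function. The one-sided comparison suits points where the barrier is available
  on one side only, in particular boundary points.\<close>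

lemma deriv_le_of_le:
  fixes f g :: "real \<Rightarrow> real"
  assumes f: "(f has_real_derivative D) (at z)" and g: "(g has_real_derivative E) (at z)"
    and e: "e > 0" and le: "\<And>s. 0 < s \<Longrightarrow> s < e \<Longrightarrow> f (z + s) \<le> g (z + s)" and eq: "f z = g z"
  shows "D \<le> E"
proof (rule ccontr)
  assume "\<not> D \<le> E"
  then have "D - E > 0" by simp
  with DERIV_pos_inc_right[OF DERIV_diff[OF f g]] obtain d where
    d: "d > 0" "\<And>h. 0 < h \<Longrightarrow> h < d \<Longrightarrow> f z - g z < f (z + h) - g (z + h)" by auto
  have "0 < min d e / 2" "min d e / 2 < d" "min d e / 2 < e" using d(1) e by auto
  then show False using d(2)[of "min d e / 2"] le[of "min d e / 2"] eq by auto
qed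

lemma DERIV_reflect:
  fixes f :: "real \<Rightarrow> real"
  assumes "(f has_real_derivative D) (at (c - x))"
  shows "((\<lambda>s. f (c - s)) has_real_derivative - D) (at x)"
proof -
  have "((\<lambda>s. c - s) has_real_derivative -1) (at x)" by (auto intro!: derivative_eq_intros)
  from DERIV_chain2[where f = f and g = "\<lambda>s. c - s", OF assms this] show ?thesis by simp
qed

lemma DERIV_translate:
  fixes f :: "real \<Rightarrow> real"
  assumes "(f has_real_derivative D) (at (c + x))"
  shows "((\<lambda>s. f (c + s)) has_real_derivative D) (at x)"
proof -
  have "((\<lambda>s. c + s) has_real_derivative 1) (at x)" by (auto intro!: derivative_eq_intros)
  from DERIV_chain2[where f = f and g = "\<lambda>s. c + s", OF assms this] show ?thesis by simp
qed

text \<open>Instantiated with the stream function minus its linear part and then with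
  \<open>b\<close>. The strict bound on the Laplacian makes the explicit quadratic barriers below
  strict, as \<open>rectangle_max_principle\<close> requires.\<close>

locale strip_dirichlet =
  fixes w wx wy wxx wyy :: "real \<Rightarrow> real \<Rightarrow> real" and A B :: real
  assumes cont: "continuous_on (UNIV \<times> {0..1}) (\<lambda>z. w (fst z) (snd z))"
    and wx: "\<And>x y. 0 < y \<Longrightarrow> y < 1 \<Longrightarrow> ((\<lambda>s. w s y) has_real_derivative wx x y) (at x)"
    and wy: "\<And>x y. 0 < y \<Longrightarrow> y < 1 \<Longrightarrow> ((\<lambda>s. w x s) has_real_derivative wy x y) (at y)"
    and wxx: "\<And>x y. 0 < y \<Longrightarrow> y < 1 \<Longrightarrow> ((\<lambda>s. wx s y) has_real_derivative wxx x y) (at x)"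
    and wyy: "\<And>x y. 0 < y \<Longrightarrow> y < 1 \<Longrightarrow> ((\<lambda>s. wy x s) has_real_derivative wyy x y) (at y)"
    and bd: "\<And>x. w x 0 = 0" "\<And>x. w x 1 = 0"
    and A: "\<And>x y. 0 < y \<Longrightarrow> y < 1 \<Longrightarrow> \<bar>w x y\<bar> \<le> A"
    and B: "\<And>x y. 0 < y \<Longrightarrow> y < 1 \<Longrightarrow> \<bar>wxx x y + wyy x y\<bar> < B"
begin

lemma A_nonneg: "A \<ge> 0" and B_pos: "B > 0"
  using A[of "1/2" 0] B[of "1/2" 0] by auto

lemmas wx_add = DERIV_translate[where f = "\<lambda>s. w s _", OF wx]
  and wx_diff = DERIV_reflect[where f = "\<lambda>s. w s _", OF wx]
  and wxx_add = DERIV_translate[where f = "\<lambda>s. wx s _", OF wxx]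
  and wxx_diff = DERIV_reflect[where f = "\<lambda>s. wx s _", OF wxx]
  and wy_add = DERIV_translate[where f = "w _", OF wy]
  and wy_diff = DERIV_reflect[where f = "w _", OF wy]
  and wyy_add = DERIV_translate[where f = "wy _", OF wyy]
  and wyy_diff = DERIV_reflect[where f = "wy _", OF wyy]

lemma A_closed: "0 \<le> y \<Longrightarrow> y \<le> 1 \<Longrightarrow> \<bar>w x y\<bar> \<le> A"
  using A[of y x] bd[of x] A_nonneg by (cases "y = 0 \<or> y = 1") auto

lemma neg: "strip_dirichlet (\<lambda>x y. - w x y) (\<lambda>x y. - wx x y) (\<lambda>x y. - wy x y)
    (\<lambda>x y. - wxx x y) (\<lambda>x y. - wyy x y) A B"
proof
  show "continuous_on (UNIV \<times> {0..1}) (\<lambda>z. - w (fst z) (snd z))" by (intro continuous_intros cont)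
  show "\<bar>- wxx x y + - wyy x y\<bar> < B" if "0 < y" "y < 1" for x y using B[OF that, of x] by arith
qed (use wx wy wxx wyy bd A in \<open>auto intro: DERIV_minus\<close>)

text \<open>The comparison runs on a rectangle of half-width 1 centred at \<open>x0\<close>. The
  extra term \<open>A * x^2\<close> beats \<open>w\<close> on the lateral sides and vanishes on the
  middle line, where the result is read off; the coefficient \<open>A + B/2\<close> makes the
  Laplacian of the whole barrier equal to \<open>-B\<close>.\<close>

lemma le_parabola:
  assumes y: "0 \<le> y" "y \<le> 1"
  shows "w x0 y \<le> (A + B/2) * (y * (1 - y))"
proof -
  have "w (x0 + 0) y - (A * 0\<^sup>2 + (A + B/2) * (y * (1 - y))) \<le> 0"
  proof (rule rectangle_max_principle[where ?x1.0 = "-1" and ?x2.0 = 1 and ?y1.0 = 0 and ?y2.0 = 1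
       and F = "\<lambda>x y. w (x0 + x) y - (A * x\<^sup>2 + (A + B/2) * (y * (1 - y)))"
       and Fx = "\<lambda>x y. wx (x0 + x) y - 2 * A * x" and Fxx = "\<lambda>x y. wxx (x0 + x) y - 2 * A"
       and Fy = "\<lambda>x y. wy (x0 + x) y - (A + B/2) * (1 - 2 * y)" and Fyy = "\<lambda>x y. wyy (x0 + x) y + (2 * A + B)"])
    show "continuous_on ({- 1..1} \<times> {0..1})
     (\<lambda>z. w (x0 + fst z) (snd z) - (A * (fst z)\<^sup>2 + (A + B / 2) * (snd z * (1 - snd z))))"
      by (intro continuous_intros continuous_on_compose2[OF cont, of _ "\<lambda>z. (x0 + fst z, snd z)", simplified]) auto
  next
    fix x y :: real assume *: "-1 < x" "x < 1" "0 < y" "y < 1"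
    show "((\<lambda>s. w (x0 + s) y - (A * s\<^sup>2 + (A + B / 2) * (y * (1 - y)))) has_real_derivative wx (x0 + x) y - 2 * A * x) (at x)"
      using * by (auto intro!: derivative_eq_intros wx_add)
    show "((\<lambda>s. wx (x0 + s) y - 2 * A * s) has_real_derivative wxx (x0 + x) y - 2 * A) (at x)"
      using * by (auto intro!: derivative_eq_intros wxx_add)
    show "((\<lambda>s. w (x0 + x) s - (A * x\<^sup>2 + (A + B / 2) * (s * (1 - s)))) has_real_derivative wy (x0 + x) y - (A + B / 2) * (1 - 2 * y)) (at y)"
      using * by (auto intro!: derivative_eq_intros wy)
    show "((\<lambda>s. wy (x0 + x) s - (A + B / 2) * (1 - 2 * s)) has_real_derivative wyy (x0 + x) y + (2 * A + B)) (at y)"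
      using * by (auto intro!: derivative_eq_intros wyy)
    show "wxx (x0 + x) y - 2 * A + (wyy (x0 + x) y + (2 * A + B)) > 0"
      using B[of y "x0 + x"] * by auto
  next
    fix x y :: real assume *: "-1 \<le> x" "x \<le> 1" "0 \<le> y" "y \<le> 1" "x = -1 \<or> x = 1 \<or> y = 0 \<or> y = 1"
    have p: "(A + B / 2) * (y * (1 - y)) \<ge> 0" "A * x\<^sup>2 \<ge> 0" using A_nonneg B_pos * by auto
    show "w (x0 + x) y - (A * x\<^sup>2 + (A + B / 2) * (y * (1 - y))) \<le> 0"
    proof (cases "y = 0 \<or> y = 1")
      case True then show ?thesis using p bd[of "x0 + x"] by auto
    next
      case False
      then have "x\<^sup>2 = 1" using * by auto
      then show ?thesis using p A_closed[of y "x0+x"] * by auto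
    qed
  qed (use y in auto)
  then show ?thesis by simp
qed

text \<open>Comparison of the antisymmetrized differences with a barrier bounds the first derivatives.\<close>

lemma wx_le:
  assumes y: "0 < y" "y < 1"
  shows "wx x0 y \<le> A + B/2"
proof -
  \<comment> \<open>The difference vanishes for \<open>s = 0\<close> and on both boundary lines, and
    is at most \<open>2 * A\<close> for \<open>s = 1\<close>. Its Laplacian exceeds
    \<open>- 2 * B\<close>, which the term \<open>B * (s * (1 - s))\<close> compensates. The slope
    of the barrier at \<open>s = 0\<close> is the bound on \<open>2 * wx\<close>.\<close>
  have le: "(w (x0 + s) y - w (x0 - s) y) - (2 * A * s + B * (s * (1 - s))) \<le> 0" if s: "0 \<le> s" "s \<le> 1" for s
  proof (rule rectangle_max_principle[where ?x1.0 = 0 and ?x2.0 = 1 and ?y1.0 = 0 and ?y2.0 = 1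
       and F = "\<lambda>s y. w (x0 + s) y - w (x0 - s) y - (2 * A * s + B * (s * (1 - s)))"
       and Fx = "\<lambda>s y. wx (x0 + s) y + wx (x0 - s) y - (2 * A + B * (1 - 2 * s))" and Fxx = "\<lambda>s y. wxx (x0 + s) y - wxx (x0 - s) y + 2 * B"
       and Fy = "\<lambda>s y. wy (x0 + s) y - wy (x0 - s) y" and Fyy = "\<lambda>s y. wyy (x0 + s) y - wyy (x0 - s) y"])
    show "continuous_on ({0..1} \<times> {0..1})
     (\<lambda>z. w (x0 + fst z) (snd z) - w (x0 - fst z) (snd z) - (2 * A * fst z + B * (fst z * (1 - fst z))))"
      by (intro continuous_intros continuous_on_compose2[OF cont, of _ "\<lambda>z. (x0 + fst z, snd z)", simplified]
           continuous_on_compose2[OF cont, of _ "\<lambda>z. (x0 - fst z, snd z)", simplified]) auto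
  next
    fix s y :: real assume *: "0 < s" "s < 1" "0 < y" "y < 1"
    show "((\<lambda>s. w (x0 + s) y - w (x0 - s) y - (2 * A * s + B * (s * (1 - s)))) has_real_derivative
       wx (x0 + s) y + wx (x0 - s) y - (2 * A + B * (1 - 2 * s))) (at s)"
      using * by (auto intro!: derivative_eq_intros wx_add wx_diff)
    show "((\<lambda>s. wx (x0 + s) y + wx (x0 - s) y - (2 * A + B * (1 - 2 * s))) has_real_derivative
       wxx (x0 + s) y - wxx (x0 - s) y + 2 * B) (at s)"
      using * by (auto intro!: derivative_eq_intros wxx_add wxx_diff)
    show "((\<lambda>t. w (x0 + s) t - w (x0 - s) t - (2 * A * s + B * (s * (1 - s)))) has_real_derivative
       wy (x0 + s) y - wy (x0 - s) y) (at y)"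
      using * by (auto intro!: derivative_eq_intros wy)
    show "((\<lambda>t. wy (x0 + s) t - wy (x0 - s) t) has_real_derivative wyy (x0 + s) y - wyy (x0 - s) y) (at y)"
      using * by (auto intro!: derivative_eq_intros wyy)
    show "wxx (x0 + s) y - wxx (x0 - s) y + 2 * B + (wyy (x0 + s) y - wyy (x0 - s) y) > 0"
      using B[of y "x0 + s"] B[of y "x0 - s"] * by auto
  next
    fix s y :: real assume *: "0 \<le> s" "s \<le> 1" "0 \<le> y" "y \<le> 1" "s = 0 \<or> s = 1 \<or> y = 0 \<or> y = 1"
    have p: "B * (s * (1 - s)) \<ge> 0" "2 * A * s \<ge> 0" using A_nonneg B_pos * by auto
    have q: "\<bar>w (x0 + s) y\<bar> \<le> A" "\<bar>w (x0 - s) y\<bar> \<le> A" using A_closed * by auto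
    show "w (x0 + s) y - w (x0 - s) y - (2 * A * s + B * (s * (1 - s))) \<le> 0"
      using *(5) p q bd by auto
  qed (use y s in auto)
  have "2 * wx x0 y \<le> 2 * A + B"
  proof (rule deriv_le_of_le[where z = 0 and e = 1])
    show "((\<lambda>s. w (x0 + s) y - w (x0 - s) y) has_real_derivative 2 * wx x0 y) (at 0)"
      using y by (auto intro!: derivative_eq_intros wx_add wx_diff)
    show "((\<lambda>s. 2 * A * s + B * (s * (1 - s))) has_real_derivative 2 * A + B) (at 0)"
      by (auto intro!: derivative_eq_intros)
  qed (use le in auto)
  then show ?thesis by simp
qed

lemma abs_le_parabola: 
  assumes y: "0 \<le> y" "y \<le> 1"
  shows "\<bar>w x0 y\<bar> \<le> (A + B/2) * (y * (1 - y))"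
  using le_parabola[OF assms, of x0] strip_dirichlet.le_parabola[OF neg assms, of x0] by auto

lemma wy_le:
  assumes y0: "0 < y0" "y0 < 1"
  shows "wy x0 y0 \<le> 4 * A + 2 * B"
proof -
  define K where "K = A + B/2"
  \<comment> \<open>The distance to the boundary is the largest reach for which both
    \<open>y0 + s\<close> and \<open>y0 - s\<close> stay in the strip. At \<open>s = d\<close> one
    of the two points lies on the boundary and the other at distance \<open>2 * d\<close> from it,
    so the parabola estimate makes the difference \<open>O(d)\<close>. A barrier whose slope is
    independent of \<open>d\<close> then suffices.\<close>
  define d where "d = min y0 (1 - y0)"
  have d: "0 < d" "d \<le> y0" "d \<le> 1 - y0" "d \<le> 1/2" "y0 = d \<or> y0 = 1 - d" using y0 by (auto simp: d_def min_def)
  have K: "K \<ge> 0" using A_nonneg B_pos by (auto simp: K_def)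
  have top: "\<bar>w x (y0 + d)\<bar> \<le> 2 * K * d \<and> \<bar>w x (y0 - d)\<bar> \<le> 2 * K * d \<and> (w x (y0 + d) = 0 \<or> w x (y0 - d) = 0)" for x
  proof -
    have t1: "K * (2 * d * (1 - 2 * d)) \<le> 2 * K * d" using d K 
      using mult_left_mono[of "2*d*(1-2*d)" "2*d" K] by (simp add: algebra_simps)
    have "2 * d \<le> 1" using d by auto
    then have t2: "\<bar>w x (2 * d)\<bar> \<le> 2 * K * d" "\<bar>w x (1 - 2 * d)\<bar> \<le> 2 * K * d"
      using abs_le_parabola[of "2*d" x] abs_le_parabola[of "1 - 2*d" x] d t1 by (auto simp: K_def[symmetric] algebra_simps)
    show ?thesis using d(5)
    proof
      assume e: "y0 = d"
      then have eqs: "y0 + d = 2 * d" "y0 - d = 0" by auto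
      show ?thesis unfolding eqs using t2 bd K d(1) by simp
    next
      assume e: "y0 = 1 - d"
      then have eqs: "y0 + d = 1" "y0 - d = 1 - 2 * d" by auto
      show ?thesis unfolding eqs using t2 bd K d(1) by simp
    qed
  qed
  have le: "(w (x0 + 0) (y0 + s) - w (x0 + 0) (y0 - s)) - (2 * A * 0\<^sup>2 + 2 * K * s + (2 * A + B) * (s * (d - s))) \<le> 0"
    if s: "0 \<le> s" "s \<le> d" for s
  proof (rule rectangle_max_principle[where ?x1.0 = "-1" and ?x2.0 = 1 and ?y1.0 = 0 and ?y2.0 = d
       and F = "\<lambda>x s. w (x0 + x) (y0 + s) - w (x0 + x) (y0 - s) - (2 * A * x\<^sup>2 + 2 * K * s + (2 * A + B) * (s * (d - s)))"
       and Fx = "\<lambda>x s. wx (x0 + x) (y0 + s) - wx (x0 + x) (y0 - s) - 4 * A * x"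
       and Fxx = "\<lambda>x s. wxx (x0 + x) (y0 + s) - wxx (x0 + x) (y0 - s) - 4 * A"
       and Fy = "\<lambda>x s. wy (x0 + x) (y0 + s) + wy (x0 + x) (y0 - s) - (2 * K + (2 * A + B) * (d - 2 * s))"
       and Fyy = "\<lambda>x s. wyy (x0 + x) (y0 + s) - wyy (x0 + x) (y0 - s) + 2 * (2 * A + B)"])
    show "continuous_on ({- 1..1} \<times> {0..d})
     (\<lambda>z. w (x0 + fst z) (y0 + snd z) - w (x0 + fst z) (y0 - snd z) -
           (2 * A * (fst z)\<^sup>2 + 2 * K * snd z + (2 * A + B) * (snd z * (d - snd z))))"
      by (intro continuous_intros continuous_on_compose2[OF cont, of _ "\<lambda>z. (x0 + fst z, y0 + snd z)", simplified]
           continuous_on_compose2[OF cont, of _ "\<lambda>z. (x0 + fst z, y0 - snd z)", simplified]) (use d in auto)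
  next
    fix x s :: real assume *: "-1 < x" "x < 1" "0 < s" "s < d"
    then have in1: "0 < y0 + s" "y0 + s < 1" "0 < y0 - s" "y0 - s < 1" using d y0 by auto
    show "((\<lambda>x. w (x0 + x) (y0 + s) - w (x0 + x) (y0 - s) - (2 * A * x\<^sup>2 + 2 * K * s + (2 * A + B) * (s * (d - s)))) has_real_derivative
       wx (x0 + x) (y0 + s) - wx (x0 + x) (y0 - s) - 4 * A * x) (at x)"
      using in1 by (auto intro!: derivative_eq_intros wx_add)
    show "((\<lambda>x. wx (x0 + x) (y0 + s) - wx (x0 + x) (y0 - s) - 4 * A * x) has_real_derivative
       wxx (x0 + x) (y0 + s) - wxx (x0 + x) (y0 - s) - 4 * A) (at x)"
      using in1 by (auto intro!: derivative_eq_intros wxx_add)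
    show "((\<lambda>s. w (x0 + x) (y0 + s) - w (x0 + x) (y0 - s) - (2 * A * x\<^sup>2 + 2 * K * s + (2 * A + B) * (s * (d - s)))) has_real_derivative
       wy (x0 + x) (y0 + s) + wy (x0 + x) (y0 - s) - (2 * K + (2 * A + B) * (d - 2 * s))) (at s)"
      using in1 by (auto intro!: derivative_eq_intros wy_add wy_diff)
    show "((\<lambda>s. wy (x0 + x) (y0 + s) + wy (x0 + x) (y0 - s) - (2 * K + (2 * A + B) * (d - 2 * s))) has_real_derivative
       wyy (x0 + x) (y0 + s) - wyy (x0 + x) (y0 - s) + 2 * (2 * A + B)) (at s)"
      using in1 by (auto intro!: derivative_eq_intros wyy_add wyy_diff)
    show "wxx (x0 + x) (y0 + s) - wxx (x0 + x) (y0 - s) - 4 * A + (wyy (x0 + x) (y0 + s) - wyy (x0 + x) (y0 - s) + 2 * (2 * A + B)) > 0"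
      using B[OF in1(1,2), of "x0 + x"] B[OF in1(3,4), of "x0 + x"] by auto
  next
    fix x s :: real assume *: "-1 \<le> x" "x \<le> 1" "0 \<le> s" "s \<le> d" "x = -1 \<or> x = 1 \<or> s = 0 \<or> s = d"
    have p: "(2 * A + B) * (s * (d - s)) \<ge> 0" "2 * K * s \<ge> 0" "2 * A * x\<^sup>2 \<ge> 0" using A_nonneg B_pos K * by auto
    have q: "\<bar>w (x0 + x) (y0 + s)\<bar> \<le> A" "\<bar>w (x0 + x) (y0 - s)\<bar> \<le> A" using A_closed * d y0 by auto
    consider "x\<^sup>2 = 1" | "s = 0" | "s = d" using *(5) by auto
    then show "w (x0 + x) (y0 + s) - w (x0 + x) (y0 - s) - (2 * A * x\<^sup>2 + 2 * K * s + (2 * A + B) * (s * (d - s))) \<le> 0"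
    proof cases
      case 1 then show ?thesis using p q by auto
    next
      case 2 then show ?thesis using p by auto
    next
      case 3 then show ?thesis using p top[of "x0 + x"] by auto
    qed
  qed (use d s in auto)
  have "2 * wy x0 y0 \<le> 2 * K + (2 * A + B) * d"
  proof (rule deriv_le_of_le[where z = 0 and e = d])
    show "((\<lambda>s. w x0 (y0 + s) - w x0 (y0 - s)) has_real_derivative 2 * wy x0 y0) (at 0)"
      using y0 by (auto intro!: derivative_eq_intros wy_add wy_diff)
    show "((\<lambda>s. 2 * K * s + (2 * A + B) * (s * (d - s))) has_real_derivative 2 * K + (2 * A + B) * d) (at 0)"
      by (auto intro!: derivative_eq_intros)
  qed (use le d in auto)
  moreover have "(2 * A + B) * d \<le> 2 * A + B" using A_nonneg B_pos d by (intro mult_left_le) auto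
  ultimately have "2 * wy x0 y0 \<le> 2 * K + (2 * A + B)" by linarith
  then show ?thesis using A_nonneg B_pos by (simp add: K_def)
qed

lemma gradient_bound:
  assumes "0 < y" "y < 1"
  shows "\<bar>wx x y\<bar> \<le> 4 * A + 2 * B" "\<bar>wy x y\<bar> \<le> 4 * A + 2 * B"
  using wx_le[OF assms, of x] wy_le[OF assms, of x] strip_dirichlet.wx_le[OF neg assms, of x]
    strip_dirichlet.wy_le[OF neg assms, of x] A_nonneg B_pos by auto

end

section \<open>Connectedness of level sets\<close>

text \<open>A set of bounded \<open>f\<close>-height can be pushed onto the level \<open>t\<close> by finitely many short steps along
  the normalized gradient, each lowering \<open>\<bar>f - t\<bar>\<close> by a fixed amount; the total displacement is
  controlled by the total change of \<open>f\<close>, so that all steps stay in one compact ball.\<close>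

lemma gradient_step:
  fixes f :: "'a::euclidean_space \<Rightarrow> real" and G :: "'a \<Rightarrow> 'a"
  assumes f: "\<And>x. (f has_derivative (\<lambda>h. G x \<bullet> h)) (at x)"
    and G: "continuous_on UNIV G"
    and eta: "\<eta> > 0" "\<And>x. norm (G x) \<ge> \<eta>"
  obtains \<epsilon> T where "\<epsilon> > 0" "continuous_on {x. norm x + 2/\<eta> * \<bar>f x - t\<bar> \<le> R} T"
    "\<And>x. norm x + 2/\<eta> * \<bar>f x - t\<bar> \<le> R \<Longrightarrow> norm (T x) + 2/\<eta> * \<bar>f (T x) - t\<bar> \<le> R"
    "\<And>x. norm x + 2/\<eta> * \<bar>f x - t\<bar> \<le> R \<Longrightarrow> \<bar>f (T x) - t\<bar> \<le> max 0 (\<bar>f x - t\<bar> - \<epsilon>)"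
    "\<And>x. norm x + 2/\<eta> * \<bar>f x - t\<bar> \<le> R \<Longrightarrow> f x = t \<Longrightarrow> T x = x"
proof -
  \<comment> \<open>\<open>Z\<close> carries a budget: a step that lowers \<open>|f - t|\<close> by
    some amount has length at most \<open>2/\<eta>\<close> times that amount, so the sum bounded by
    \<open>R\<close> never increases. This keeps every iterate in the ball of radius
    \<open>R\<close>, where one step size works for all points.\<close>
  define Z where "Z = {x. norm x + 2/\<eta> * \<bar>f x - t\<bar> \<le> R}"
  define \<nu> where "\<nu> x = G x /\<^sub>R norm (G x)" for x
  have G0: "norm (G x) > 0" for x using eta(1) eta(2)[of x] by linarith
  have \<nu>1: "norm (\<nu> x) = 1" for x using G0[of x] by (simp add: \<nu>_def)
  have G\<nu>: "G x \<bullet> \<nu> x = norm (G x)" for x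
    using G0[of x] by (simp add: \<nu>_def dot_square_norm power2_eq_square)
  have contf: "continuous_on UNIV f"
    using f by (intro has_derivative_continuous_on) (auto intro: has_derivative_at_withinI)
  have cont\<nu>: "continuous_on UNIV \<nu>"
    unfolding \<nu>_def using G0 by (intro continuous_intros G) auto
  have "uniformly_continuous_on (cball 0 (R + 1)) G"
    by (rule compact_uniformly_continuous) (auto intro: continuous_on_subset[OF G])
  then obtain d0 where d0: "d0 > 0" "\<And>x y. x \<in> cball 0 (R+1) \<Longrightarrow> y \<in> cball 0 (R+1) \<Longrightarrow> dist y x < d0 \<Longrightarrow> dist (G y) (G x) < \<eta>/2"
    unfolding uniformly_continuous_on_def using eta(1) by (metis half_gt_zero)
  define \<delta> where "\<delta> = min d0 1 / 2"
  have \<delta>: "0 < \<delta>" "\<delta> < d0" "\<delta> < 1" using d0(1) by (auto simp: \<delta>_def)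
  \<comment> \<open>The change of \<open>f\<close> guaranteed by a displacement
    \<open>\<delta>\<close> along \<open>\<nu>\<close> when the slope is at least
    \<open>\<eta>/2\<close>.\<close>
  define \<epsilon> where "\<epsilon> = \<eta> * \<delta> / 2"
  have \<epsilon>: "\<epsilon> > 0" using eta(1) \<delta> by (simp add: \<epsilon>_def)
  define \<phi> where "\<phi> x s = f (x + s *\<^sub>R \<nu> x)" for x s
  have d\<phi>: "(\<phi> x has_real_derivative G (x + s *\<^sub>R \<nu> x) \<bullet> \<nu> x) (at s)" for x s
  proof -
    have "((\<lambda>s. x + s *\<^sub>R \<nu> x) has_derivative (\<lambda>h. h *\<^sub>R \<nu> x)) (at s)"
      by (auto intro!: derivative_eq_intros)
    from has_derivative_compose[OF this f] have "(\<phi> x has_derivative (\<lambda>h. G (x + s *\<^sub>R \<nu> x) \<bullet> (h *\<^sub>R \<nu> x))) (at s)"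
      unfolding \<phi>_def .
    then show ?thesis
      unfolding has_field_derivative_def by (rule has_derivative_eq_rhs) (simp add: fun_eq_iff)
  qed
  have slope: "G (x + s *\<^sub>R \<nu> x) \<bullet> \<nu> x \<ge> \<eta>/2" if x: "norm x \<le> R" and s: "\<bar>s\<bar> \<le> \<delta>" for x s
  proof -
    have 1: "norm (x + s *\<^sub>R \<nu> x) \<le> R + 1"
    proof -
      have "norm (s *\<^sub>R \<nu> x) = \<bar>s\<bar>" using \<nu>1[of x] by simp
      then show ?thesis using norm_triangle_ineq[of x "s *\<^sub>R \<nu> x"] x s \<delta>(3) by linarith
    qed
    have "dist (G (x + s *\<^sub>R \<nu> x)) (G x) < \<eta>/2"
    proof (rule d0(2))
      show "dist (x + s *\<^sub>R \<nu> x) x < d0" using \<nu>1[of x] s \<delta> by (simp add: dist_norm)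
    qed (use 1 x in simp_all)
    then have "\<bar>(G (x + s *\<^sub>R \<nu> x) - G x) \<bullet> \<nu> x\<bar> < \<eta>/2"
      using Cauchy_Schwarz_ineq2[of "G (x + s *\<^sub>R \<nu> x) - G x" "\<nu> x"] \<nu>1[of x] by (simp add: dist_norm)
    then have "\<bar>G (x + s *\<^sub>R \<nu> x) \<bullet> \<nu> x - norm (G x)\<bar> < \<eta>/2"
      using G\<nu>[of x] by (simp add: inner_diff_left)
    then show ?thesis using eta(2)[of x] by linarith
  qed
  have incr: "\<phi> x b - \<phi> x a \<ge> \<eta>/2 * (b - a)" if x: "norm x \<le> R" and ab: "-\<delta> \<le> a" "a \<le> b" "b \<le> \<delta>" for x a b
  proof (cases "a = b")
    case False
    then have "a < b" using ab by simp
    have "\<exists>z. a < z \<and> z < b \<and> \<phi> x b - \<phi> x a = (b - a) * (G (x + z *\<^sub>R \<nu> x) \<bullet> \<nu> x)"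
      by (rule MVT2[OF \<open>a < b\<close>]) (rule d\<phi>)
    then obtain z where z: "a < z" "z < b" "\<phi> x b - \<phi> x a = (b - a) * (G (x + z *\<^sub>R \<nu> x) \<bullet> \<nu> x)"
      by auto
    have "(b - a) * (G (x + z *\<^sub>R \<nu> x) \<bullet> \<nu> x) \<ge> (b - a) * (\<eta>/2)"
      by (rule mult_left_mono) (use slope[OF x, of z] z ab in auto)
    then show ?thesis using z(3) by (simp add: mult.commute)
  qed simp
  \<comment> \<open>The desired change of \<open>f\<close>: the full gap to \<open>t\<close>,
    clipped at \<open>\<epsilon>\<close>. It vanishes on the level, which is why points there stay
    fixed.\<close>
  define r where "r x = max (-\<epsilon>) (min \<epsilon> (t - f x))" for x
  have contr: "continuous_on UNIV r" unfolding r_def by (intro continuous_intros contf)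
  have rb: "\<bar>r x\<bar> \<le> \<epsilon>" for x using \<epsilon> by (auto simp: r_def)
  have ex: "\<exists>s. \<bar>s\<bar> \<le> \<delta> \<and> \<phi> x s = f x + r x" if x: "norm x \<le> R" for x
  proof -
    have 0: "\<phi> x 0 = f x" by (simp add: \<phi>_def)
    have "\<phi> x \<delta> - \<phi> x 0 \<ge> \<epsilon>" "\<phi> x 0 - \<phi> x (-\<delta>) \<ge> \<epsilon>"
      using incr[OF x, of 0 \<delta>] incr[OF x, of "-\<delta>" 0] \<delta> by (auto simp: \<epsilon>_def)
    then have "\<phi> x (-\<delta>) \<le> f x + r x" "f x + r x \<le> \<phi> x \<delta>" using rb[of x] 0 by auto
    moreover have "continuous_on {-\<delta>..\<delta>} (\<phi> x)"
      by (intro continuous_at_imp_continuous_on ballI DERIV_isCont[OF d\<phi>])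
    ultimately obtain s where "-\<delta> \<le> s" "s \<le> \<delta>" "\<phi> x s = f x + r x"
      using IVT'[of "\<phi> x" "-\<delta>" "f x + r x" \<delta>] \<delta> by auto
    then show ?thesis by (intro exI[of _ s]) auto
  qed
  define \<tau> where "\<tau> x = (SOME s. \<bar>s\<bar> \<le> \<delta> \<and> \<phi> x s = f x + r x)" for x
  have \<tau>: "\<bar>\<tau> x\<bar> \<le> \<delta>" "\<phi> x (\<tau> x) = f x + r x" if "norm x \<le> R" for x
    using someI_ex[OF ex[OF that]] by (auto simp: \<tau>_def)
  \<comment> \<open>The slope bound makes the chosen displacement unique and controls it by the
    residual of its defining equation. Continuity of \<open>\<tau>\<close> follows directly; the
    direction \<open>\<nu>\<close> depends only continuously on the point, so differentiability in
    \<open>x\<close> is not at hand.\<close>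
  have lip: "\<eta>/2 * \<bar>s - \<tau> x\<bar> \<le> \<bar>\<phi> x s - (f x + r x)\<bar>" if x: "norm x \<le> R" and s: "\<bar>s\<bar> \<le> \<delta>" for x s
  proof (cases "s \<le> \<tau> x")
    case True
    then have "\<eta>/2 * (\<tau> x - s) \<le> \<phi> x (\<tau> x) - \<phi> x s" and e: "\<bar>s - \<tau> x\<bar> = \<tau> x - s"
      using \<tau>(1)[OF x] s incr[OF x, of s "\<tau> x"] by (auto simp: abs_le_iff)
    then show ?thesis unfolding e using \<tau>(2)[OF x] by linarith
  next
    case False
    then have "\<eta>/2 * (s - \<tau> x) \<le> \<phi> x s - \<phi> x (\<tau> x)" and e: "\<bar>s - \<tau> x\<bar> = s - \<tau> x"
      using \<tau>(1)[OF x] s incr[OF x, of "\<tau> x" s] by (auto simp: abs_le_iff)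
    then show ?thesis unfolding e using \<tau>(2)[OF x] by linarith
  qed
  have \<tau>r: "\<bar>\<tau> x\<bar> \<le> 2/\<eta> * \<bar>r x\<bar>" if x: "norm x \<le> R" for x
    using lip[OF x, of 0] \<delta> eta(1) by (simp add: \<phi>_def field_simps)
  have cont\<tau>: "continuous_on (cball 0 R) \<tau>"
  proof (rule continuous_onI)
    fix x :: 'a and e assume x: "x \<in> cball 0 R" and e: "(0::real) < e"
    define g where "g y = \<phi> y (\<tau> x) - (f y + r y)" for y
    have contg: "continuous_on UNIV g" unfolding g_def \<phi>_def
      by (intro continuous_intros contr contf cont\<nu> continuous_on_compose2[OF contf]) auto
    have gx: "g x = 0" using \<tau>(2)[of x] x by (simp add: g_def)
    have "\<eta>/2 * e > 0" using e eta(1) by simp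
    with contg obtain d where d: "d > 0" "\<And>y. dist y x < d \<Longrightarrow> dist (g y) (g x) < \<eta>/2 * e"
      unfolding continuous_on_iff by (metis UNIV_I)
    show "\<exists>d>0. \<forall>y\<in>cball 0 R. dist y x < d \<longrightarrow> dist (\<tau> y) (\<tau> x) \<le> e"
    proof (intro exI[of _ d] conjI ballI impI d(1))
      fix y assume y: "y \<in> cball 0 R" "dist y x < d"
      have "\<eta>/2 * \<bar>\<tau> x - \<tau> y\<bar> \<le> \<bar>g y\<bar>" unfolding g_def by (rule lip) (use x y \<tau>(1)[of x] in auto)
      also have "\<dots> < \<eta>/2 * e" using d(2)[OF y(2)] gx by (simp add: dist_real_def)
      finally show "dist (\<tau> y) (\<tau> x) \<le> e" using eta(1) by (simp add: dist_real_def)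
    qed
  qed
  define T where "T x = x + \<tau> x *\<^sub>R \<nu> x" for x
  have Zsub: "Z \<subseteq> cball 0 R"
  proof
    fix x assume "x \<in> Z"
    moreover have "2/\<eta> * \<bar>f x - t\<bar> \<ge> 0" using eta(1) by simp
    ultimately show "x \<in> cball 0 R" unfolding Z_def by auto
  qed
  have contT: "continuous_on Z T" unfolding T_def
    by (intro continuous_intros continuous_on_subset[OF cont\<tau> Zsub] continuous_on_subset[OF cont\<nu>]) auto
  show thesis
  proof (rule that[of \<epsilon> T, OF \<epsilon>])
    show "continuous_on {x. norm x + 2/\<eta> * \<bar>f x - t\<bar> \<le> R} T" using contT by (simp add: Z_def)
  next
    fix x assume xZ: "norm x + 2/\<eta> * \<bar>f x - t\<bar> \<le> R"
    then have x: "norm x \<le> R" using Zsub by (auto simp: Z_def)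
    have fT: "f (T x) = f x + r x" using \<tau>(2)[OF x] by (simp add: T_def \<phi>_def)
    have fTt: "\<bar>f (T x) - t\<bar> = \<bar>f x - t\<bar> - \<bar>r x\<bar>" unfolding fT r_def using \<epsilon> by (auto simp: max_def min_def)
    show "\<bar>f (T x) - t\<bar> \<le> max 0 (\<bar>f x - t\<bar> - \<epsilon>)" unfolding fT r_def using \<epsilon> by (auto simp: max_def min_def)
    have "norm (T x) \<le> norm x + \<bar>\<tau> x\<bar>" unfolding T_def
      using norm_triangle_ineq[of x "\<tau> x *\<^sub>R \<nu> x"] \<nu>1[of x] by simp
    then have "norm (T x) + 2/\<eta> * \<bar>f (T x) - t\<bar> \<le> norm x + 2/\<eta> * \<bar>r x\<bar> + 2/\<eta> * (\<bar>f x - t\<bar> - \<bar>r x\<bar>)"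
      using \<tau>r[OF x] fTt by simp
    also have "\<dots> = norm x + 2/\<eta> * \<bar>f x - t\<bar>" by (simp add: right_diff_distrib)
    finally show "norm (T x) + 2/\<eta> * \<bar>f (T x) - t\<bar> \<le> R" using xZ by simp
    show "T x = x" if "f x = t"
    proof -
      have "r x = 0" using that \<epsilon> by (simp add: r_def)
      then have "\<tau> x = 0" using \<tau>r[OF x] by simp
      then show ?thesis by (simp add: T_def)
    qed
  qed
qed

text \<open>The segment joining two points of the level is the initial connected set. Both endpoints
  are fixed by every step, images stay connected, and after more than \<open>M / \<epsilon>\<close>
  steps the image lies in the level itself.\<close>

lemma level_sets_connected:
  fixes f :: "'a::euclidean_space \<Rightarrow> real" and G :: "'a \<Rightarrow> 'a"
  assumes f: "\<And>x. (f has_derivative (\<lambda>h. G x \<bullet> h)) (at x)"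
    and G: "continuous_on UNIV G"
    and eta: "\<eta> > 0" "\<And>x. norm (G x) \<ge> \<eta>"
  shows "connected {x. f x = t}"
proof -
  have comp: "connected_component {x. f x = t} a b" if a: "f a = t" and b: "f b = t" for a b
  proof -
    have contf: "continuous_on UNIV f"
      using f by (intro has_derivative_continuous_on) (auto intro: has_derivative_at_withinI)
    have "compact ((\<lambda>x. \<bar>f x - t\<bar>) ` closed_segment a b)" "compact ((\<lambda>x. norm x + 2/\<eta> * \<bar>f x - t\<bar>) ` closed_segment a b)"
      by (intro compact_continuous_image compact_segment continuous_intros continuous_on_subset[OF contf]; simp)+
    then have "bdd_above ((\<lambda>x. \<bar>f x - t\<bar>) ` closed_segment a b)" "bdd_above ((\<lambda>x. norm x + 2/\<eta> * \<bar>f x - t\<bar>) ` closed_segment a b)"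
      by (auto intro!: bounded_imp_bdd_above compact_imp_bounded)
    then obtain M R where MR: "\<And>x. x \<in> closed_segment a b \<Longrightarrow> \<bar>f x - t\<bar> \<le> M"
      "\<And>x. x \<in> closed_segment a b \<Longrightarrow> norm x + 2/\<eta> * \<bar>f x - t\<bar> \<le> R"
      unfolding bdd_above_def by auto
    define Z where "Z = {x. norm x + 2/\<eta> * \<bar>f x - t\<bar> \<le> R}"
    obtain \<epsilon> T where \<epsilon>: "\<epsilon> > 0" and T0:
      "continuous_on {x. norm x + 2/\<eta> * \<bar>f x - t\<bar> \<le> R} T"
      "\<And>x. norm x + 2/\<eta> * \<bar>f x - t\<bar> \<le> R \<Longrightarrow> norm (T x) + 2/\<eta> * \<bar>f (T x) - t\<bar> \<le> R"
      "\<And>x. norm x + 2/\<eta> * \<bar>f x - t\<bar> \<le> R \<Longrightarrow> \<bar>f (T x) - t\<bar> \<le> max 0 (\<bar>f x - t\<bar> - \<epsilon>)"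
      "\<And>x. norm x + 2/\<eta> * \<bar>f x - t\<bar> \<le> R \<Longrightarrow> f x = t \<Longrightarrow> T x = x"
      by (rule gradient_step[OF assms, of t R]) (rule that)
    have T: "continuous_on Z T"
      "\<And>x. x \<in> Z \<Longrightarrow> T x \<in> Z" "\<And>x. x \<in> Z \<Longrightarrow> \<bar>f (T x) - t\<bar> \<le> max 0 (\<bar>f x - t\<bar> - \<epsilon>)"
      "\<And>x. x \<in> Z \<Longrightarrow> f x = t \<Longrightarrow> T x = x" unfolding Z_def using T0 by auto
    have it: "\<exists>C. connected C \<and> C \<subseteq> Z \<and> a \<in> C \<and> b \<in> C \<and> (\<forall>x\<in>C. \<bar>f x - t\<bar> \<le> max 0 (M - real n * \<epsilon>))" for n
    proof (induction n)
      case 0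
      show ?case
        by (rule exI[of _ "closed_segment a b"]) (use MR in \<open>auto simp: Z_def le_max_iff_disj\<close>)
    next
      case (Suc n)
      then obtain C where C: "connected C" "C \<subseteq> Z" "a \<in> C" "b \<in> C" "\<And>x. x \<in> C \<Longrightarrow> \<bar>f x - t\<bar> \<le> max 0 (M - real n * \<epsilon>)" by blast
      show ?case
      proof (intro exI[of _ "T ` C"] conjI)
        show "connected (T ` C)" by (rule connected_continuous_image[OF continuous_on_subset[OF T(1) C(2)] C(1)])
        have "T a = a" "T b = b" using T(4) C a b by auto
        then show "a \<in> T ` C" "b \<in> T ` C" using C by (metis imageI)+
        show "T ` C \<subseteq> Z" using T(2) C(2) by auto
        show "\<forall>x\<in>T ` C. \<bar>f x - t\<bar> \<le> max 0 (M - real (Suc n) * \<epsilon>)"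
        proof
          fix y assume "y \<in> T ` C"
          then obtain x where x: "x \<in> C" "y = T x" by auto
          show "\<bar>f y - t\<bar> \<le> max 0 (M - real (Suc n) * \<epsilon>)"
            using T(3)[of x] C(2) C(5)[OF x(1)] x \<epsilon> by (auto simp: max_def algebra_simps split: if_splits)
        qed
      qed
    qed
    obtain n where n: "real n * \<epsilon> > M" using reals_Archimedean3[OF \<epsilon>] by blast
    from it[of n] obtain C where C: "connected C" "a \<in> C" "b \<in> C" "\<And>x. x \<in> C \<Longrightarrow> \<bar>f x - t\<bar> \<le> max 0 (M - real n * \<epsilon>)" by auto
    have "f x = t" if "x \<in> C" for x using C(4)[OF that] n by (simp add: max_def)
    then show ?thesis unfolding connected_component_def using C by (intro exI[of _ C]) auto
  qed
  show ?thesis unfolding connected_iff_connected_component by (intro ballI comp) simp_all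
qed

section \<open>Functions constant along level sets\<close>

text \<open>Two nearby points of a level are joined inside it by a Lipschitz curve, obtained by
  displacing the straight segment along the fixed direction \<open>\<nu>\<close>. At each point of
  the curve \<open>Q - c f\<close>, with \<open>c\<close> frozen there, has zero derivative, and
  \<open>f\<close> is constant along the curve; being Lipschitz is enough to conclude that
  \<open>Q\<close> has zero derivative along it.\<close>

lemma locally_constant_along_level_sets:
  fixes f Q c :: "'a::euclidean_space \<Rightarrow> real" and G :: "'a \<Rightarrow> 'a"
  assumes S: "open S" "z \<in> S"
    and f: "\<And>x. x \<in> S \<Longrightarrow> (f has_derivative (\<lambda>h. G x \<bullet> h)) (at x)"
    and G: "continuous_on S G" "G z \<noteq> 0"
    and Q: "\<And>x. x \<in> S \<Longrightarrow> (Q has_derivative (\<lambda>h. c x * (G x \<bullet> h))) (at x)"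
  obtains e where "e > 0" "\<And>a b. dist a z < e \<Longrightarrow> dist b z < e \<Longrightarrow> f a = f b \<Longrightarrow> Q a = Q b"
proof -
  define g where "g = norm (G z)"
  have g: "g > 0" using G(2) by (simp add: g_def)
  define \<nu> where "\<nu> = G z /\<^sub>R g"
  have \<nu>1: "norm \<nu> = 1" and G\<nu>: "G z \<bullet> \<nu> = g"
    using g by (simp_all add: \<nu>_def g_def dot_square_norm power2_eq_square)
  have "continuous (at z) G" using G(1) S by (simp add: continuous_on_eq_continuous_at)
  then obtain r1 where r1: "r1 > 0" "\<And>x. dist x z < r1 \<Longrightarrow> dist (G x) (G z) < g/2"
    using g unfolding continuous_at_eps_delta by (metis half_gt_zero)
  obtain r2 where r2: "r2 > 0" "ball z r2 \<subseteq> S" using S open_contains_ball by blast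
  \<comment> \<open>The segment stays within \<open>e\<close> of \<open>z\<close>. Along it
    \<open>f\<close> changes by at most \<open>3 * g/2 * (2 * e)\<close>, and the slope along
    \<open>\<nu>\<close> is at least \<open>g/2\<close>, so displacements up to \<open>6 * e\<close>
    recover the level. Everything happens in the ball of radius \<open>7 * e\<close>, which the
    factor 10 fits into the radii \<open>r1\<close> and \<open>r2\<close>.\<close>
  define e where "e = min r1 r2 / 10"
  have e: "e > 0" using r1 r2 by (simp add: e_def)
  define B where "B = ball z (7 * e)"
  have B: "B \<subseteq> S" "convex B" using r2 e by (auto simp: B_def e_def)
  have GB: "norm (G x - G z) < g/2" if "x \<in> B" for x
    using r1(2)[of x] that e by (auto simp: B_def e_def dist_norm dist_commute norm_minus_commute)
  have lipf: "\<bar>f y - f x\<bar> \<le> 3 * g/2 * norm (y - x)" if "x \<in> B" "y \<in> B" for x y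
  proof -
    have "norm (f y - f x) \<le> 3 * g/2 * norm (y - x)"
    proof (rule differentiable_bound[OF B(2)])
      fix u assume u: "u \<in> B"
      show "(f has_derivative (\<lambda>h. G u \<bullet> h)) (at u within B)"
        using f u B by (auto intro: has_derivative_at_withinI)
      have "norm (G u) \<le> 3 * g/2" using GB[OF u] norm_triangle_ineq2[of "G u" "G z"] by (simp add: g_def)
      then have "\<bar>G u \<bullet> h\<bar> \<le> 3 * g/2 * norm h" for h
        using Cauchy_Schwarz_ineq2[of "G u" h] mult_right_mono[OF _ norm_ge_zero[of h], of "norm (G u)" "3 * g/2"] by linarith
      then show "onorm (\<lambda>h. G u \<bullet> h) \<le> 3 * g/2"
        using g by (intro onorm_bound) auto
    qed (use that in auto)
    then show ?thesis by simp
  qed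
  have incr: "f (x + s *\<^sub>R \<nu>) - f x \<ge> g/2 * s" if x: "x \<in> B" "x + s *\<^sub>R \<nu> \<in> B" and s: "s \<ge> 0" for x s
  proof (cases "s = 0")
    case False
    have seg: "x + u *\<^sub>R \<nu> \<in> B" if u: "0 \<le> u" "u \<le> s" for u
    proof -
      have "(1 - u/s) *\<^sub>R x + (u/s) *\<^sub>R (x + s *\<^sub>R \<nu>) \<in> B"
        using x B(2) u False by (intro convexD) (auto simp: divide_simps)
      also have "(1 - u/s) *\<^sub>R x + (u/s) *\<^sub>R (x + s *\<^sub>R \<nu>) = x + u *\<^sub>R \<nu>"
        using False by (simp add: algebra_simps)
      finally show ?thesis .
    qed
    have "\<exists>u. 0 < u \<and> u < s \<and> f (x + s *\<^sub>R \<nu>) - f (x + 0 *\<^sub>R \<nu>) = (s - 0) * (G (x + u *\<^sub>R \<nu>) \<bullet> \<nu>)"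
    proof (rule MVT2)
      show "0 < s" using s False by simp
      fix u assume u: "0 \<le> u" "u \<le> s"
      have "((\<lambda>u. x + u *\<^sub>R \<nu>) has_derivative (\<lambda>h. h *\<^sub>R \<nu>)) (at u)"
        by (auto intro!: derivative_eq_intros)
      from has_derivative_compose[OF this f] seg[OF u] B
      have "((\<lambda>u. f (x + u *\<^sub>R \<nu>)) has_derivative (\<lambda>h. G (x + u *\<^sub>R \<nu>) \<bullet> (h *\<^sub>R \<nu>))) (at u)" by auto
      then show "((\<lambda>u. f (x + u *\<^sub>R \<nu>)) has_real_derivative G (x + u *\<^sub>R \<nu>) \<bullet> \<nu>) (at u)"
        unfolding has_field_derivative_def by (rule has_derivative_eq_rhs) (simp add: fun_eq_iff)
    qed
    then obtain u where u: "0 < u" "u < s" "f (x + s *\<^sub>R \<nu>) - f x = s * (G (x + u *\<^sub>R \<nu>) \<bullet> \<nu>)" by auto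
    have "\<bar>(G (x + u *\<^sub>R \<nu>) - G z) \<bullet> \<nu>\<bar> < g/2"
      using Cauchy_Schwarz_ineq2[of "G (x + u *\<^sub>R \<nu>) - G z" \<nu>] GB[OF seg[of u]] u \<nu>1 by auto
    then have "\<bar>G (x + u *\<^sub>R \<nu>) \<bullet> \<nu> - g\<bar> < g/2" using G\<nu> by (simp add: inner_diff_left)
    then have "G (x + u *\<^sub>R \<nu>) \<bullet> \<nu> \<ge> g/2" by linarith
    then show ?thesis using u(3) s by (metis mult.commute mult_left_mono)
  qed simp
  have mono: "g/2 * \<bar>s\<bar> \<le> \<bar>f (x + s *\<^sub>R \<nu>) - f x\<bar>" if x: "x \<in> B" "x + s *\<^sub>R \<nu> \<in> B" for x s
  proof (cases "s \<ge> 0")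
    case True
    then have e: "\<bar>s\<bar> = s" by simp
    show ?thesis unfolding e using incr[OF x True] by linarith
  next
    case False
    then have "g/2 * (- s) \<le> f x - f (x + s *\<^sub>R \<nu>)" and e: "\<bar>s\<bar> = - s"
      using incr[of "x + s *\<^sub>R \<nu>" "- s"] x by simp_all
    then show ?thesis unfolding e by linarith
  qed
  show thesis
  proof (rule that[OF e])
    fix a b assume ab: "dist a z < e" "dist b z < e" "f a = f b"
    define q where "q s = a + s *\<^sub>R (b - a)" for s
    have q: "norm (q s - z) < e" if "s \<in> {0..1}" for s
    proof -
      have "(1 - s) *\<^sub>R a + s *\<^sub>R b \<in> ball z e"
        using ab that by (intro convexD[OF convex_ball]) (auto simp: dist_commute)
      then show ?thesis by (simp add: q_def dist_norm norm_minus_commute algebra_simps)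
    qed
    have inB: "q s + u *\<^sub>R \<nu> \<in> B" if "s \<in> {0..1}" "\<bar>u\<bar> \<le> 6 * e" for s u
    proof -
      have "norm (q s - z + u *\<^sub>R \<nu>) \<le> norm (q s - z) + \<bar>u\<bar>"
        using norm_triangle_ineq[of "q s - z" "u *\<^sub>R \<nu>"] \<nu>1 by simp
      then have "norm (q s + u *\<^sub>R \<nu> - z) < 7 * e" using q[OF that(1)] that(2) by (simp add: algebra_simps)
      then show ?thesis by (simp add: B_def dist_norm norm_minus_commute)
    qed
    have qB: "q s \<in> B" if "s \<in> {0..1}" for s using inB[OF that, of 0] e by simp
    have ba: "norm (b - a) \<le> 2 * e" using ab dist_triangle2[of a b z] by (simp add: dist_norm norm_minus_commute)
    have "\<exists>u. \<bar>u\<bar> \<le> 6 * e \<and> f (q s + u *\<^sub>R \<nu>) = f a" if s: "s \<in> {0..1}" for s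
    proof -
      have "\<bar>f (q s) - f (q 0)\<bar> \<le> 3 * g/2 * norm (q s - q 0)" by (rule lipf) (use qB s in auto)
      also have "\<dots> \<le> 3 * g/2 * (2 * e)"
        using ba s g mult_mono[of s 1 "norm (b - a)" "2 * e"] by (intro mult_left_mono) (auto simp: q_def)
      finally have 1: "\<bar>f (q s) - f a\<bar> \<le> 3 * g * e" by (simp add: q_def mult_ac)
      have 2: "f (q s + (6 * e) *\<^sub>R \<nu>) - f (q s) \<ge> 3 * g * e"
        using incr[of "q s" "6 * e"] inB[OF s, of "6*e"] qB[OF s] e by (simp add: mult_ac)
      have 3: "f (q s) - f (q s + (- 6 * e) *\<^sub>R \<nu>) \<ge> 3 * g * e"
        using incr[of "q s + (- 6 * e) *\<^sub>R \<nu>" "6 * e"] inB[OF s, of "-6*e"] qB[OF s] e by (simp add: mult_ac)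
      have "continuous_on {-6 * e..6 * e} (\<lambda>u. f (q s + u *\<^sub>R \<nu>))"
      proof (rule continuous_on_compose2[of B f])
        show "continuous_on B f"
          using f B by (intro has_derivative_continuous_on) (auto intro: has_derivative_at_withinI)
      qed (use inB[OF s] in \<open>auto intro!: continuous_intros\<close>)
      then have "\<exists>u. -6 * e \<le> u \<and> u \<le> 6 * e \<and> f (q s + u *\<^sub>R \<nu>) = f a"
        by (intro IVT') (use 1 2 3 e in auto)
      then show ?thesis by (metis abs_le_iff minus_le_iff mult_minus_left)
    qed
    then obtain \<tau> where \<tau>: "\<And>s. s \<in> {0..1} \<Longrightarrow> \<bar>\<tau> s\<bar> \<le> 6 * e" "\<And>s. s \<in> {0..1} \<Longrightarrow> f (q s + \<tau> s *\<^sub>R \<nu>) = f a"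
      by metis
    define p where "p s = q s + \<tau> s *\<^sub>R \<nu>" for s
    have pB: "p s \<in> B" if "s \<in> {0..1}" for s using inB \<tau>(1) that by (simp add: p_def)
    have lip: "norm (p s' - p s) \<le> 8 * e * \<bar>s' - s\<bar>" if s: "s \<in> {0..1}" "s' \<in> {0..1}" for s s'
    proof -
      \<comment> \<open>The auxiliary point has the base of \<open>p s'\<close> and the displacement
        of \<open>p s\<close>. Thus the move splits into a translation of length at most
        \<open>2 * e\<close> times the parameter change and a correction along \<open>\<nu>\<close>
        of at most \<open>6 * e\<close> times it, whence the constant 8.\<close>
      define x where "x = q s' + \<tau> s *\<^sub>R \<nu>"
      have xB: "x \<in> B" using inB[OF s(2) \<tau>(1)[OF s(1)]] by (simp add: x_def)
      have xp: "x - p s = (s' - s) *\<^sub>R (b - a)" by (simp add: x_def p_def q_def algebra_simps)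
      have px: "p s' = x + (\<tau> s' - \<tau> s) *\<^sub>R \<nu>" by (simp add: x_def p_def algebra_simps)
      have n: "norm (x - p s) \<le> 2 * e * \<bar>s' - s\<bar>" unfolding xp using mult_left_mono[OF ba, of "\<bar>s' - s\<bar>"] by (simp add: mult_ac)
      have "g/2 * \<bar>\<tau> s' - \<tau> s\<bar> \<le> \<bar>f (p s') - f x\<bar>"
        unfolding px by (rule mono) (use xB pB[OF s(2)] in \<open>simp_all add: px\<close>)
      also have "\<dots> = \<bar>f x - f (p s)\<bar>" using \<tau>(2)[OF s(1)] \<tau>(2)[OF s(2)] by (simp add: p_def)
      also have "\<dots> \<le> 3 * g/2 * norm (x - p s)" by (rule lipf[OF pB[OF s(1)] xB])
      also have "\<dots> \<le> 3 * g/2 * (2 * e * \<bar>s' - s\<bar>)" using n g by (intro mult_left_mono) auto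
      finally have "g/2 * \<bar>\<tau> s' - \<tau> s\<bar> \<le> g/2 * (6 * e * \<bar>s' - s\<bar>)" by (simp add: mult_ac)
      then have t: "\<bar>\<tau> s' - \<tau> s\<bar> \<le> 6 * e * \<bar>s' - s\<bar>" using g by simp
      have e: "p s' - p s = (x - p s) + (\<tau> s' - \<tau> s) *\<^sub>R \<nu>" using px by simp
      have "norm (p s' - p s) \<le> norm (x - p s) + \<bar>\<tau> s' - \<tau> s\<bar>"
        unfolding e using norm_triangle_ineq[of "x - p s" "(\<tau> s' - \<tau> s) *\<^sub>R \<nu>"] \<nu>1 by simp
      then show ?thesis using n t by (simp add: algebra_simps)
    qed
    have p0: "p 0 = a" "p 1 = b"
    proof -
      have "g/2 * \<bar>\<tau> 0\<bar> \<le> 0" "g/2 * \<bar>\<tau> 1\<bar> \<le> 0"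
        using mono[of "q 0" "\<tau> 0"] mono[of "q 1" "\<tau> 1"] qB[of 0] qB[of 1] inB[of 0 "\<tau> 0"] inB[of 1 "\<tau> 1"] \<tau>[of 0] \<tau>[of 1] ab(3)
        by (auto simp: q_def)
      then show "p 0 = a" "p 1 = b" using g by (auto simp: p_def q_def mult_le_0_iff)
    qed
    have "((\<lambda>s. Q (p s)) has_derivative (\<lambda>h. 0)) (at s within {0..1})" if s: "s \<in> {0..1}" for s
    proof -
      define x where "x = p s"
      have x: "x \<in> S" using pB[OF s] B by (auto simp: x_def)
      define R where "R y = Q y - c x * f y" for y
      have "(R has_derivative (\<lambda>h. 0)) (at x)"
        unfolding R_def by (auto intro!: derivative_eq_intros Q[OF x] f[OF x])
      then have R: "\<exists>d>0. \<forall>y. norm (y - x) < d \<longrightarrow> norm (R y - R x) \<le> k * norm (y - x)" if "k > 0" for k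
        using that unfolding has_derivative_within_alt by auto
      show ?thesis unfolding has_derivative_within_alt
      proof (intro conjI allI impI)
        fix k :: real assume k: "k > 0"
        with R[of "k / (8 * e)"] e obtain d where d: "d > 0" "\<And>y. norm (y - x) < d \<Longrightarrow> norm (R y - R x) \<le> k / (8 * e) * norm (y - x)"
          by auto
        show "\<exists>d>0. \<forall>s'\<in>{0..1}. norm (s' - s) < d \<longrightarrow> norm (Q (p s') - Q (p s) - 0) \<le> k * norm (s' - s)"
        proof (intro exI[of _ "d / (8 * e)"] conjI ballI impI)
          fix s' :: real assume s': "s' \<in> {0..1}" "norm (s' - s) < d / (8 * e)"
          have l: "norm (p s' - x) \<le> 8 * e * \<bar>s' - s\<bar>" using lip[OF s s'(1)] by (simp add: x_def)
          also have "\<dots> < d" using s' e by (simp add: field_simps)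
          finally have "norm (R (p s') - R x) \<le> k / (8 * e) * norm (p s' - x)" by (rule d(2))
          also have "\<dots> \<le> k / (8 * e) * (8 * e * \<bar>s' - s\<bar>)" using l k e by (intro mult_left_mono) auto
          also have "\<dots> = k * norm (s' - s)" using e by simp
          also have "R (p s') - R x = Q (p s') - Q (p s)"
            using \<tau>(2)[OF s] \<tau>(2)[OF s'(1)] by (simp add: R_def x_def p_def)
          finally show "norm (Q (p s') - Q (p s) - 0) \<le> k * norm (s' - s)" by simp
        qed (use d e in auto)
      qed auto
    qed
    then have "Q (p 0) = Q (p 1)"
      using has_derivative_zero_unique[of "{0..1}" "\<lambda>s. Q (p s)" 0 1] by auto
    then show "Q a = Q b" by (simp add: p0)
  qed
qed

text \<open>Near \<open>\<alpha> 0\<close> one has \<open>F = \<beta> \<circ> \<alpha>^{-1}\<close>,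
  and the inverse exists since \<open>\<alpha>\<close> is increasing. Regularity of \<open>F\<close>
  is a conclusion here: it suits a function known only through its values along a curve.\<close>

lemma DERIV_of_composite:
  fixes F \<alpha> \<beta> \<alpha>' :: "real \<Rightarrow> real"
  assumes e: "e > 0"
    and \<alpha>: "\<And>s. \<bar>s\<bar> < e \<Longrightarrow> (\<alpha> has_real_derivative \<alpha>' s) (at s)" "\<And>s. \<bar>s\<bar> < e \<Longrightarrow> \<alpha>' s > 0"
    and \<beta>: "(\<beta> has_real_derivative D) (at 0)"
    and F: "\<And>s. \<bar>s\<bar> < e \<Longrightarrow> F (\<alpha> s) = \<beta> s"
  shows "(F has_real_derivative D / \<alpha>' 0) (at (\<alpha> 0))"
proof -
  define S where "S = {-e<..<e}"
  have S: "open S" "0 \<in> S" using e by (auto simp: S_def)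
  have contS: "continuous_on S \<alpha>"
    by (intro continuous_at_imp_continuous_on ballI DERIV_isCont[OF \<alpha>(1)]) (auto simp: S_def)
  have "\<alpha> x < \<alpha> y" if "x \<in> S" "y \<in> S" "x < y" for x y
  proof (rule DERIV_pos_imp_increasing[OF that(3)])
    fix s assume "x \<le> s" "s \<le> y"
    then have "\<bar>s\<bar> < e" using that by (auto simp: S_def)
    then show "\<exists>D. (\<alpha> has_real_derivative D) (at s) \<and> 0 < D" using \<alpha> by blast
  qed
  then have inj: "inj_on \<alpha> S" by (metis inj_onI linorder_neqE_linordered_idom order_less_irrefl)
  define g where "g = inv_into S \<alpha>"
  have g: "g (\<alpha> s) = s" if "s \<in> S" for s using inj that by (simp add: g_def)
  have "(g has_real_derivative inverse (\<alpha>' 0)) (at (\<alpha> 0))" unfolding has_field_derivative_def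
  proof (rule has_derivative_inverse_strong[OF S contS g])
    show "(\<alpha> has_derivative (*) (\<alpha>' 0)) (at 0)" using \<alpha>(1)[of 0] e by (simp add: has_field_derivative_def)
    show "(*) (\<alpha>' 0) \<circ> (*) (inverse (\<alpha>' 0)) = id" using \<alpha>(2)[of 0] e by (auto simp: fun_eq_iff)
  qed
  moreover have "(\<beta> has_real_derivative D) (at (g (\<alpha> 0)))" using \<beta> g S by simp
  ultimately have "((\<lambda>t. \<beta> (g t)) has_real_derivative D * inverse (\<alpha>' 0)) (at (\<alpha> 0))"
    by (intro DERIV_chain2)
  moreover have "open (\<alpha> ` S)" by (rule invariance_of_domain[OF contS S(1) inj])
  moreover have "\<beta> (g t) = F t" if "t \<in> \<alpha> ` S" for t
    using that F by (auto simp: g S_def)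
  ultimately have "(F has_real_derivative D * inverse (\<alpha>' 0)) (at (\<alpha> 0))"
    using S by (auto elim!: has_field_derivative_transform_within_open)
  then show ?thesis by (simp add: divide_inverse)
qed

section \<open>Functions on the closed strip\<close>

abbreviation continuous_on_strip :: "(real \<Rightarrow> real \<Rightarrow> real) \<Rightarrow> bool" where
  "continuous_on_strip f \<equiv> continuous_on (UNIV \<times> {0..1}) (\<lambda>z. f (fst z) (snd z))"

lemma continuous_on_strip_compose:
  assumes "continuous_on_strip f" "continuous_on T p" "continuous_on T q" "\<And>x. x \<in> T \<Longrightarrow> 0 \<le> q x \<and> q x \<le> 1"
  shows "continuous_on T (\<lambda>x. f (p x) (q x))"
proof -
  have "(\<lambda>x. (p x, q x)) ` T \<subseteq> UNIV \<times> {0..1}" using assms(4) by auto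
  from continuous_on_compose2[OF assms(1) continuous_on_Pair[OF assms(2,3)] this] show ?thesis by simp
qed

lemma strip_boundary_limit:
  fixes f :: "real \<Rightarrow> real"
  assumes "continuous_on {0..1} f" "continuous_on {0..1} g" "\<And>y. 0 < y \<Longrightarrow> y < 1 \<Longrightarrow> f y = g y" "0 \<le> y" "y \<le> 1"
  shows "f y = g y"
proof -
  have "f y - g y = 0"
  proof (rule continuous_constant_on_closure[of "{0<..<1}" "\<lambda>y. f y - g y" 0 y])
    show "continuous_on (closure {0<..<1}) (\<lambda>y. f y - g y)"
      using assms by (simp add: continuous_intros)
  qed (use assms in auto)
  then show ?thesis by simp
qed

text \<open>Horizontal derivatives pass to the boundary because they are equivalent to an integral identity.\<close>

lemma horizontal_derivative_closed:
  assumes f: "continuous_on_strip f" and g: "continuous_on_strip g"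
    and d: "\<And>x y. 0 < y \<Longrightarrow> y < 1 \<Longrightarrow> ((\<lambda>s. f s y) has_real_derivative g x y) (at x)"
    and y: "0 \<le> y" "y \<le> 1"
  shows "((\<lambda>s. f s y) has_real_derivative g x y) (at x)"
proof -
  \<comment> \<open>A base point strictly to the left of \<open>x\<close> makes the integral
    differentiable from both sides at \<open>x\<close>.\<close>
  define x0 where "x0 = x - 1"
  have eq: "f x1 y - f x0 y = integral {x0..x1} (\<lambda>s. g s y)" if x1: "x0 \<le> x1" for x1
  proof (rule strip_boundary_limit[OF _ _ _ y, of "\<lambda>y. f x1 y - f x0 y" "\<lambda>y. integral {x0..x1} (\<lambda>s. g s y)"])
    show "continuous_on {0..1} (\<lambda>y. f x1 y - f x0 y)"
      by (intro continuous_intros continuous_on_strip_compose[OF f]) auto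
    have "continuous_on {0..1} (\<lambda>y. integral (cbox x0 x1) (\<lambda>s. g s y))"
      by (rule integral_continuous_on_param)
        (auto simp: split_beta intro!: continuous_on_strip_compose[OF g] continuous_intros)
    then show "continuous_on {0..1} (\<lambda>y. integral {x0..x1} (\<lambda>s. g s y))" by simp
    fix y :: real assume y: "0 < y" "y < 1"
    have "((\<lambda>s. g s y) has_integral (f x1 y - f x0 y)) {x0..x1}"
      using x1 d[OF y] by (intro fundamental_theorem_of_calculus)
        (auto simp: has_real_derivative_iff_has_vector_derivative[symmetric] intro: has_field_derivative_at_within)
    then show "f x1 y - f x0 y = integral {x0..x1} (\<lambda>s. g s y)" by (simp add: integral_unique)
  qed
  have "((\<lambda>s. integral {x0..s} (\<lambda>s. g s y)) has_real_derivative g x y) (at x within {x0..x+1})"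
    by (rule integral_has_real_derivative) (use y in \<open>auto simp: x0_def intro!: continuous_on_strip_compose[OF g] continuous_intros\<close>)
  then have "((\<lambda>s. integral {x0..s} (\<lambda>s. g s y)) has_real_derivative g x y) (at x)"
    by (simp add: at_within_Icc_at x0_def)
  then have "((\<lambda>s. f x0 y + integral {x0..s} (\<lambda>s. g s y)) has_real_derivative g x y) (at x)"
    by (auto intro!: derivative_eq_intros)
  moreover have "eventually (\<lambda>s. f x0 y + integral {x0..s} (\<lambda>s. g s y) = f s y) (nhds x)"
  proof -
    have "eventually (\<lambda>s. s > x0) (nhds x)" by (rule eventually_nhds_in_open[of "{x0<..}", simplified]) (simp add: x0_def)
    then show ?thesis
    proof eventually_elim
      case (elim s)
      then show ?case using eq[of s] by simp
    qed
  qed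
  ultimately show ?thesis using DERIV_cong_ev[OF refl _ refl] by metis
qed

text \<open>Integrating \<open>R\<close> vertically from the bottom gives the potential; by
  differentiation under the integral its horizontal derivative is the integral of \<open>S\<close>,
  which is \<open>P\<close> because \<open>S\<close> is also the vertical derivative of
  \<open>P\<close>. Used for the stream function and again for the polar angle.\<close>

lemma strip_potential:
  assumes P: "continuous_on_strip P" and R: "continuous_on_strip R" and S: "continuous_on_strip S"
    and Rx: "\<And>x y. 0 < y \<Longrightarrow> y < 1 \<Longrightarrow> ((\<lambda>s. R s y) has_real_derivative S x y) (at x)"
    and Py: "\<And>x y. 0 < y \<Longrightarrow> y < 1 \<Longrightarrow> ((\<lambda>s. P x s) has_real_derivative S x y) (at y)"
    and P0: "\<And>x. P x 0 = 0"
  obtains u where "continuous_on_strip u" "\<And>x. u x 0 = 0"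
    "\<And>x y. 0 \<le> y \<Longrightarrow> y \<le> 1 \<Longrightarrow> ((\<lambda>s. u s y) has_real_derivative P x y) (at x)"
    "\<And>x y. 0 \<le> y \<Longrightarrow> y \<le> 1 \<Longrightarrow> ((\<lambda>s. u x s) has_real_derivative R x y) (at y within {0..1})"
proof -
  define u where "u x y = integral {0..y} (R x)" for x y
  have Rc: "continuous_on {0..1} (R x)" for x by (intro continuous_on_strip_compose[OF R] continuous_intros) auto
  have ux: "((\<lambda>s. u s y) has_real_derivative P x y) (at x)" if y: "0 \<le> y" "y \<le> 1" for x y
  proof -
    have "((\<lambda>x. integral (cbox 0 y) (R x)) has_real_derivative integral (cbox 0 y) (S x)) (at x within UNIV)"
    proof (rule leibniz_rule_field_derivative)
      show "((\<lambda>x. R x t) has_real_derivative S x t) (at x within UNIV)" if "t \<in> cbox 0 y" for x t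
        using horizontal_derivative_closed[OF R S Rx] that y by auto
      show "R x integrable_on cbox 0 y" for x
        by (rule integrable_continuous) (use y in \<open>auto intro!: continuous_on_subset[OF Rc]\<close>)
      show "continuous_on (UNIV \<times> cbox 0 y) (\<lambda>(x, t). S x t)"
        unfolding split_beta using y by (auto intro!: continuous_on_subset[OF S])
    qed auto
    moreover have "(S x has_integral (P x y - P x 0)) {0..y}"
    proof (rule fundamental_theorem_of_calculus_interior[OF y(1)])
      show "continuous_on {0..y} (P x)" using y by (intro continuous_on_strip_compose[OF P] continuous_intros) auto
      show "(P x has_vector_derivative S x s) (at s)" if "s \<in> {0<..<y}" for s
        using Py[of s x] that y by (simp add: has_real_derivative_iff_has_vector_derivative)
    qed
    ultimately show ?thesis by (simp add: u_def integral_unique P0)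
  qed
  have uy: "((\<lambda>s. u x s) has_real_derivative R x y) (at y within {0..1})" if "0 \<le> y" "y \<le> 1" for x y
    unfolding u_def using that by (intro integral_has_real_derivative Rc) auto
  \<comment> \<open>Separate differentiability does not give joint continuity. Local boundedness of
    \<open>P\<close> makes \<open>u\<close> Lipschitz in the first variable uniformly in the second,
    and this combines with continuity along one vertical line.\<close>
  have "continuous_on_strip u" unfolding continuous_on_iff
  proof (intro ballI allI impI)
    fix z :: "real \<times> real" and e :: real assume z: "z \<in> UNIV \<times> {0..1}" and e: "e > 0"
    obtain x y where xy: "z = (x, y)" by (cases z)
    have y: "0 \<le> y" "y \<le> 1" using z xy by auto
    have "continuous_on {0..1} (u x)" using uy DERIV_continuous_on[of "{0..1}" "u x" "R x"] by auto
    then obtain d1 where d1: "d1 > 0" "\<And>y'. y' \<in> {0..1} \<Longrightarrow> dist y' y < d1 \<Longrightarrow> dist (u x y') (u x y) < e/2"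
      using y e unfolding continuous_on_iff by (metis atLeastAtMost_iff half_gt_zero)
    have "compact ((\<lambda>z. P (fst z) (snd z)) ` ({x - 1..x + 1} \<times> {0..1}))"
      by (intro compact_continuous_image continuous_on_subset[OF P] compact_Times compact_Icc) auto
    then obtain K where K: "\<And>x' y'. x - 1 \<le> x' \<Longrightarrow> x' \<le> x + 1 \<Longrightarrow> y' \<in> {0..1} \<Longrightarrow> \<bar>P x' y'\<bar> \<le> K" "K > 0"
      unfolding compact_eq_bounded_closed bounded_pos by fastforce
    have lip: "\<bar>u x' y' - u x y'\<bar> \<le> K * \<bar>x' - x\<bar>" if "\<bar>x' - x\<bar> \<le> 1" "y' \<in> {0..1}" for x' y'
    proof -
      have "norm (u x' y' - u x y') \<le> K * norm (x' - x)"
      proof (rule field_differentiable_bound[where S = "{x - 1..x + 1}" and f = "\<lambda>s. u s y'" and f' = "\<lambda>s. P s y'"])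
        show "((\<lambda>s. u s y') has_real_derivative P s y') (at s within {x - 1..x + 1})" for s
          using ux[of y' s] that by (auto intro: has_field_derivative_at_within)
      qed (use that K in auto)
      then show ?thesis by simp
    qed
    define d where "d = min d1 (min 1 (e / (2 * K)))"
    show "\<exists>d>0. \<forall>z'\<in>UNIV \<times> {0..1}. dist z' z < d \<longrightarrow> dist (u (fst z') (snd z')) (u (fst z) (snd z)) < e"
    proof (intro exI[of _ d] conjI ballI impI)
      show "d > 0" using d1 K e by (simp add: d_def)
      fix z' :: "real \<times> real" assume z': "z' \<in> UNIV \<times> {0..1}" "dist z' z < d"
      obtain x' y' where xy': "z' = (x', y')" by (cases z')
      have "dist x' x < d" "dist y' y < d" using z' dist_fst_le[of z' z] dist_snd_le[of z' z] by (auto simp: xy xy')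
      then have *: "\<bar>x' - x\<bar> \<le> 1" "\<bar>x' - x\<bar> < e / (2 * K)" "dist y' y < d1" by (auto simp: d_def dist_real_def)
      have "K * \<bar>x' - x\<bar> < e/2" using *(2) K by (simp add: field_simps)
      moreover have "y' \<in> {0..1}" using z' xy' by auto
      ultimately show "dist (u (fst z') (snd z')) (u (fst z) (snd z)) < e"
        using lip[OF *(1), of y'] d1(2)[of y'] *(3) unfolding xy xy' dist_real_def fst_conv snd_conv by linarith
    qed
  qed
  moreover have "u x 0 = 0" for x by (simp add: u_def)
  ultimately show thesis using ux uy by (rule that)
qed

text \<open>An increment splits into a vertical move, controlled by the continuous partial
  \<open>fy\<close>, and a horizontal move at the original height, controlled by the derivative at
  the single point \<open>x\<close>.\<close>

lemma has_derivative_of_partials: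
  fixes f fx fy :: "real \<Rightarrow> real \<Rightarrow> real"
  assumes Y: "open Y" "convex Y" "y \<in> Y"
    and fx: "((\<lambda>s. f s y) has_real_derivative fx x y) (at x)"
    and fy: "\<And>x y. y \<in> Y \<Longrightarrow> ((\<lambda>s. f x s) has_real_derivative fy x y) (at y)"
    and cont: "continuous_on (UNIV \<times> Y) (\<lambda>z. fy (fst z) (snd z))"
  shows "((\<lambda>z. f (fst z) (snd z)) has_derivative (\<lambda>h. (fx x y, fy x y) \<bullet> h)) (at (x, y))"
proof -
  have op: "open (UNIV \<times> Y :: (real \<times> real) set)" using Y by (intro open_Times) auto
  have "((\<lambda>(x, y). f x y) has_derivative (\<lambda>(tx, ty). fx x y * tx + blinfun_apply (blinfun_mult_right (fy x y)) ty))
      (at (x, y) within UNIV \<times> Y)"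
  proof (rule has_derivative_partialsI)
    show "((\<lambda>x. f x y) has_derivative (\<lambda>tx. fx x y * tx)) (at x within UNIV)"
      using fx by (simp add: has_field_derivative_def)
    show "((\<lambda>y. f x y) has_derivative blinfun_apply (blinfun_mult_right (fy x y))) (at y within Y)" if "y \<in> Y" for x y
      using fy[OF that, of x] by (auto simp: has_field_derivative_def intro: has_derivative_at_withinI)
    have "continuous (at (x, y) within UNIV \<times> Y) (\<lambda>z. fy (fst z) (snd z))"
      using cont Y(3) by (simp add: continuous_on_eq_continuous_within)
    then show "continuous (at (x, y) within UNIV \<times> Y) (\<lambda>(x, y). blinfun_mult_right (fy x y))"
      unfolding split_beta by (intro bounded_linear.continuous[OF bounded_linear_blinfun_mult_right])
  qed (use Y in auto)
  moreover have "at (x, y) within UNIV \<times> Y = at (x, y)" using op Y(3) by (intro at_within_open) auto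
  ultimately show ?thesis by (simp add: case_prod_unfold inner_prod_def)
qed

definition clamp01 :: "real \<Rightarrow> real" where "clamp01 y = max 0 (min 1 y)"

lemma clamp01_range: "0 \<le> clamp01 y" "clamp01 y \<le> 1" by (auto simp: clamp01_def)

lemma continuous_on_clamp01: "continuous_on A clamp01"
  unfolding clamp01_def by (intro continuous_intros)

text \<open>Continuation by the two end tangents. Inside the interval the correction term vanishes;
  at 0 and 1 the one-sided derivatives agree and are glued.\<close>

lemma linear_extension_derivative:
  assumes f: "\<And>y. 0 \<le> y \<Longrightarrow> y \<le> 1 \<Longrightarrow> (f has_real_derivative g y) (at y within {0..1})"
  shows "((\<lambda>y. f (clamp01 y) + (y - clamp01 y) * g (clamp01 y)) has_real_derivative g (clamp01 y)) (at y)"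
    (is "(?F has_real_derivative _) _")
proof -
  have lin: "((\<lambda>y. f c + (y - c) * g c) has_real_derivative g c) (at z within A)" for c z A
    by (auto intro!: derivative_eq_intros)
  have mid: "(?F has_real_derivative g y) (at y within {0..1})" if "0 \<le> y" "y \<le> 1" for y
    by (rule has_field_derivative_transform_within[OF f zero_less_one]) (use that in \<open>auto simp: clamp01_def\<close>)
  have low: "(?F has_real_derivative g 0) (at y within {y-1..0})" if "y \<le> 0" for y
    by (rule has_field_derivative_transform_within[OF lin[of 0] zero_less_one]) (use that in \<open>auto simp: clamp01_def\<close>)
  have high: "(?F has_real_derivative g 1) (at y within {1..y+1})" if "y \<ge> 1" for y
    by (rule has_field_derivative_transform_within[OF lin[of 1] zero_less_one]) (use that in \<open>auto simp: clamp01_def\<close>)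
  have glue: "(h has_real_derivative D) (at y)" if "(h has_real_derivative D) (at_left y)" "(h has_real_derivative D) (at_right y)" for h D y
    using that by (simp add: has_field_derivative_iff filterlim_at_split)
  consider "y < 0" | "y = 0" | "0 < y" "y < 1" | "y = 1" | "y > 1" by linarith
  then show ?thesis
  proof cases
    case 1
    then show ?thesis using low[of y] by (simp add: at_within_Icc_at clamp01_def)
  next
    case 2
    then show ?thesis using low[of 0] mid[of 0]
      by (intro glue) (simp_all add: at_within_Icc_at_right at_within_Icc_at_left clamp01_def)
  next
    case 3
    then show ?thesis using mid[of y] by (simp add: at_within_Icc_at clamp01_def)
  next
    case 4
    then show ?thesis using high[of 1] mid[of 1]
      by (intro glue) (simp_all add: at_within_Icc_at_right at_within_Icc_at_left clamp01_def)
  next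
    case 5
    then show ?thesis using high[of y] by (simp add: at_within_Icc_at clamp01_def)
  qed
qed

text \<open>The line is open and closed relative to the level. Openness holds because the vertical
  derivative is nonzero near the line, so by Rolle a vertical segment reaching the line cannot
  return to the value \<open>t\<close> nearby. Connectedness of the level then leaves room for
  nothing else.\<close>

lemma level_set_eq_horizontal_line:
  fixes U :: "real \<times> real \<Rightarrow> real" and G :: "real \<times> real \<Rightarrow> real \<times> real"
  assumes U: "\<And>z. (U has_derivative (\<lambda>h. G z \<bullet> h)) (at z)"
    and G: "continuous_on UNIV G"
    and eta: "\<eta> > 0" "\<And>z. norm (G z) \<ge> \<eta>"
    and line: "\<And>x. U (x, y0) = t" "\<And>x. snd (G (x, y0)) \<noteq> 0"
  shows "U z = t \<longleftrightarrow> snd z = y0"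
proof
  assume z: "U z = t"
  have "(snd (0 :: real, y0) = y0) = (snd z = y0)"
  proof (rule connected_local_const[where f = "\<lambda>z. snd z = y0", OF level_sets_connected[OF U G eta, of t]])
    show "\<forall>p\<in>{z. U z = t}. eventually (\<lambda>q. (snd p = y0) = (snd q = y0)) (at p within {z. U z = t})"
    proof
      fix p assume "p \<in> {z. U z = t}"
      show "eventually (\<lambda>q. (snd p = y0) = (snd q = y0)) (at p within {z. U z = t})"
      proof (cases "snd p = y0")
        case False
        have "eventually (\<lambda>q. snd q \<noteq> y0) (at p within {z. U z = t})"
          by (rule tendsto_imp_eventually_ne[OF tendsto_snd[OF tendsto_ident_at] False])
        then show ?thesis by eventually_elim (use False in auto)
      next
        case True
        then obtain x0 where p: "p = (x0, y0)" by (cases p) auto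
        have "isCont (\<lambda>q. snd (G q)) p"
          using G continuous_on_eq_continuous_at[OF open_UNIV, of G] by (intro continuous_snd) blast
        then obtain d where d: "d > 0" "\<And>q. dist q p < d \<Longrightarrow> dist (snd (G q)) (snd (G p)) < \<bar>snd (G p)\<bar>"
          using line(2)[of x0] unfolding p continuous_at_eps_delta by (metis zero_less_abs_iff)
        have "snd q = y0" if q: "dist q p < d" "U q = t" for q
        proof (rule ccontr)
          obtain x y where xy: "q = (x, y)" by (cases q)
          assume "snd q \<noteq> y0"
          then have yne: "y \<noteq> y0" by (simp add: xy)
          define h where "h s = U (x, s)" for s
          have h: "(h has_real_derivative snd (G (x, s))) (at s)" for s
          proof -
            have "((\<lambda>s. (x, s)) has_derivative (\<lambda>k. (0, k))) (at s)" by (auto intro!: derivative_eq_intros)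
            from has_derivative_compose[OF this U] have "(h has_derivative (\<lambda>k. G (x, s) \<bullet> (0, k))) (at s)"
              unfolding h_def .
            then show ?thesis unfolding has_field_derivative_def
              by (rule has_derivative_eq_rhs) (simp add: fun_eq_iff inner_prod_def)
          qed
          have "\<exists>\<xi>. (y < \<xi> \<and> \<xi> < y0 \<or> y0 < \<xi> \<and> \<xi> < y) \<and> snd (G (x, \<xi>)) = 0"
          proof -
            have eq: "h y = h y0" using q(2) line(1) by (simp add: h_def xy)
            have "continuous_on A h" for A
              by (intro continuous_at_imp_continuous_on ballI DERIV_isCont[OF h])
            moreover have "h differentiable (at s)" for s using h real_differentiable_def by blast
            ultimately have "\<exists>\<xi>. (y < \<xi> \<and> \<xi> < y0 \<or> y0 < \<xi> \<and> \<xi> < y) \<and> (h has_real_derivative 0) (at \<xi>)"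
              using Rolle[of y y0 h] Rolle[of y0 y h] eq yne by (cases "y < y0") auto
            then show ?thesis using DERIV_unique[OF h] by blast
          qed
          then obtain \<xi> where \<xi>': "y < \<xi> \<and> \<xi> < y0 \<or> y0 < \<xi> \<and> \<xi> < y" and \<xi>2: "snd (G (x, \<xi>)) = 0" by blast
          have \<xi>: "\<bar>\<xi> - y0\<bar> \<le> \<bar>y - y0\<bar>" using \<xi>' by linarith
          have "dist (x, \<xi>) p \<le> dist q p"
            unfolding p xy dist_prod_def using \<xi> by (auto simp: dist_real_def abs_le_square_iff)
          then have "dist (snd (G (x, \<xi>))) (snd (G p)) < \<bar>snd (G p)\<bar>" using d(2) q by auto
          then show False using \<xi>2 by (simp add: dist_real_def)
        qed
        then show ?thesis unfolding eventually_at using d(1) True by auto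
      qed
    qed
  qed (use z line in auto)
  then show "snd z = y0" by simp
next
  assume "snd z = y0" then show "U z = t" using line(1)[of "fst z"] by (cases z) auto
qed

section \<open>Stream function and vorticity\<close>

text \<open>The pressure has been eliminated in favour of the curl of the momentum equation, and a
  single name stands for each pair of equal mixed derivatives. Derivatives are continuous on the
  closed strip but are derivatives only inside; \<open>div\<close> is stated up to the boundary,
  where it is read on the bottom line.\<close>

locale strip_flow =
  fixes a b a1 a2 b1 b2 a11 a12 a22 b11 b12 b22 u :: "real \<Rightarrow> real \<Rightarrow> real" and \<eta> :: real
  assumes cont: "continuous_on_strip a" "continuous_on_strip b"
      "continuous_on_strip a1" "continuous_on_strip a2" "continuous_on_strip b1" "continuous_on_strip b2"
      "continuous_on_strip a11" "continuous_on_strip a12" "continuous_on_strip a22"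
      "continuous_on_strip b11" "continuous_on_strip b12" "continuous_on_strip b22"
    and a1: "\<And>x y. 0 < y \<Longrightarrow> y < 1 \<Longrightarrow> ((\<lambda>s. a s y) has_real_derivative a1 x y) (at x)"
    and a2: "\<And>x y. 0 < y \<Longrightarrow> y < 1 \<Longrightarrow> ((\<lambda>s. a x s) has_real_derivative a2 x y) (at y)"
    and b1: "\<And>x y. 0 < y \<Longrightarrow> y < 1 \<Longrightarrow> ((\<lambda>s. b s y) has_real_derivative b1 x y) (at x)"
    and b2: "\<And>x y. 0 < y \<Longrightarrow> y < 1 \<Longrightarrow> ((\<lambda>s. b x s) has_real_derivative b2 x y) (at y)"
    and a11: "\<And>x y. 0 < y \<Longrightarrow> y < 1 \<Longrightarrow> ((\<lambda>s. a1 s y) has_real_derivative a11 x y) (at x)"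
    and a12: "\<And>x y. 0 < y \<Longrightarrow> y < 1 \<Longrightarrow> ((\<lambda>s. a1 x s) has_real_derivative a12 x y) (at y)"
    and a21: "\<And>x y. 0 < y \<Longrightarrow> y < 1 \<Longrightarrow> ((\<lambda>s. a2 s y) has_real_derivative a12 x y) (at x)"
    and a22: "\<And>x y. 0 < y \<Longrightarrow> y < 1 \<Longrightarrow> ((\<lambda>s. a2 x s) has_real_derivative a22 x y) (at y)"
    and b11: "\<And>x y. 0 < y \<Longrightarrow> y < 1 \<Longrightarrow> ((\<lambda>s. b1 s y) has_real_derivative b11 x y) (at x)"
    and b12: "\<And>x y. 0 < y \<Longrightarrow> y < 1 \<Longrightarrow> ((\<lambda>s. b1 x s) has_real_derivative b12 x y) (at y)"
    and b21: "\<And>x y. 0 < y \<Longrightarrow> y < 1 \<Longrightarrow> ((\<lambda>s. b2 s y) has_real_derivative b12 x y) (at x)"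
    and b22: "\<And>x y. 0 < y \<Longrightarrow> y < 1 \<Longrightarrow> ((\<lambda>s. b2 x s) has_real_derivative b22 x y) (at y)"
    and div: "\<And>x y. 0 \<le> y \<Longrightarrow> y \<le> 1 \<Longrightarrow> b2 x y = - a1 x y"
    and div_deriv: "\<And>x y. 0 < y \<Longrightarrow> y < 1 \<Longrightarrow> b12 x y = - a11 x y" "\<And>x y. 0 < y \<Longrightarrow> y < 1 \<Longrightarrow> b22 x y = - a12 x y"
    and vorticity: "\<And>x y. 0 < y \<Longrightarrow> y < 1 \<Longrightarrow> a x y * (b11 x y - a12 x y) + b x y * (b12 x y - a22 x y) = 0"
    and bottom: "\<And>x. b x 0 = 0" and top: "\<And>x. b x 1 = 0"
    and eta: "\<eta> > 0" "\<And>x y. 0 \<le> y \<Longrightarrow> y \<le> 1 \<Longrightarrow> \<eta>\<^sup>2 \<le> (a x y)\<^sup>2 + (b x y)\<^sup>2"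
    and cont_u: "continuous_on_strip u" and u0: "\<And>x. u x 0 = 0"
    and ux: "\<And>x y. 0 \<le> y \<Longrightarrow> y \<le> 1 \<Longrightarrow> ((\<lambda>s. u s y) has_real_derivative - b x y) (at x)"
    and uy: "\<And>x y. 0 \<le> y \<Longrightarrow> y \<le> 1 \<Longrightarrow> ((\<lambda>s. u x s) has_real_derivative a x y) (at y within {0..1})"
begin

lemma speed_pos: "0 \<le> y \<Longrightarrow> y \<le> 1 \<Longrightarrow> (a x y)\<^sup>2 + (b x y)\<^sup>2 > 0"
  using eta(1) eta(2)[of y x] by (smt (verit) zero_less_power)

lemma uy_interior: "0 < y \<Longrightarrow> y < 1 \<Longrightarrow> ((\<lambda>s. u x s) has_real_derivative a x y) (at y)"
  using uy[of y x] by (simp add: at_within_Icc_at)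

text \<open>The volume flux through a vertical section. Its sign is not prescribed, so later order
  statements come in two versions.\<close>

definition "flux = u 0 1"

lemma u_top: "u x 1 = flux"
proof -
  have "((\<lambda>s. u s 1) has_real_derivative 0) (at x)" for x using ux[of 1 x] top by simp
  then show ?thesis unfolding flux_def using DERIV_isconst_all[of "\<lambda>s. u s 1"] by blast
qed

text \<open>The stream function is continued affinely across the boundary, to a \<open>C\<^sup>1\<close> function on the plane
  whose gradient is still bounded away from zero.\<close>

definition U where "U x y = u x (clamp01 y) + (y - clamp01 y) * a x (clamp01 y)"
definition Ux where "Ux x y = - b x (clamp01 y) + (y - clamp01 y) * a1 x (clamp01 y)"
definition Uy where "Uy x y = a x (clamp01 y)"

lemma U_interior: "0 \<le> y \<Longrightarrow> y \<le> 1 \<Longrightarrow> U x y = u x y"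
  "0 \<le> y \<Longrightarrow> y \<le> 1 \<Longrightarrow> Ux x y = - b x y" "0 \<le> y \<Longrightarrow> y \<le> 1 \<Longrightarrow> Uy x y = a x y"
  by (simp_all add: U_def Ux_def Uy_def clamp01_def)

lemma continuous_clamped:
  assumes "continuous_on_strip f"
  shows "continuous_on A (\<lambda>z. f (fst z) (clamp01 (snd z)))"
  by (intro continuous_on_strip_compose[OF assms] continuous_intros continuous_on_compose2[OF continuous_on_clamp01])
    (auto simp: clamp01_range)

lemma continuous_U_gradient: "continuous_on A (\<lambda>z. (Ux (fst z) (snd z), Uy (fst z) (snd z)))"
  unfolding Ux_def Uy_def
  by (intro continuous_intros continuous_clamped cont continuous_on_compose2[OF continuous_on_clamp01]) auto

lemma U_derivative:
  "((\<lambda>z. U (fst z) (snd z)) has_derivative (\<lambda>h. (Ux (fst z) (snd z), Uy (fst z) (snd z)) \<bullet> h)) (at z)"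
proof -
  have "((\<lambda>z. U (fst z) (snd z)) has_derivative (\<lambda>h. (Ux (fst z) (snd z), Uy (fst z) (snd z)) \<bullet> h)) (at (fst z, snd z))"
  proof (rule has_derivative_of_partials[where Y = UNIV])
    show "((\<lambda>s. U s (snd z)) has_real_derivative Ux (fst z) (snd z)) (at (fst z))"
      unfolding U_def Ux_def
      by (auto intro!: derivative_eq_intros ux horizontal_derivative_closed[OF cont(1) cont(3) a1] simp: clamp01_range)
    show "((\<lambda>s. U x s) has_real_derivative Uy x y) (at y)" for x y
      unfolding U_def Uy_def by (rule linear_extension_derivative) (rule uy)
    show "continuous_on (UNIV \<times> UNIV) (\<lambda>z. Uy (fst z) (snd z))"
      unfolding Uy_def by (intro continuous_clamped cont)
  qed auto
  then show ?thesis by simp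
qed

text \<open>Outside the strip \<open>Uy\<close> is the horizontal velocity at the nearest boundary
  point, which is the full speed up to sign because \<open>b\<close> vanishes there. The term with
  \<open>a1\<close> in \<open>Ux\<close> can only enlarge the norm.\<close>

lemma U_gradient_lower: "norm (Ux x y, Uy x y) \<ge> \<eta>"
proof (cases "0 \<le> y \<and> y \<le> 1")
  case True
  then have "\<eta>\<^sup>2 \<le> (norm (Ux x y, Uy x y))\<^sup>2" using eta(2)[of y x] by (simp add: U_interior norm_prod_def)
  then show ?thesis by (rule power2_le_imp_le) simp
next
  case False
  then have "b x (clamp01 y) = 0" using bottom top by (auto simp: clamp01_def)
  then have "\<eta>\<^sup>2 \<le> \<bar>Uy x y\<bar>\<^sup>2" using eta(2)[of "clamp01 y" x] by (simp add: Uy_def clamp01_range)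
  then have "\<eta> \<le> \<bar>Uy x y\<bar>" by (rule power2_le_imp_le) simp
  also have "\<dots> \<le> norm (Ux x y, Uy x y)" using norm_snd_le[of "Uy x y" "Ux x y"] by simp
  finally show ?thesis .
qed

lemma U_level: "connected {z. U (fst z) (snd z) = t}"
  by (rule level_sets_connected[OF U_derivative continuous_U_gradient eta(1)]) (rule U_gradient_lower)

lemma U_eq_boundary_value:
  assumes "y0 = 0 \<or> y0 = 1"
  shows "U x y = u 0 y0 \<longleftrightarrow> y = y0"
proof -
  have "(\<lambda>z. U (fst z) (snd z)) (x, y) = u 0 y0 \<longleftrightarrow> snd (x, y) = y0"
  proof (rule level_set_eq_horizontal_line[OF U_derivative continuous_U_gradient eta(1)])
    show "U (fst (x, y0)) (snd (x, y0)) = u 0 y0" for x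
      using assms u0 u_top[of x] u_top[of 0] by (auto simp: U_interior)
    have "b x y0 = 0" for x using assms bottom top by auto
    then show "snd (Ux (fst (x, y0)) (snd (x, y0)), Uy (fst (x, y0)) (snd (x, y0))) \<noteq> 0" for x
      using assms speed_pos[of y0 x] by (auto simp: U_interior)
  qed (rule U_gradient_lower)
  then show ?thesis by simp
qed

lemma flux_nonzero: "flux \<noteq> 0"
  using U_eq_boundary_value[of 0 0 1] by (simp add: U_interior u_top u0)

lemma u_ne_boundary: "0 < y \<Longrightarrow> y < 1 \<Longrightarrow> u x y \<noteq> 0 \<and> u x y \<noteq> flux"
  using U_eq_boundary_value[of 0 x y] U_eq_boundary_value[of 1 x y] by (simp add: U_interior u_top u0)

lemma continuous_u_vertical: "0 \<le> p \<Longrightarrow> q \<le> 1 \<Longrightarrow> continuous_on {p..q} (u x)"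
  by (intro continuous_on_strip_compose[OF cont_u] continuous_intros) auto

lemma u_between:
  assumes "0 < y" "y < 1"
  shows "0 < u x y \<and> u x y < flux \<or> flux < u x y \<and> u x y < 0"
proof -
  \<comment> \<open>A vertical segment cannot pass through either boundary value at an interior
    height. Excluding \<open>flux\<close> on the part below \<open>y\<close> and 0 on the part above
    leaves only the two strict orders.\<close>
  have no: "\<not> (u x p \<le> k \<and> k \<le> u x q \<or> u x q \<le> k \<and> k \<le> u x p)" if "k = 0 \<or> k = flux" "0 \<le> p" "q \<le> 1" "p \<le> q"
     "u x p \<noteq> k" "u x q \<noteq> k" for k p q
  proof
    assume sgn: "u x p \<le> k \<and> k \<le> u x q \<or> u x q \<le> k \<and> k \<le> u x p"
    have "continuous_on {p..q} (u x)" using that by (intro continuous_u_vertical) auto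
    then have "\<exists>s. p \<le> s \<and> s \<le> q \<and> u x s = k" using IVT'[of "u x" p k q] IVT2'[of "u x" q k p] sgn \<open>p \<le> q\<close> by auto
    then obtain s where s: "p \<le> s" "s \<le> q" "u x s = k" by auto
    then have "0 < s" "s < 1" using that by (auto simp: order.strict_iff_order)
    then show False using u_ne_boundary[of s x] s that by auto
  qed
  have "\<not> (u x 0 \<le> flux \<and> flux \<le> u x y \<or> u x y \<le> flux \<and> flux \<le> u x 0)"
    by (rule no) (use assms u_ne_boundary flux_nonzero u0 in auto)
  moreover have "\<not> (u x y \<le> 0 \<and> 0 \<le> u x 1 \<or> u x 1 \<le> 0 \<and> 0 \<le> u x y)"
    by (rule no) (use assms u_ne_boundary flux_nonzero u_top in auto)
  ultimately show ?thesis using flux_nonzero u0[of x] u_top[of x] by auto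
qed

lemma abs_u_le: "0 < y \<Longrightarrow> y < 1 \<Longrightarrow> \<bar>u x y\<bar> \<le> \<bar>flux\<bar>"
  using u_between[of y x] by auto

lemma crosses_axis:
  assumes "0 < y" "y < 1"
  obtains y0 where "0 < y0" "y0 < 1" "u 0 y0 = u x y"
proof -
  have "continuous_on {0..1} (u 0)" by (intro continuous_u_vertical) auto
  then have "\<exists>s. 0 \<le> s \<and> s \<le> 1 \<and> u 0 s = u x y"
    using IVT'[of "u 0" 0 "u x y" 1] IVT2'[of "u 0" 1 "u x y" 0] u_between[OF assms, of x] u0[of 0] u_top[of 0] by auto
  then obtain s where s: "0 \<le> s" "s \<le> 1" "u 0 s = u x y" by auto
  then have "s \<noteq> 0" "s \<noteq> 1" using u_ne_boundary[OF assms, of x] u0[of 0] u_top[of 0] by auto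
  then show thesis using s that[of s] by auto
qed

definition W where "W x y = b1 x y - a2 x y"

text \<open>By the vorticity equation \<open>\<nabla>W = \<kappa> \<nabla>u\<close>, so \<open>\<kappa>\<close> is the derivative of \<open>W\<close> as a function of \<open>u\<close>.\<close>

definition \<kappa> where "\<kappa> x y = (a x y * (b12 x y - a22 x y) - b x y * (b11 x y - a12 x y)) / ((a x y)\<^sup>2 + (b x y)\<^sup>2)"

lemma W_gradient:
  assumes "0 < y" "y < 1"
  shows "b11 x y - a12 x y = \<kappa> x y * (- b x y)" "b12 x y - a22 x y = \<kappa> x y * a x y"
proof -
  define A B P Q where "A = a x y" and "B = b x y" and "P = b11 x y - a12 x y" and "Q = b12 x y - a22 x y"
  have pos: "A\<^sup>2 + B\<^sup>2 > 0" using speed_pos[of y x] assms by (simp add: A_def B_def)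
  have AP: "A * P + B * Q = 0" using vorticity[OF assms] by (simp add: A_def B_def P_def Q_def)
  \<comment> \<open>Decomposition of the vorticity gradient along the orthogonal pair
    \<open>(-B, A)\<close> and \<open>(A, B)\<close>; the vorticity equation kills the second
    component.\<close>
  have "P * (A\<^sup>2 + B\<^sup>2) = (A * Q - B * P) * (- B) + A * (A * P + B * Q)"
       "Q * (A\<^sup>2 + B\<^sup>2) = (A * Q - B * P) * A + B * (A * P + B * Q)" by algebra+
  then have "P * (A\<^sup>2 + B\<^sup>2) = (A * Q - B * P) * (- B)" "Q * (A\<^sup>2 + B\<^sup>2) = (A * Q - B * P) * A" using AP by simp_all
  then have "P = (A * Q - B * P) / (A\<^sup>2 + B\<^sup>2) * (- B)" "Q = (A * Q - B * P) / (A\<^sup>2 + B\<^sup>2) * A"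
    using pos by (metis less_numeral_extra(3) nonzero_eq_divide_eq times_divide_eq_left)+
  then show "b11 x y - a12 x y = \<kappa> x y * (- b x y)" "b12 x y - a22 x y = \<kappa> x y * a x y"
    by (simp_all add: \<kappa>_def A_def B_def P_def Q_def)
qed

lemma continuous_\<kappa>: "continuous_on_strip \<kappa>"
  unfolding \<kappa>_def by (intro continuous_intros cont) (use speed_pos in \<open>auto simp: less_le\<close>)

lemma W_derivative:
  assumes "0 < snd z" "snd z < 1"
  shows "((\<lambda>z. W (fst z) (snd z)) has_derivative
    (\<lambda>h. \<kappa> (fst z) (snd z) * ((Ux (fst z) (snd z), Uy (fst z) (snd z)) \<bullet> h))) (at z)"
proof -
  have "((\<lambda>z. W (fst z) (snd z)) has_derivative (\<lambda>h. (b11 (fst z) (snd z) - a12 (fst z) (snd z),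
      b12 (fst z) (snd z) - a22 (fst z) (snd z)) \<bullet> h)) (at (fst z, snd z))"
  proof (rule has_derivative_of_partials[where Y = "{0<..<1}"
       and fx = "\<lambda>x y. b11 x y - a12 x y" and fy = "\<lambda>x y. b12 x y - a22 x y"])
    show "((\<lambda>s. W s (snd z)) has_real_derivative b11 (fst z) (snd z) - a12 (fst z) (snd z)) (at (fst z))"
      unfolding W_def using assms by (intro DERIV_diff b11 a21)
    show "((\<lambda>s. W x s) has_real_derivative b12 x y - a22 x y) (at y)" if "y \<in> {0<..<1}" for x y
      unfolding W_def using that by (intro DERIV_diff b12 a22) auto
    show "continuous_on (UNIV \<times> {0<..<1}) (\<lambda>z. b12 (fst z) (snd z) - a22 (fst z) (snd z))"
      by (rule continuous_on_subset[of "UNIV \<times> {0..1}"]) (auto intro!: continuous_intros cont)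
  qed (use assms in auto)
  moreover have "(b11 (fst z) (snd z) - a12 (fst z) (snd z), b12 (fst z) (snd z) - a22 (fst z) (snd z)) =
      \<kappa> (fst z) (snd z) *\<^sub>R (Ux (fst z) (snd z), Uy (fst z) (snd z))"
    using W_gradient[OF assms, of "fst z"] assms by (simp add: U_interior)
  ultimately show ?thesis by (simp del: scaleR_Pair)
qed

lemma U_gradient_nonzero: "(Ux x y, Uy x y) \<noteq> 0"
  using U_gradient_lower[of x y] eta(1) by (metis norm_zero not_less)

text \<open>Connectedness is available for levels in the whole plane, while \<open>W\<close> has
  meaning only in the strip. The value \<open>None\<close> outside makes the function locally
  constant on the whole level, which avoids both boundary lines since these are full levels of other
  values.\<close>

lemma W_function_of_u:
  assumes y: "0 < y" "y < 1" and y': "0 < y'" "y' < 1" and eq: "u x y = u x' y'"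
  shows "W x y = W x' y'"
proof -
  define F where "F z = (if 0 < snd z \<and> snd z < 1 then Some (W (fst z) (snd z)) else None)" for z :: "real \<times> real"
  define L where "L = {z. U (fst z) (snd z) = u x y}"
  define S where "S = {z :: real \<times> real. 0 < snd z \<and> snd z < 1}"
  have oS: "open S" unfolding S_def by (intro open_Collect_conj open_Collect_less continuous_intros)
  have "F (x, y) = F (x', y')"
  proof (rule connected_local_const)
    show "connected L" unfolding L_def by (rule U_level)
    show "(x, y) \<in> L" "(x', y') \<in> L" using assms by (auto simp: L_def U_interior)
    show "\<forall>p\<in>L. eventually (\<lambda>q. F p = F q) (at p within L)"
    proof
      fix p assume p: "p \<in> L"
      have ne: "snd p \<noteq> 0" "snd p \<noteq> 1"
        using U_eq_boundary_value[of "snd p" "fst p" "snd p"] p u_ne_boundary[OF y, of x] u0[of 0] u_top[of 0]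
        by (auto simp: L_def)
      show "eventually (\<lambda>q. F p = F q) (at p within L)"
      proof (cases "p \<in> S")
        case True
        obtain e where e: "e > 0" "\<And>q q'. dist q p < e \<Longrightarrow> dist q' p < e \<Longrightarrow>
            U (fst q) (snd q) = U (fst q') (snd q') \<Longrightarrow> W (fst q) (snd q) = W (fst q') (snd q')"
        proof (rule locally_constant_along_level_sets[OF oS True])
          show "((\<lambda>z. U (fst z) (snd z)) has_derivative (\<lambda>h. (Ux (fst z) (snd z), Uy (fst z) (snd z)) \<bullet> h)) (at z)" for z
            by (rule U_derivative)
          show "((\<lambda>z. W (fst z) (snd z)) has_derivative
              (\<lambda>h. \<kappa> (fst z) (snd z) * ((Ux (fst z) (snd z), Uy (fst z) (snd z)) \<bullet> h))) (at z)" if "z \<in> S" for z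
            using that by (intro W_derivative) (auto simp: S_def)
        qed (rule continuous_U_gradient, rule U_gradient_nonzero, rule that)
        have "eventually (\<lambda>q. q \<in> S) (at p within L)"
          by (rule filter_leD[OF at_le[OF subset_UNIV] eventually_at_in_open'[OF oS True]])
        moreover have "eventually (\<lambda>q. dist q p < e) (at p within L)"
          using e(1) by (auto simp: eventually_at)
        moreover have "eventually (\<lambda>q. q \<in> L) (at p within L)" by (auto simp: eventually_at_filter)
        ultimately show ?thesis
        proof eventually_elim
          case (elim q)
          then have "W (fst p) (snd p) = W (fst q) (snd q)" using e(1) e(2)[of p q] p by (simp add: L_def)
          then show ?case using True elim by (simp add: F_def S_def)
        qed
      next
        case False
        define S' where "S' = {z :: real \<times> real. snd z < 0} \<union> {z. 1 < snd z}"
        have oS': "open S'" unfolding S'_def by (intro open_Un open_Collect_less continuous_intros)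
        have pS': "p \<in> S'" using False ne by (auto simp: S'_def S_def)
        have "eventually (\<lambda>q. q \<in> S') (at p within L)"
          by (rule filter_leD[OF at_le[OF subset_UNIV] eventually_at_in_open'[OF oS' pS']])
        then show ?thesis
        proof eventually_elim
          case (elim q)
          then show ?case using pS' by (auto simp: F_def S'_def)
        qed
      qed
    qed
  qed
  then show ?thesis using y y' by (simp add: F_def)
qed

end

section \<open>Bounds for the vorticity, the velocity and the velocity gradient\<close>

lemma bounded_on_axis:
  assumes "continuous_on_strip f"
  obtains K where "K > 0" "\<And>y. 0 \<le> y \<Longrightarrow> y \<le> 1 \<Longrightarrow> \<bar>f 0 y\<bar> \<le> K"
proof -
  have "compact (f 0 ` {0..1})"
    by (intro compact_continuous_image continuous_on_strip_compose[OF assms] continuous_intros compact_Icc) auto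
  then show thesis using that unfolding compact_eq_bounded_closed bounded_pos by (auto simp: image_iff)
qed

context strip_flow begin

text \<open>The function \<open>f\<close> in \<open>W = f(u)\<close>, read off on the axis. For a
  value not attained inside the strip on the axis the chosen height is arbitrary and carries no
  meaning.\<close>

definition vorticity_of_level where
  "vorticity_of_level t = W 0 (SOME y. 0 < y \<and> y < 1 \<and> u 0 y = t)"

lemma W_eq_vorticity_of_level:
  assumes "0 < y" "y < 1"
  shows "W x y = vorticity_of_level (u x y)"
proof -
  obtain y0 where "0 < y0 \<and> y0 < 1 \<and> u 0 y0 = u x y" using crosses_axis[OF assms] by metis
  then have "0 < (SOME s. 0 < s \<and> s < 1 \<and> u 0 s = u x y) \<and> (SOME s. 0 < s \<and> s < 1 \<and> u 0 s = u x y) < 1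
      \<and> u 0 (SOME s. 0 < s \<and> s < 1 \<and> u 0 s = u x y) = u x y" by (rule someI)
  then show ?thesis unfolding vorticity_of_level_def using assms by (intro W_function_of_u) auto
qed

text \<open>Along the straight line in the direction \<open>g\<close> of the gradient of
  \<open>u\<close>, the level increases at initial rate \<open>g \<bullet> g\<close> and the
  vorticity changes at initial rate \<open>\<kappa> x y * (g \<bullet> g)\<close>; the quotient is
  the derivative. Since it depends on the level alone, so does \<open>\<kappa>\<close>.\<close>

lemma vorticity_of_level_derivative:
  assumes y: "0 < y" "y < 1"
  shows "(vorticity_of_level has_real_derivative \<kappa> x y) (at (u x y))"
proof -
  define G where "G z = (Ux (fst z) (snd z), Uy (fst z) (snd z))" for z
  define g where "g = G (x, y)"
  define p where "p s = (x, y) + s *\<^sub>R g" for s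
  have "g \<noteq> 0" unfolding g_def G_def fst_conv snd_conv by (rule U_gradient_nonzero)
  then have g0: "g \<bullet> g > 0" by (rule inner_gt_zero_iff[THEN iffD2])
  have contp: "continuous_on UNIV p" unfolding p_def by (intro continuous_intros)
  have dp: "(p has_derivative (\<lambda>h. h *\<^sub>R g)) (at s)" for s
    unfolding p_def by (auto intro!: derivative_eq_intros)
  have contG: "continuous_on UNIV (\<lambda>s. G (p s) \<bullet> g)"
    unfolding G_def by (intro continuous_intros continuous_on_compose2[OF continuous_U_gradient contp]) auto
  have "open {s. 0 < snd (p s) \<and> snd (p s) < 1 \<and> 0 < G (p s) \<bullet> g}"
    by (intro open_Collect_conj open_Collect_less continuous_intros contp contG)
  moreover have "0 \<in> {s. 0 < snd (p s) \<and> snd (p s) < 1 \<and> 0 < G (p s) \<bullet> g}"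
    using y g0 by (simp add: p_def g_def)
  ultimately obtain e where e: "e > 0" "ball 0 e \<subseteq> {s. 0 < snd (p s) \<and> snd (p s) < 1 \<and> 0 < G (p s) \<bullet> g}"
    using open_contains_ball by blast
  have in_strip: "0 < snd (p s)" "snd (p s) < 1" "0 < G (p s) \<bullet> g" if "\<bar>s\<bar> < e" for s
    using e(2) that by (auto simp: subset_iff)
  have "(vorticity_of_level has_real_derivative (\<kappa> x y * (g \<bullet> g)) / (G (p 0) \<bullet> g)) (at (U (fst (p 0)) (snd (p 0))))"
  proof (rule DERIV_of_composite[OF e(1), where \<beta> = "\<lambda>s. W (fst (p s)) (snd (p s))"
       and \<alpha> = "\<lambda>s. U (fst (p s)) (snd (p s))" and \<alpha>' = "\<lambda>s. G (p s) \<bullet> g"])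
    fix s :: real assume s: "\<bar>s\<bar> < e"
    show "((\<lambda>s. U (fst (p s)) (snd (p s))) has_real_derivative G (p s) \<bullet> g) (at s)"
      using has_derivative_compose[OF dp U_derivative, of s] unfolding has_field_derivative_def G_def
      by (rule has_derivative_eq_rhs) (simp add: fun_eq_iff algebra_simps)
    show "vorticity_of_level (U (fst (p s)) (snd (p s))) = W (fst (p s)) (snd (p s))"
      using in_strip[OF s] W_eq_vorticity_of_level by (simp add: U_interior)
    show "0 < G (p s) \<bullet> g" by (rule in_strip[OF s])
  next
    have "0 < snd (p 0)" "snd (p 0) < 1" using in_strip[of 0] e by auto
    from has_derivative_compose[OF dp W_derivative[OF this]]
    show "((\<lambda>s. W (fst (p s)) (snd (p s))) has_real_derivative \<kappa> x y * (g \<bullet> g)) (at 0)"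
      unfolding has_field_derivative_def 
      by (rule has_derivative_eq_rhs) (simp add: fun_eq_iff p_def g_def G_def algebra_simps)
  qed
  then show ?thesis using g0 y by (simp add: p_def g_def U_interior)
qed

lemma vorticity_bounded:
  obtains K where "K > 0" "\<And>x y. 0 < y \<Longrightarrow> y < 1 \<Longrightarrow> \<bar>W x y\<bar> \<le> K" "\<And>x y. 0 < y \<Longrightarrow> y < 1 \<Longrightarrow> \<bar>\<kappa> x y\<bar> \<le> K"
proof -
  have "continuous_on_strip W" unfolding W_def by (intro continuous_intros cont)
  then obtain K1 where K1: "K1 > 0" "\<And>y. 0 \<le> y \<Longrightarrow> y \<le> 1 \<Longrightarrow> \<bar>W 0 y\<bar> \<le> K1" by (rule bounded_on_axis) (rule that)
  obtain K2 where K2: "K2 > 0" "\<And>y. 0 \<le> y \<Longrightarrow> y \<le> 1 \<Longrightarrow> \<bar>\<kappa> 0 y\<bar> \<le> K2" by (rule bounded_on_axis[OF continuous_\<kappa>]) (rule that)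
  have "\<bar>W x y\<bar> \<le> max K1 K2 \<and> \<bar>\<kappa> x y\<bar> \<le> max K1 K2" if y: "0 < y" "y < 1" for x y
  proof -
    obtain y0 where y0: "0 < y0" "y0 < 1" "u 0 y0 = u x y" using crosses_axis[OF y] .
    have "W x y = W 0 y0" using W_function_of_u[OF y y0(1,2)] y0(3) by simp
    moreover have "\<kappa> x y = \<kappa> 0 y0"
      using vorticity_of_level_derivative[OF y, of x] vorticity_of_level_derivative[OF y0(1,2), of 0] y0(3)
      by (metis DERIV_unique)
    ultimately show ?thesis using K1(2)[of y0] K2(2)[of y0] y0 by auto
  qed
  then show thesis using that[of "max K1 K2"] K1(1) by auto
qed

lemma velocity_bounded:
  obtains M where "M > 0" "\<And>x y. 0 < y \<Longrightarrow> y < 1 \<Longrightarrow> \<bar>a x y\<bar> \<le> M" "\<And>x y. 0 < y \<Longrightarrow> y < 1 \<Longrightarrow> \<bar>b x y\<bar> \<le> M"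
proof -
  obtain K where K: "K > 0" "\<And>x y. 0 < y \<Longrightarrow> y < 1 \<Longrightarrow> \<bar>W x y\<bar> \<le> K" using vorticity_bounded by metis
  \<comment> \<open>Subtracting \<open>flux * y\<close> gives zero boundary values and leaves the
    Laplacian equal to \<open>- W\<close>. The summand 1 in \<open>K + 1\<close> makes the bound
    strict.\<close>
  interpret P: strip_dirichlet "\<lambda>x y. u x y - flux * y" "\<lambda>x y. - b x y" "\<lambda>x y. a x y - flux"
    "\<lambda>x y. - b1 x y" a2 "2 * \<bar>flux\<bar>" "K + 1"
  proof
    show "continuous_on_strip (\<lambda>x y. u x y - flux * y)" by (intro continuous_intros cont_u)
    fix x y :: real
    show "u x 0 - flux * 0 = 0" "u x 1 - flux * 1 = 0" by (simp_all add: u0 u_top)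
    assume y: "0 < y" "y < 1"
    show "((\<lambda>s. u s y - flux * y) has_real_derivative - b x y) (at x)"
      using y by (auto intro!: derivative_eq_intros ux)
    show "((\<lambda>s. u x s - flux * s) has_real_derivative a x y - flux) (at y)"
      using y by (auto intro!: derivative_eq_intros uy_interior)
    show "((\<lambda>s. - b s y) has_real_derivative - b1 x y) (at x)"
      using y by (auto intro!: derivative_eq_intros b1)
    show "((\<lambda>s. a x s - flux) has_real_derivative a2 x y) (at y)"
      using y by (auto intro!: derivative_eq_intros a2)
    have "\<bar>flux * y\<bar> \<le> \<bar>flux\<bar>" using y by (simp add: abs_mult mult_left_le)
    then show "\<bar>u x y - flux * y\<bar> \<le> 2 * \<bar>flux\<bar>" using abs_u_le[OF y, of x] by linarith
    show "\<bar>- b1 x y + a2 x y\<bar> < K + 1" using K(2)[OF y, of x] by (simp add: W_def)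
  qed
  define M where "M = 4 * (2 * \<bar>flux\<bar>) + 2 * (K + 1) + \<bar>flux\<bar>"
  have "\<bar>a x y\<bar> \<le> M \<and> \<bar>b x y\<bar> \<le> M" if y: "0 < y" "y < 1" for x y
    using P.gradient_bound[OF y, of x] by (auto simp: M_def)
  then show thesis using that[of M] K(1) by (auto simp: M_def)
qed

lemma velocity_gradient_bounded:
  obtains M where "M > 0" "\<And>x y. 0 < y \<Longrightarrow> y < 1 \<Longrightarrow> \<bar>a x y\<bar> \<le> M" "\<And>x y. 0 < y \<Longrightarrow> y < 1 \<Longrightarrow> \<bar>b x y\<bar> \<le> M"
    "\<And>x y. 0 < y \<Longrightarrow> y < 1 \<Longrightarrow> \<bar>a1 x y\<bar> \<le> M" "\<And>x y. 0 < y \<Longrightarrow> y < 1 \<Longrightarrow> \<bar>a2 x y\<bar> \<le> M"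
    "\<And>x y. 0 < y \<Longrightarrow> y < 1 \<Longrightarrow> \<bar>b1 x y\<bar> \<le> M" "\<And>x y. 0 < y \<Longrightarrow> y < 1 \<Longrightarrow> \<bar>b2 x y\<bar> \<le> M"
proof -
  obtain K where K: "K > 0" "\<And>x y. 0 < y \<Longrightarrow> y < 1 \<Longrightarrow> \<bar>W x y\<bar> \<le> K" "\<And>x y. 0 < y \<Longrightarrow> y < 1 \<Longrightarrow> \<bar>\<kappa> x y\<bar> \<le> K"
    using vorticity_bounded by metis
  obtain M where M: "M > 0" "\<And>x y. 0 < y \<Longrightarrow> y < 1 \<Longrightarrow> \<bar>a x y\<bar> \<le> M" "\<And>x y. 0 < y \<Longrightarrow> y < 1 \<Longrightarrow> \<bar>b x y\<bar> \<le> M"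
    using velocity_bounded by metis
  interpret P: strip_dirichlet b b1 b2 b11 b22 M "K * M + 1"
  proof
    fix x y :: real
    assume y: "0 < y" "y < 1"
    \<comment> \<open>The divergence condition turns the Laplacian of \<open>b\<close> into the
      horizontal derivative of \<open>W\<close>, which equals \<open>- \<kappa> b\<close>; hence no
      third derivatives are needed for a gradient bound.\<close>
    have "b11 x y + b22 x y = \<kappa> x y * (- b x y)" using W_gradient[OF y] div_deriv[OF y] by simp
    then have "\<bar>b11 x y + b22 x y\<bar> = \<bar>\<kappa> x y\<bar> * \<bar>b x y\<bar>" by (simp add: abs_mult)
    also have "\<dots> \<le> K * M" using K M y by (intro mult_mono) (auto simp: less_imp_le)
    finally show "\<bar>b11 x y + b22 x y\<bar> < K * M + 1" by simp
  qed (use cont b1 b2 b11 b22 bottom top M in auto)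
  define q where "q = K * M"
  define N where "N = 4 * M + 2 * (q + 1) + M + K"
  have KM: "q > 0" using K M by (simp add: q_def)
  have "\<bar>a x y\<bar> \<le> N \<and> \<bar>b x y\<bar> \<le> N \<and> \<bar>a1 x y\<bar> \<le> N \<and> \<bar>a2 x y\<bar> \<le> N \<and> \<bar>b1 x y\<bar> \<le> N \<and> \<bar>b2 x y\<bar> \<le> N" if y: "0 < y" "y < 1" for x y
  proof -
    have "\<bar>a2 x y\<bar> \<le> \<bar>b1 x y\<bar> + \<bar>W x y\<bar>" by (simp add: W_def)
    moreover have "\<bar>a1 x y\<bar> = \<bar>b2 x y\<bar>" using div[of y x] y by simp
    ultimately show ?thesis
      using P.gradient_bound[OF y, of x] M(2)[OF y, of x] M(3)[OF y, of x] K(2)[OF y, of x] KM M(1) K(1)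
      unfolding N_def q_def[symmetric] by linarith
  qed
  moreover have "N > 0" unfolding N_def by (intro add_pos_pos mult_pos_pos KM M(1) K(1)) simp_all
  ultimately show thesis using that[of N] by blast
qed

end

section \<open>The polar angle: maximum principle with drift and rigidity\<close>

text \<open>This form of the quotient rule isolates the logarithmic derivative of the denominator.
  With the squared speed as denominator it is the drift coefficient.\<close>

lemma DERIV_quotient:
  fixes f g :: "real \<Rightarrow> real"
  assumes "(f has_real_derivative f') (at t)" "(g has_real_derivative g') (at t)" "g t > 0"
  shows "((\<lambda>s. f s / g s) has_real_derivative f' / g t - g' / g t * (f t / g t)) (at t)"
  using assms by (auto intro!: derivative_eq_intros simp: field_simps)

text \<open>A small multiple of a growing supersolution is subtracted, so that long rectangles are
  controlled on all four sides; letting the multiple tend to zero removes it.\<close>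

lemma strip_max_principle:
  fixes F Fx Fy Fxx Fyy p q :: "real \<Rightarrow> real \<Rightarrow> real"
  assumes cont: "continuous_on_strip F"
    and Fx: "\<And>x y. 0 < y \<Longrightarrow> y < 1 \<Longrightarrow> ((\<lambda>s. F s y) has_real_derivative Fx x y) (at x)"
    and Fy: "\<And>x y. 0 < y \<Longrightarrow> y < 1 \<Longrightarrow> ((\<lambda>s. F x s) has_real_derivative Fy x y) (at y)"
    and Fxx: "\<And>x y. 0 < y \<Longrightarrow> y < 1 \<Longrightarrow> ((\<lambda>s. Fx s y) has_real_derivative Fxx x y) (at x)"
    and Fyy: "\<And>x y. 0 < y \<Longrightarrow> y < 1 \<Longrightarrow> ((\<lambda>s. Fy x s) has_real_derivative Fyy x y) (at y)"
    and bd: "\<And>x. F x 0 \<le> 0" "\<And>x. F x 1 \<le> 0"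
    and A: "\<And>x y. 0 < y \<Longrightarrow> y < 1 \<Longrightarrow> F x y \<le> A"
    and pq: "\<And>x y. 0 < y \<Longrightarrow> y < 1 \<Longrightarrow> \<bar>p x y\<bar> \<le> \<beta>" "\<And>x y. 0 < y \<Longrightarrow> y < 1 \<Longrightarrow> \<bar>q x y\<bar> \<le> \<beta>"
    and sub: "\<And>x y. 0 < y \<Longrightarrow> y < 1 \<Longrightarrow> Fxx x y + Fyy x y + p x y * Fx x y + q x y * Fy x y \<ge> 0"
    and y0: "0 \<le> y0" "y0 \<le> 1"
  shows "F x0 y0 \<le> 0"
proof -
  have \<beta>: "\<beta> \<ge> 0" using pq(1)[of "1/2" 0] by auto
  \<comment> \<open>With \<open>l = \<beta> + 1\<close> the exponential satisfies
    \<open>l^2 - \<beta> * l = l\<close>, so its second derivative absorbs the vertical drift with a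
    margin. \<open>K\<close> keeps \<open>r\<close> above 1, and \<open>d\<close> is small enough
    that growth in \<open>x\<close>, even times the horizontal drift, uses up less than this
    margin.\<close>
  define l where "l = \<beta> + 1"
  define K where "K = exp l + 1"
  define d where "d = 1 / (2 * K)"
  define E where "E y = exp (l * y)" for y
  define r where "r y = K - E y" for y
  define m where "m x = 1 + d\<^sup>2 * x\<^sup>2" for x
  have l: "l \<ge> 1" using \<beta> by (simp add: l_def)
  have K: "K \<ge> 2" using l by (simp add: K_def)
  have d: "0 < d" "d \<le> 1/4" "d * K = 1/2" using K by (auto simp: d_def field_simps)
  have E1: "E y \<ge> 1" if "0 \<le> y" for y using l that by (simp add: E_def)
  have r: "1 \<le> r y" "r y \<le> K" if "0 \<le> y" "y \<le> 1" for y
  proof -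
    have "E y \<le> exp l" using that l by (simp add: E_def mult_left_le)
    then show "1 \<le> r y" by (simp add: r_def K_def)
    show "r y \<le> K" by (simp add: r_def E_def)
  qed
  have m1: "m x \<ge> 1" for x by (simp add: m_def)
  \<comment> \<open>The square of \<open>d * |x| - 1\<close> is nonnegative; this bounds the
    horizontal slope of \<open>m\<close> by \<open>m\<close> itself, uniformly in
    \<open>x\<close>.\<close>
  have m2: "2 * d * \<bar>x\<bar> \<le> m x" for x
    using zero_le_power2[of "d * \<bar>x\<bar> - 1"] by (simp add: m_def power2_diff power_mult_distrib)
  text \<open>\<open>\<Psi> = m r\<close> is a strict supersolution of the equation that tends to infinity at both ends.\<close>
  have super: "2 * d\<^sup>2 * r y - m x * (l\<^sup>2 * E y) + p x y * (2 * d\<^sup>2 * x * r y) + q x y * (- m x * (l * E y)) < 0"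
    if y: "0 < y" "y < 1" for x y
  proof -
    have r': "1 \<le> r y" "r y \<le> K" using r y by auto
    have "2 * d\<^sup>2 * r y \<le> 2 * d\<^sup>2 * K" using r' by (intro mult_left_mono) auto
    also have "\<dots> = d" using d(3) by (simp add: power2_eq_square)
    also have "\<dots> \<le> m x * (1/4)" using d m1[of x] by auto
    finally have 1: "2 * d\<^sup>2 * r y \<le> m x * (1/4)" .
    have "p x y * (2 * d\<^sup>2 * x * r y) \<le> \<bar>p x y\<bar> * (2 * d * \<bar>x\<bar>) * (d * r y)"
      using abs_ge_self[of "p x y * (2 * d\<^sup>2 * x * r y)"] r' d by (simp add: abs_mult power2_eq_square mult_ac)
    also have "\<dots> \<le> \<beta> * m x * (d * K)"
      using pq(1)[OF y, of x] m2[of x] m1[of x] r' d \<beta> by (intro mult_mono) (auto intro!: mult_nonneg_nonneg)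
    also have "\<dots> = m x * (\<beta> / 2)" unfolding d(3) by simp
    finally have 2: "p x y * (2 * d\<^sup>2 * x * r y) \<le> m x * (\<beta> / 2)" .
    have "- q x y \<le> \<beta>" using pq(2)[OF y, of x] by auto
    then have "(- q x y) * (m x * (l * E y)) \<le> \<beta> * (m x * (l * E y))"
      using m1[of x] l E1[of y] y by (intro mult_right_mono) (auto intro!: mult_nonneg_nonneg)
    then have "q x y * (- m x * (l * E y)) - m x * (l\<^sup>2 * E y) \<le> m x * (\<beta> * (l * E y)) - m x * (l\<^sup>2 * E y)" by (simp add: mult_ac)
    also have "\<dots> = m x * (- (l * E y))" by (simp add: l_def algebra_simps power2_eq_square)
    also have "\<dots> \<le> m x * (- l)" using m1[of x] l E1[of y] y by (intro mult_left_mono) auto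
    finally have "2 * d\<^sup>2 * r y - m x * (l\<^sup>2 * E y) + p x y * (2 * d\<^sup>2 * x * r y) + q x y * (- m x * (l * E y))
       \<le> m x * (1/4) + m x * (\<beta> / 2) + m x * (- l)" using 1 2 by linarith
    also have "\<dots> = m x * (1/4 + \<beta>/2 - l)" by (simp add: algebra_simps)
    also have "\<dots> < 0" using m1[of x] \<beta> by (intro mult_pos_neg) (auto simp: l_def)
    finally show ?thesis .
  qed
  have le: "F x0 y0 \<le> \<epsilon> * (m x0 * r y0)" if \<epsilon>: "\<epsilon> > 0" for \<epsilon>
  proof -
    \<comment> \<open>Wide enough to contain \<open>x0\<close> and to give
      \<open>A \<le> \<epsilon> * m N\<close> on the lateral sides; \<open>N \<ge> 1\<close> lets
      the linear choice be used for \<open>N^2\<close>.\<close>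
    define N where "N = \<bar>x0\<bar> + 1 + \<bar>A\<bar> / (\<epsilon> * d\<^sup>2)"
    have N: "N \<ge> 1" "\<bar>x0\<bar> \<le> N" "\<bar>A\<bar> / (\<epsilon> * d\<^sup>2) \<le> N" using \<epsilon> d by (auto simp: N_def)
    have "\<bar>A\<bar> / (\<epsilon> * d\<^sup>2) \<le> N\<^sup>2" using N(1,3) self_le_power[of N 2] by simp
    then have "\<bar>A\<bar> \<le> \<epsilon> * (d\<^sup>2 * N\<^sup>2)" using \<epsilon> d by (simp add: pos_divide_le_eq mult_ac)
    then have AN: "A \<le> \<epsilon> * m N" using \<epsilon> by (simp add: m_def algebra_simps)
    have "F x0 y0 - \<epsilon> * (m x0 * r y0) \<le> 0"
    proof (rule rectangle_max_principle[where ?x1.0 = "-N" and ?x2.0 = N and ?y1.0 = 0 and ?y2.0 = 1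
         and F = "\<lambda>x y. F x y - \<epsilon> * (m x * r y)"
         and Fx = "\<lambda>x y. Fx x y - \<epsilon> * (2 * d\<^sup>2 * x * r y)" and Fxx = "\<lambda>x y. Fxx x y - \<epsilon> * (2 * d\<^sup>2 * r y)"
         and Fy = "\<lambda>x y. Fy x y + \<epsilon> * (m x * (l * E y))" and Fyy = "\<lambda>x y. Fyy x y + \<epsilon> * (m x * (l\<^sup>2 * E y))"])
      show "continuous_on ({- N..N} \<times> {0..1}) (\<lambda>z. F (fst z) (snd z) - \<epsilon> * (m (fst z) * r (snd z)))"
        unfolding m_def r_def E_def by (intro continuous_intros continuous_on_subset[OF cont]) auto
    next
      fix x y :: real assume "- N < x" "x < N" and y: "0 < y" "y < 1"
      show "((\<lambda>s. F s y - \<epsilon> * (m s * r y)) has_real_derivative Fx x y - \<epsilon> * (2 * d\<^sup>2 * x * r y)) (at x)"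
        unfolding m_def using y by (auto intro!: derivative_eq_intros Fx)
      show "((\<lambda>s. F x s - \<epsilon> * (m x * r s)) has_real_derivative Fy x y + \<epsilon> * (m x * (l * E y))) (at y)"
        unfolding r_def E_def using y by (auto intro!: derivative_eq_intros Fy)
      show "((\<lambda>s. Fx s y - \<epsilon> * (2 * d\<^sup>2 * s * r y)) has_real_derivative Fxx x y - \<epsilon> * (2 * d\<^sup>2 * r y)) (at x)"
        using y by (auto intro!: derivative_eq_intros Fxx)
      show "((\<lambda>s. Fy x s + \<epsilon> * (m x * (l * E s))) has_real_derivative Fyy x y + \<epsilon> * (m x * (l\<^sup>2 * E y))) (at y)"
        unfolding E_def using y by (auto intro!: derivative_eq_intros Fyy simp: power2_eq_square)
      assume "Fx x y - \<epsilon> * (2 * d\<^sup>2 * x * r y) = 0" "Fy x y + \<epsilon> * (m x * (l * E y)) = 0"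
      then have e: "Fx x y = \<epsilon> * (2 * d\<^sup>2 * x * r y)" "Fy x y = \<epsilon> * (- m x * (l * E y))" by auto
      have "\<epsilon> * (2 * d\<^sup>2 * r y - m x * (l\<^sup>2 * E y) + p x y * (2 * d\<^sup>2 * x * r y) + q x y * (- m x * (l * E y))) < 0"
        using \<epsilon> super[OF y, of x] by (simp add: mult_pos_neg)
      then show "Fxx x y - \<epsilon> * (2 * d\<^sup>2 * r y) + (Fyy x y + \<epsilon> * (m x * (l\<^sup>2 * E y))) > 0"
        using sub[OF y, of x] unfolding e by (simp add: algebra_simps)
    next
      fix x y :: real assume xy: "- N \<le> x" "x \<le> N" "0 \<le> y" "y \<le> 1" "x = - N \<or> x = N \<or> y = 0 \<or> y = 1"
      have pos: "\<epsilon> * (m x * r y) \<ge> 0" using \<epsilon> m1[of x] r[OF xy(3,4)] by simp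
      show "F x y - \<epsilon> * (m x * r y) \<le> 0"
      proof (cases "y = 0 \<or> y = 1")
        case True
        then have "F x y \<le> 0" using bd by auto
        then show ?thesis using pos by simp
      next
        case False
        then have "m x = m N" using xy by (auto simp: m_def)
        have "F x y \<le> A" using False xy by (intro A) auto
        also have "A \<le> \<epsilon> * m N * 1" using AN by simp
        also have "\<dots> \<le> \<epsilon> * m N * r y" using \<epsilon> m1[of N] r[OF xy(3,4)] by (intro mult_left_mono) auto
        finally show ?thesis using \<open>m x = m N\<close> by (simp add: mult_ac)
      qed
    qed (use N y0 in auto)
    then show ?thesis by simp
  qed
  show ?thesis
  proof (rule ccontr)
    assume "\<not> F x0 y0 \<le> 0"
    then have pos: "F x0 y0 > 0" by simp
    have Pp: "m x0 * r y0 > 0" using m1[of x0] r[OF y0] by (intro mult_pos_pos) auto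
    \<comment> \<open>In place of a limit, this one value of \<open>\<epsilon>\<close> makes the
      barrier equal to half of \<open>F x0 y0\<close>.\<close>
    have "F x0 y0 \<le> F x0 y0 / (2 * (m x0 * r y0)) * (m x0 * r y0)" by (rule le) (use pos Pp in auto)
    also have "\<dots> = F x0 y0 / 2" using m1[of x0] r(1)[OF y0] by auto
    finally show False using pos by simp
  qed
qed

context strip_flow begin

definition "speed2 x y = (a x y)\<^sup>2 + (b x y)\<^sup>2"

text \<open>\<open>(P, R)\<close> is the gradient of the polar angle of the velocity.\<close>

definition "P x y = (a x y * b1 x y - b x y * a1 x y) / speed2 x y"
definition "R x y = (a x y * b2 x y - b x y * a2 x y) / speed2 x y"
text \<open>\<open>p1\<close> and \<open>p2\<close> are the components of the gradient of log
  \<open>|v|^2\<close>, the drift of the angle equation.\<close>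

definition "p1 x y = 2 * (a x y * a1 x y + b x y * b1 x y) / speed2 x y"
definition "p2 x y = 2 * (a x y * a2 x y + b x y * b2 x y) / speed2 x y"
definition "P1 x y = (a x y * b11 x y - b x y * a11 x y) / speed2 x y - p1 x y * P x y"
definition "P2 x y = (a2 x y * b1 x y + a x y * b12 x y - b2 x y * a1 x y - b x y * a12 x y) / speed2 x y - p2 x y * P x y"
definition "R2 x y = (a x y * b22 x y - b x y * a22 x y) / speed2 x y - p2 x y * R x y"

lemma speed2_pos: "0 \<le> y \<Longrightarrow> y \<le> 1 \<Longrightarrow> speed2 x y > 0"
  unfolding speed2_def by (rule speed_pos)

lemma speed2_derivative:
  assumes "0 < y" "y < 1"
  shows "((\<lambda>s. speed2 s y) has_real_derivative 2 * (a x y * a1 x y + b x y * b1 x y)) (at x)"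
    "((\<lambda>s. speed2 x s) has_real_derivative 2 * (a x y * a2 x y + b x y * b2 x y)) (at y)"
  unfolding speed2_def using assms by (auto intro!: derivative_eq_intros a1 a2 b1 b2)

lemma P_derivative:
  assumes y: "0 < y" "y < 1"
  shows "((\<lambda>s. P s y) has_real_derivative P1 x y) (at x)" "((\<lambda>s. P x s) has_real_derivative P2 x y) (at y)"
proof -
  have s: "speed2 x y > 0" using speed2_pos y by simp
  have "((\<lambda>s. a s y * b1 s y - b s y * a1 s y) has_real_derivative a x y * b11 x y - b x y * a11 x y) (at x)"
    using y by (auto intro!: derivative_eq_intros a1 b1 a11 b11)
  from DERIV_quotient[OF this speed2_derivative(1)[OF y] s] show "((\<lambda>s. P s y) has_real_derivative P1 x y) (at x)"
    unfolding P_def P1_def p1_def .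
  have "((\<lambda>s. a x s * b1 x s - b x s * a1 x s) has_real_derivative
      a2 x y * b1 x y + a x y * b12 x y - b2 x y * a1 x y - b x y * a12 x y) (at y)"
    using y by (auto intro!: derivative_eq_intros a2 b2 a12 b12)
  from DERIV_quotient[OF this speed2_derivative(2)[OF y] s] show "((\<lambda>s. P x s) has_real_derivative P2 x y) (at y)"
    unfolding P_def P2_def p2_def .
qed

lemma R_derivative:
  assumes y: "0 < y" "y < 1"
  shows "((\<lambda>s. R s y) has_real_derivative P2 x y) (at x)" "((\<lambda>s. R x s) has_real_derivative R2 x y) (at y)"
proof -
  have s: "speed2 x y > 0" using speed2_pos y by simp
  have "((\<lambda>s. a x s * b2 x s - b x s * a2 x s) has_real_derivative a x y * b22 x y - b x y * a22 x y) (at y)"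
    using y by (auto intro!: derivative_eq_intros a2 b2 a22 b22)
  from DERIV_quotient[OF this speed2_derivative(2)[OF y] s] show "((\<lambda>s. R x s) has_real_derivative R2 x y) (at y)"
    unfolding R_def R2_def p2_def .
  define R1 where "R1 = (a1 x y * b2 x y + a x y * b12 x y - b1 x y * a2 x y - b x y * a12 x y) / speed2 x y - p1 x y * R x y"
  have "((\<lambda>s. a s y * b2 s y - b s y * a2 s y) has_real_derivative
      a1 x y * b2 x y + a x y * b12 x y - b1 x y * a2 x y - b x y * a12 x y) (at x)"
    using y by (auto intro!: derivative_eq_intros a1 b1 a21 b21)
  from DERIV_quotient[OF this speed2_derivative(1)[OF y] s] have "((\<lambda>s. R s y) has_real_derivative R1) (at x)"
    unfolding R_def R1_def p1_def .
  \<comment> \<open>Closedness of the angular form of a nonvanishing field: terms with second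
    derivatives agree on both sides, and what remains is a polynomial identity in the field and its
    first derivatives.\<close>
  moreover have "R1 = P2 x y"
  proof -
    define S where "S = speed2 x y"
    have S: "S \<noteq> 0" using s by (simp add: S_def)
    have "(R1 - P2 x y) * S * S = ((a1 x y * b2 x y - b1 x y * a2 x y) - (a2 x y * b1 x y - b2 x y * a1 x y)) * S
       - 2 * (a x y * a1 x y + b x y * b1 x y) * (a x y * b2 x y - b x y * a2 x y)
       + 2 * (a x y * a2 x y + b x y * b2 x y) * (a x y * b1 x y - b x y * a1 x y)"
      unfolding R1_def P2_def p1_def p2_def P_def R_def S_def[symmetric] using S by (simp add: field_simps)
    also have "\<dots> = 0" unfolding S_def speed2_def by algebra
    finally show ?thesis using S by simp
  qed
  ultimately show "((\<lambda>s. R s y) has_real_derivative P2 x y) (at x)" by simp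
qed

text \<open>\<open>|v|^2\<close> times the angle gradient is
  \<open>a \<nabla>b - b \<nabla>a\<close>, whose divergence
  \<open>a \<Delta>b - b \<Delta>a\<close> equals the derivative of \<open>W\<close> along
  \<open>v\<close> for a divergence-free field. Dividing by \<open>|v|^2\<close> gives the stated
  form.\<close>

lemma angle_equation:
  assumes y: "0 < y" "y < 1"
  shows "P1 x y + R2 x y + p1 x y * P x y + p2 x y * R x y = 0"
proof -
  have "P1 x y + R2 x y + p1 x y * P x y + p2 x y * R x y =
      (a x y * (b11 x y - a12 x y) + b x y * (b12 x y - a22 x y)) / speed2 x y"
    unfolding P1_def R2_def using div_deriv[OF y, of x] by (simp add: add_divide_distrib diff_divide_distrib algebra_simps)
  then show ?thesis using vorticity[OF y] by simp
qed

lemma continuous_angle_gradient: "continuous_on_strip P" "continuous_on_strip R" "continuous_on_strip P2"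
  unfolding P_def R_def P2_def p2_def speed2_def
  by (intro continuous_intros cont; use speed_pos in \<open>auto simp: less_le\<close>)+

lemma P_boundary: "P x 0 = 0" "P x 1 = 0"
proof -
  have d: "((\<lambda>s. b s y) has_real_derivative b1 x y) (at x)" if "0 \<le> y" "y \<le> 1" for y
    using horizontal_derivative_closed[OF cont(2,5) b1 that] .
  have "((\<lambda>s. 0) has_real_derivative b1 x 0) (at x)" "((\<lambda>s. 0) has_real_derivative b1 x 1) (at x)"
    using d[of 0] d[of 1] by (simp_all add: bottom top)
  then have "b1 x 0 = 0" "b1 x 1 = 0" by (auto intro: DERIV_unique[OF _ DERIV_const])
  then show "P x 0 = 0" "P x 1 = 0" by (simp_all add: P_def bottom top)
qed

end

lemma bounded_on_closed_strip:
  assumes f: "continuous_on_strip f" and M: "\<And>x y. 0 < y \<Longrightarrow> y < 1 \<Longrightarrow> \<bar>f x y\<bar> \<le> M" and y: "0 \<le> y" "y \<le> 1"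
  shows "\<bar>f x y\<bar> \<le> M"
proof -
  have "norm (f x y) \<le> M"
  proof (rule continuous_on_closure_norm_le[of "{0<..<1}" "f x"])
    show "continuous_on (closure {0<..<1}) (f x)"
      by (simp, intro continuous_on_strip_compose[OF f] continuous_intros) auto
  qed (use M y in auto)
  then show ?thesis by simp
qed

context strip_flow begin

text \<open>Constructing the angle as a potential of its gradient avoids any choice of branch. It is
  normalized to zero on the bottom; on the top it is constant because \<open>P\<close> vanishes
  there.\<close>

lemma angle_potential:
  obtains \<theta> k where "continuous_on_strip \<theta>" "\<And>x. \<theta> x 0 = 0" "\<And>x. \<theta> x 1 = k"
    "\<And>x y. 0 \<le> y \<Longrightarrow> y \<le> 1 \<Longrightarrow> ((\<lambda>s. \<theta> s y) has_real_derivative P x y) (at x)"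
    "\<And>x y. 0 \<le> y \<Longrightarrow> y \<le> 1 \<Longrightarrow> ((\<lambda>s. \<theta> x s) has_real_derivative R x y) (at y within {0..1})"
proof -
  obtain \<theta> where \<theta>: "continuous_on_strip \<theta>" "\<And>x. \<theta> x 0 = 0"
    "\<And>x y. 0 \<le> y \<Longrightarrow> y \<le> 1 \<Longrightarrow> ((\<lambda>s. \<theta> s y) has_real_derivative P x y) (at x)"
    "\<And>x y. 0 \<le> y \<Longrightarrow> y \<le> 1 \<Longrightarrow> ((\<lambda>s. \<theta> x s) has_real_derivative R x y) (at y within {0..1})"
    by (rule strip_potential[OF continuous_angle_gradient R_derivative(1) P_derivative(2) P_boundary(1)]) (assumption | rule that)+
  have "((\<lambda>s. \<theta> s 1) has_real_derivative 0) (at x)" for x using \<theta>(3)[of 1 x] by (simp add: P_boundary)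
  then have "\<theta> x 1 = \<theta> 0 1" for x using DERIV_isconst_all[of "\<lambda>s. \<theta> s 1"] by blast
  then show thesis using that[of \<theta> "\<theta> 0 1"] \<theta> by auto
qed

text \<open>If the angle differed on the two boundary lines, comparison with a function of \<open>x\<^sub>2\<close> alone would
  make \<open>\<bar>a\<bar>\<^sup>2\<close> strictly monotone at a uniform rate along the line \<open>x\<^sub>2 = 0\<close>, hence unbounded.\<close>

lemma angle_gradient_zero:
  assumes y: "0 < y" "y < 1"
  shows "R x y = 0"
proof -
  obtain M where M: "M > 0" "\<And>x y. 0 < y \<Longrightarrow> y < 1 \<Longrightarrow> \<bar>a x y\<bar> \<le> M" "\<And>x y. 0 < y \<Longrightarrow> y < 1 \<Longrightarrow> \<bar>b x y\<bar> \<le> M"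
    "\<And>x y. 0 < y \<Longrightarrow> y < 1 \<Longrightarrow> \<bar>a1 x y\<bar> \<le> M" "\<And>x y. 0 < y \<Longrightarrow> y < 1 \<Longrightarrow> \<bar>a2 x y\<bar> \<le> M"
    "\<And>x y. 0 < y \<Longrightarrow> y < 1 \<Longrightarrow> \<bar>b1 x y\<bar> \<le> M" "\<And>x y. 0 < y \<Longrightarrow> y < 1 \<Longrightarrow> \<bar>b2 x y\<bar> \<le> M"
    by (rule velocity_gradient_bounded) (rule that)
  define \<beta> where "\<beta> = 4 * (M * M) / \<eta>\<^sup>2"
  \<comment> \<open>One estimate for all three quotients: \<open>c = 1\<close> gives both drift
    coefficients, \<open>c = -1\<close> gives \<open>R\<close>.\<close>
  have quot: "\<bar>(f * g + c * h * i) / speed2 x y\<bar> \<le> \<beta> / 2"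
    if y: "0 < y" "y < 1" and fg: "\<bar>f\<bar> \<le> M" "\<bar>g\<bar> \<le> M" "\<bar>h\<bar> \<le> M" "\<bar>i\<bar> \<le> M" and c: "\<bar>c\<bar> = 1" for f g h i c x y
  proof -
    have "\<bar>f * g + c * h * i\<bar> \<le> \<bar>f\<bar> * \<bar>g\<bar> + \<bar>h\<bar> * \<bar>i\<bar>" using abs_triangle_ineq[of "f * g" "c * h * i"] c by (simp add: abs_mult)
    also have "\<dots> \<le> M * M + M * M" using fg M(1) by (intro add_mono mult_mono) auto
    finally have "\<bar>f * g + c * h * i\<bar> \<le> 2 * (M * M)" by simp
    moreover have "\<eta>\<^sup>2 \<le> speed2 x y" "0 < speed2 x y" "0 < \<eta>\<^sup>2" using eta(2)[of y x] eta(1) speed2_pos[of y x] y by (auto simp: speed2_def)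
    ultimately have "\<bar>f * g + c * h * i\<bar> / speed2 x y \<le> 2 * (M * M) / \<eta>\<^sup>2" by (intro frac_le) auto
    then show ?thesis using \<open>0 < speed2 x y\<close> by (simp add: \<beta>_def abs_divide)
  qed
  have p1: "\<bar>p1 x y\<bar> \<le> \<beta>" if y: "0 < y" "y < 1" for x y
  proof -
    have e: "p1 x y = 2 * ((a x y * a1 x y + 1 * b x y * b1 x y) / speed2 x y)" by (simp add: p1_def)
    show ?thesis unfolding e abs_mult abs_numeral
      using quot[OF y M(2)[OF y] M(4)[OF y] M(3)[OF y] M(6)[OF y], of 1 x x x x x] by linarith
  qed
  have p2: "\<bar>p2 x y\<bar> \<le> \<beta>" if y: "0 < y" "y < 1" for x y
  proof -
    have e: "p2 x y = 2 * ((a x y * a2 x y + 1 * b x y * b2 x y) / speed2 x y)" by (simp add: p2_def)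
    show ?thesis unfolding e abs_mult abs_numeral
      using quot[OF y M(2)[OF y] M(5)[OF y] M(3)[OF y] M(7)[OF y], of 1 x x x x x] by linarith
  qed
  have R_bound: "\<bar>R x y\<bar> \<le> \<beta> / 2" if y: "0 < y" "y < 1" for x y
    using quot[OF y M(2)[OF y] M(7)[OF y] M(3)[OF y] M(5)[OF y], of "-1" x x x x x] by (simp add: R_def)
  have \<beta>: "\<beta> \<ge> 0" using M(1) by (simp add: \<beta>_def)
  obtain \<theta> k where \<theta>: "continuous_on_strip \<theta>" "\<And>x. \<theta> x 0 = 0" "\<And>x. \<theta> x 1 = k"
    "\<And>x y. 0 \<le> y \<Longrightarrow> y \<le> 1 \<Longrightarrow> ((\<lambda>s. \<theta> s y) has_real_derivative P x y) (at x)"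
    "\<And>x y. 0 \<le> y \<Longrightarrow> y \<le> 1 \<Longrightarrow> ((\<lambda>s. \<theta> x s) has_real_derivative R x y) (at y within {0..1})"
    by (rule angle_potential) (rule that)
  have \<theta>y: "((\<lambda>s. \<theta> x s) has_real_derivative R x y) (at y)" if "0 < y" "y < 1" for x y
    using \<theta>(5)[of y x] that by (simp add: at_within_Icc_at)
  have \<theta>_bound: "\<bar>\<theta> x y\<bar> \<le> \<beta>" if y: "0 < y" "y < 1" for x y
  proof -
    have "continuous_on {0..y} (\<theta> x)" using y by (intro continuous_on_strip_compose[OF \<theta>(1)] continuous_intros) auto
    moreover have "\<theta> x differentiable (at z)" if "0 < z" "z < y" for z
      using \<theta>y[of z x] that y by (auto simp: real_differentiable_def)
    ultimately have "\<exists>l z. 0 < z \<and> z < y \<and> (\<theta> x has_real_derivative l) (at z) \<and> \<theta> x y - \<theta> x 0 = (y - 0) * l"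
      using y by (intro MVT) auto
    then obtain l z where z: "0 < z" "z < y" "(\<theta> x has_real_derivative l) (at z)" "\<theta> x y - \<theta> x 0 = (y - 0) * l"
      by blast
    then have "l = R x z" using \<theta>y[of z x] y DERIV_unique by auto
    then have "\<theta> x y = y * R x z" using z(4) \<theta>(2) by simp
    then have "\<bar>\<theta> x y\<bar> = y * \<bar>R x z\<bar>" using y by (simp add: abs_mult)
    also have "\<dots> \<le> 1 * (\<beta> / 2)" using y z R_bound[of z x] by (intro mult_mono) auto
    finally show ?thesis using \<beta> by simp
  qed
  define l where "l = \<beta> + 1"
  have l: "l \<ge> 1" using \<beta> by (simp add: l_def)
  have el: "exp l - 1 > 0" using l by simp
  \<comment> \<open>Makes \<open>D * (exp (l * y) - 1)\<close> equal to 0 on the bottom and to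
    \<open>|k|\<close> on the top, the boundary values of \<open>\<sigma> * \<theta>\<close>. Since
    \<open>l\<close> exceeds the drift bound, this function is a subsolution.\<close>
  define D where "D = \<bar>k\<bar> / (exp l - 1)"
  have D: "D \<ge> 0" using el by (simp add: D_def)
  have lower: "D * (exp (l * y) - 1) \<le> \<sigma> * \<theta> x y"
    if \<sigma>: "\<bar>\<sigma>\<bar> = 1" "\<sigma> * k = \<bar>k\<bar>" and y: "0 \<le> y" "y \<le> 1" for \<sigma> x y
  proof -
    have "D * (exp (l * y) - 1) - \<sigma> * \<theta> x y \<le> 0"
    proof (rule strip_max_principle[OF _ _ _ _ _ _ _ _ p1 p2 _ y, where F = "\<lambda>x y. D * (exp (l * y) - 1) - \<sigma> * \<theta> x y"
        and Fx = "\<lambda>x y. - \<sigma> * P x y" and Fxx = "\<lambda>x y. - \<sigma> * P1 x y"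
        and Fy = "\<lambda>x y. D * l * exp (l * y) - \<sigma> * R x y" and Fyy = "\<lambda>x y. D * l * l * exp (l * y) - \<sigma> * R2 x y"
        and A = "D * exp l + \<beta>"])
      show "continuous_on_strip (\<lambda>x y. D * (exp (l * y) - 1) - \<sigma> * \<theta> x y)" by (intro continuous_intros \<theta>(1))
      fix x y :: real
      show "D * (exp (l * 0) - 1) - \<sigma> * \<theta> x 0 \<le> 0" by (simp add: \<theta>(2))
      show "D * (exp (l * 1) - 1) - \<sigma> * \<theta> x 1 \<le> 0" using el \<sigma> by (simp add: \<theta>(3) D_def)
      assume y: "0 < y" "y < 1"
      show "((\<lambda>s. D * (exp (l * y) - 1) - \<sigma> * \<theta> s y) has_real_derivative - \<sigma> * P x y) (at x)"
        using y by (auto intro!: derivative_eq_intros \<theta>(4))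
      show "((\<lambda>s. D * (exp (l * s) - 1) - \<sigma> * \<theta> x s) has_real_derivative D * l * exp (l * y) - \<sigma> * R x y) (at y)"
        using y by (auto intro!: derivative_eq_intros \<theta>y)
      show "((\<lambda>s. - \<sigma> * P s y) has_real_derivative - \<sigma> * P1 x y) (at x)"
        using y by (auto intro!: derivative_eq_intros P_derivative(1))
      show "((\<lambda>s. D * l * exp (l * s) - \<sigma> * R x s) has_real_derivative D * l * l * exp (l * y) - \<sigma> * R2 x y) (at y)"
        using y by (auto intro!: derivative_eq_intros R_derivative(2))
      have "exp (l * y) \<le> exp l" using y l by (simp add: mult_left_le)
      then have "D * (exp (l * y) - 1) \<le> D * exp l" using D by (intro mult_left_mono) linarith+
      moreover have "- (\<sigma> * \<theta> x y) \<le> \<beta>" using \<theta>_bound[OF y, of x] \<sigma> abs_ge_minus_self[of "\<sigma> * \<theta> x y"] by (simp add: abs_mult)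
      ultimately show "D * (exp (l * y) - 1) - \<sigma> * \<theta> x y \<le> D * exp l + \<beta>" by linarith
      have "- \<sigma> * P1 x y + (D * l * l * exp (l * y) - \<sigma> * R2 x y) + p1 x y * (- \<sigma> * P x y) + p2 x y * (D * l * exp (l * y) - \<sigma> * R x y)
         = D * l * exp (l * y) * (l + p2 x y) - \<sigma> * (P1 x y + R2 x y + p1 x y * P x y + p2 x y * R x y)"
        by (simp add: algebra_simps)
      also have "\<dots> = D * l * exp (l * y) * (l + p2 x y)" using angle_equation[OF y] by simp
      also have "\<dots> \<ge> 0" using D l p2[OF y, of x] by (intro mult_nonneg_nonneg) (auto simp: l_def)
      finally show "0 \<le> - \<sigma> * P1 x y + (D * l * l * exp (l * y) - \<sigma> * R2 x y) + p1 x y * (- \<sigma> * P x y) + p2 x y * (D * l * exp (l * y) - \<sigma> * R x y)" .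
    qed
    then show ?thesis by simp
  qed
  have "k = 0"
  proof (rule ccontr)
    assume k: "k \<noteq> 0"
    define \<sigma> where "\<sigma> = sgn k"
    have \<sigma>: "\<bar>\<sigma>\<bar> = 1" "\<sigma> * k = \<bar>k\<bar>" using k by (auto simp: \<sigma>_def sgn_if)
    have Dp: "D > 0" using k el by (simp add: D_def)
    \<comment> \<open>A boundary-point estimate of Hopf type: the subsolution and
      \<open>\<sigma> * \<theta>\<close> touch on the bottom, so the slope \<open>D * l\<close>
      passes to the vertical derivative of the angle. Tangent continuation supplies the two-sided
      derivative that the comparison lemma expects.\<close>
    have Rlow: "\<sigma> * R x 0 \<ge> D * l" for x
    proof (rule deriv_le_of_le[where z = 0 and e = 1])
      show "((\<lambda>s. D * (exp (l * s) - 1)) has_real_derivative D * l) (at 0)"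
        by (auto intro!: derivative_eq_intros)
      show "((\<lambda>s. \<sigma> * (\<theta> x (clamp01 s) + (s - clamp01 s) * R x (clamp01 s))) has_real_derivative \<sigma> * R x 0) (at 0)"
        using linear_extension_derivative[of "\<theta> x" "R x" 0, OF \<theta>(5)]
        by (auto intro!: DERIV_cmult simp: clamp01_def)
      show "D * (exp (l * (0 + s)) - 1) \<le> \<sigma> * (\<theta> x (clamp01 (0 + s)) + (0 + s - clamp01 (0 + s)) * R x (clamp01 (0 + s)))"
        if "0 < s" "s < 1" for s
        using lower[OF \<sigma>, of s x] that by (simp add: clamp01_def)
    qed (simp_all add: \<theta>(2) clamp01_def)
    have deriv: "((\<lambda>s. \<sigma> * (a s 0)\<^sup>2) has_real_derivative \<sigma> * (2 * a x 0 * a1 x 0)) (at x)" for x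
      using horizontal_derivative_closed[OF cont(1,3) a1, of 0 x] by (auto intro!: derivative_eq_intros)
    have slope: "\<sigma> * (2 * a x 0 * a1 x 0) \<le> - 2 * (D * l * \<eta>\<^sup>2)" for x
    proof -
      have a0: "\<eta>\<^sup>2 \<le> (a x 0)\<^sup>2" using eta(2)[of 0 x] by (simp add: bottom)
      then have ne: "a x 0 \<noteq> 0" using eta(1) by auto
      have "R x 0 = - a1 x 0 / a x 0" using ne div[of 0 x] by (simp add: R_def speed2_def bottom power2_eq_square)
      then have "a x 0 * a1 x 0 = - ((a x 0)\<^sup>2 * R x 0)" using ne by (simp add: power2_eq_square)
      then have "\<sigma> * (2 * a x 0 * a1 x 0) = - 2 * ((\<sigma> * R x 0) * (a x 0)\<^sup>2)" by (simp add: mult_ac)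
      moreover have "(D * l) * \<eta>\<^sup>2 \<le> (\<sigma> * R x 0) * (a x 0)\<^sup>2"
        using Dp l by (intro mult_mono[OF Rlow a0]) (auto intro: order_trans[OF _ Rlow])
      ultimately show ?thesis by linarith
    qed
    have Dl: "D * l * \<eta>\<^sup>2 > 0" using Dp l eta(1) by simp
    \<comment> \<open>Over this length \<open>\<sigma> * a^2\<close> would drop by at least
      \<open>4 * M^2 + 2\<close>, while its oscillation is at most \<open>2 * M^2\<close>.\<close>
    define X where "X = (2 * M\<^sup>2 + 1) / (D * l * \<eta>\<^sup>2)"
    have X: "X > 0" unfolding X_def by (intro divide_pos_pos add_nonneg_pos Dl) simp_all
    have XD: "X * (D * l * \<eta>\<^sup>2) = 2 * M\<^sup>2 + 1" unfolding X_def times_divide_eq_left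
      by (rule nonzero_mult_div_cancel_right[OF less_imp_neq[OF Dl, symmetric]])
    have "\<exists>z. 0 < z \<and> z < X \<and> \<sigma> * (a X 0)\<^sup>2 - \<sigma> * (a 0 0)\<^sup>2 = (X - 0) * (\<sigma> * (2 * a z 0 * a1 z 0))"
      by (rule MVT2[OF X]) (rule deriv)
    then obtain z where z: "\<sigma> * (a X 0)\<^sup>2 - \<sigma> * (a 0 0)\<^sup>2 = X * (\<sigma> * (2 * a z 0 * a1 z 0))" by auto
    also have "\<dots> \<le> X * (- 2 * (D * l * \<eta>\<^sup>2))" by (rule mult_left_mono[OF slope less_imp_le[OF X]])
    also have "\<dots> = - 2 * (X * (D * l * \<eta>\<^sup>2))" by (simp only: mult_ac)
    also have "\<dots> = - 4 * M\<^sup>2 - 2" unfolding XD by simp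
    finally have "\<sigma> * (a X 0)\<^sup>2 - \<sigma> * (a 0 0)\<^sup>2 \<le> - 4 * M\<^sup>2 - 2" .
    moreover have "(a x 0)\<^sup>2 \<le> M\<^sup>2" for x
      using bounded_on_closed_strip[OF cont(1) M(2), of 0 x] M(1) abs_le_square_iff[of "a x 0" M] by simp
    then have "\<bar>\<sigma> * (a X 0)\<^sup>2\<bar> \<le> M\<^sup>2" "\<bar>\<sigma> * (a 0 0)\<^sup>2\<bar> \<le> M\<^sup>2" using \<sigma> by (simp_all add: abs_mult)
    ultimately show False using zero_le_power2[of M] by linarith
  qed
  \<comment> \<open>With \<open>k = 0\<close> the barrier is zero and both signs of
    \<open>\<sigma>\<close> are admissible, giving the two opposite inequalities.\<close>
  then have zero: "\<theta> x y = 0" if "0 \<le> y" "y \<le> 1" for x y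
    using lower[of 1 y x] lower[of "-1" y x] that by (simp add: D_def)
  have "((\<lambda>s. \<theta> x s) has_real_derivative 0) (at y)"
  proof (rule has_field_derivative_transform_within_open[OF DERIV_const, where S = "{0<..<1}"])
    show "\<And>s. s \<in> {0<..<1} \<Longrightarrow> 0 = \<theta> x s" using zero by auto
  qed (use y in auto)
  then show ?thesis using \<theta>y[OF y, of x] DERIV_unique by blast
qed

text \<open>\<open>b^2 / |v|^2\<close> is the squared sine of the polar angle. Its vertical
  derivative contains \<open>R\<close> as a factor, and it vanishes on the bottom. Working with it
  avoids dividing by \<open>a\<close>, whose nonvanishing inside is not yet known.\<close>

lemma b_zero_interior:
  assumes y: "0 < y" "y < 1"
  shows "b x y = 0"
proof -
  define g where "g s = (b x s)\<^sup>2 / speed2 x s" for s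
  have "(g has_real_derivative 0) (at s)" if s: "0 < s" "s < y" for s
  proof -
    have s1: "0 < s" "s < 1" using s y by auto
    have sp: "speed2 x s > 0" using speed2_pos s1 by simp
    have num: "a x s * b2 x s - b x s * a2 x s = 0"
      using angle_gradient_zero[OF s1, of x] sp by (simp add: R_def)
    have "((\<lambda>s. (b x s)\<^sup>2) has_real_derivative 2 * b x s * b2 x s) (at s)"
      using s1 by (auto intro!: derivative_eq_intros b2)
    from DERIV_quotient[OF this speed2_derivative(2)[OF s1] sp]
    have "(g has_real_derivative 2 * b x s * b2 x s / speed2 x s - 2 * (a x s * a2 x s + b x s * b2 x s) / speed2 x s * ((b x s)\<^sup>2 / speed2 x s)) (at s)"
      unfolding g_def .
    moreover have "2 * b x s * b2 x s / speed2 x s - 2 * (a x s * a2 x s + b x s * b2 x s) / speed2 x s * ((b x s)\<^sup>2 / speed2 x s)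
        = (2 * b x s * b2 x s * speed2 x s - 2 * (a x s * a2 x s + b x s * b2 x s) * (b x s)\<^sup>2) / (speed2 x s)\<^sup>2"
      using sp by (simp add: field_simps power2_eq_square)
    moreover have "2 * b x s * b2 x s * speed2 x s - 2 * (a x s * a2 x s + b x s * b2 x s) * (b x s)\<^sup>2
        = 2 * a x s * b x s * (a x s * b2 x s - b x s * a2 x s)" unfolding speed2_def by algebra
    ultimately show ?thesis using num by simp
  qed
  moreover have "continuous_on {0..y} g" unfolding g_def speed2_def
    by (intro continuous_intros continuous_on_strip_compose[OF cont(1)] continuous_on_strip_compose[OF cont(2)])
      (use y speed_pos in \<open>auto simp: less_le\<close>)
  ultimately have "g y = g 0" using y by (intro DERIV_isconst_end) auto
  then show ?thesis using speed2_pos[of y x] y by (simp add: g_def bottom)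
qed

lemma shear_flow:
  assumes "0 \<le> y" "y \<le> 1"
  shows "b x y = 0" "a x y = a 0 y"
proof -
  show "b x y = 0" using assms b_zero_interior[of y x] bottom top by (cases "y = 0 \<or> y = 1") auto
  have "a1 x y = 0" if y: "0 < y" "y < 1" for x y
  proof -
    have "((\<lambda>s. b x s) has_real_derivative 0) (at y)"
    proof (rule has_field_derivative_transform_within_open[OF DERIV_const, where S = "{0<..<1}"])
      show "\<And>s. s \<in> {0<..<1} \<Longrightarrow> 0 = b x s" using b_zero_interior by auto
    qed (use y in auto)
    then have "b2 x y = 0" using b2[OF y] DERIV_unique by blast
    then show ?thesis using div[of y x] y by simp
  qed
  then have "a x y = a 0 y" if y: "0 < y" "y < 1" for y
    using DERIV_isconst_all[of "\<lambda>s. a s y" x 0] a1[OF y] y by metis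
  then show "a x y = a 0 y"
    by (intro strip_boundary_limit[OF _ _ _ assms, of "a x" "a 0"] continuous_on_strip_compose[OF cont(1)] continuous_intros) auto
qed

end

section \<open>Passage to coordinates\<close>

definition point :: "real \<Rightarrow> real \<Rightarrow> real ^ 2" where
  "point x y = (\<chi> i. if i = 1 then x else y)"

lemma point_nth [simp]: "point x y $ 1 = x" "point x y $ 2 = y"
  by (simp_all add: point_def)

lemma point_eta: "point (x $ 1) (x $ 2) = x"
  by (simp add: vec_eq_iff forall_2)

lemma point_add_axis: "point x y + t *\<^sub>R axis 1 1 = point (x + t) y" "point x y + t *\<^sub>R axis 2 1 = point x (y + t)"
  by (simp_all add: vec_eq_iff forall_2 axis_def)

lemma continuous_on_point: "continuous_on A (\<lambda>z. point (fst z) (snd z))"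
proof -
  have "continuous_on A (\<lambda>z. \<chi> i. if i = (1::2) then fst z else snd z)"
  proof (rule continuous_on_vec_lambda)
    show "continuous_on A (\<lambda>z. if i = (1::2) then fst z else snd z)" for i
      by (cases "i = 1") (auto intro!: continuous_intros)
  qed
  then show ?thesis by (simp add: point_def)
qed

lemma point_in_strip: "point x y \<in> strip \<longleftrightarrow> 0 < y \<and> y < 1"
  by (simp add: strip_def)

lemma point_in_closure_strip: "point x y \<in> closure strip \<longleftrightarrow> 0 \<le> y \<and> y \<le> 1"
proof
  have "closure strip \<subseteq> {x. 0 \<le> x $ 2 \<and> x $ 2 \<le> 1}"
    by (intro closure_minimal closed_Collect_conj closed_Collect_le continuous_intros) (auto simp: strip_def)
  then show "point x y \<in> closure strip \<Longrightarrow> 0 \<le> y \<and> y \<le> 1" by auto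
next
  assume y: "0 \<le> y \<and> y \<le> 1"
  have "point x ` closure {0<..<1} \<subseteq> closure strip"
  proof (rule image_closure_subset)
    show "continuous_on (closure {0<..<1}) (point x)"
      using continuous_on_compose2[OF continuous_on_point continuous_on_Pair[OF continuous_on_const continuous_on_id] subset_UNIV]
      by simp
    show "point x ` {0<..<1} \<subseteq> closure strip" using closure_subset point_in_strip by fastforce
  qed simp
  then show "point x y \<in> closure strip" using y by auto
qed

lemma point_in_frontier_strip: "y = 0 \<or> y = 1 \<Longrightarrow> point x y \<in> frontier strip"
  unfolding frontier_def using point_in_closure_strip[of x y] interior_subset[of strip] point_in_strip[of x y] by auto

lemma continuous_on_strip_point:
  assumes "continuous_on (closure strip) f"
  shows "continuous_on_strip (\<lambda>x y. f (point x y))"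
  by (rule continuous_on_compose2[OF assms continuous_on_point]) (auto simp: point_in_closure_strip)

lemma has_partial_point:
  "has_partial f 1 D (point x y) \<longleftrightarrow> ((\<lambda>s. f (point s y)) has_real_derivative D) (at x)"
  "has_partial f 2 D (point x y) \<longleftrightarrow> ((\<lambda>s. f (point x s)) has_real_derivative D) (at y)"
  using DERIV_shift[of "\<lambda>s. f (point s y)" D 0 x] DERIV_shift[of "\<lambda>s. f (point x s)" D 0 y]
  by (simp_all add: has_partial_def point_add_axis add.commute)

lemma has_partial_imp_partial: "has_partial f i D x \<Longrightarrow> partial i f x = D"
  unfolding has_partial_def partial_def by (rule DERIV_imp_deriv)

text \<open>The second difference over a small square, evaluated by mean values in both orders. This
  form asks for continuity of the mixed derivatives only, so it also applies to the pressure, which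
  is merely given with partial derivatives.\<close>

lemma mixed_partials_eq:
  fixes f f1 f2 f12 f21 :: "real \<Rightarrow> real \<Rightarrow> real"
  assumes f1: "\<And>x y. 0 < y \<Longrightarrow> y < 1 \<Longrightarrow> ((\<lambda>s. f s y) has_real_derivative f1 x y) (at x)"
    and f2: "\<And>x y. 0 < y \<Longrightarrow> y < 1 \<Longrightarrow> ((\<lambda>s. f x s) has_real_derivative f2 x y) (at y)"
    and f12: "\<And>x y. 0 < y \<Longrightarrow> y < 1 \<Longrightarrow> ((\<lambda>s. f1 x s) has_real_derivative f12 x y) (at y)"
    and f21: "\<And>x y. 0 < y \<Longrightarrow> y < 1 \<Longrightarrow> ((\<lambda>s. f2 s y) has_real_derivative f21 x y) (at x)"
    and cont: "continuous_on_strip f12" "continuous_on_strip f21"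
    and y: "0 < y" "y < 1"
  shows "f12 x y = f21 x y"
proof (rule ccontr)
  assume ne: "f12 x y \<noteq> f21 x y"
  define e where "e = \<bar>f12 x y - f21 x y\<bar> / 2"
  have e: "e > 0" using ne by (simp add: e_def)
  have xy: "(x, y) \<in> UNIV \<times> {0..1}" using y by auto
  obtain d1 where d1: "d1 > 0" "\<And>s t. 0 \<le> t \<Longrightarrow> t \<le> 1 \<Longrightarrow> dist (s, t) (x, y) < d1 \<Longrightarrow> \<bar>f12 s t - f12 x y\<bar> < e"
    using cont(1)[unfolded continuous_on_iff, rule_format, OF xy e] by (auto simp: dist_real_def)
  obtain d2 where d2: "d2 > 0" "\<And>s t. 0 \<le> t \<Longrightarrow> t \<le> 1 \<Longrightarrow> dist (s, t) (x, y) < d2 \<Longrightarrow> \<bar>f21 s t - f21 x y\<bar> < e"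
    using cont(2)[unfolded continuous_on_iff, rule_format, OF xy e] by (auto simp: dist_real_def)
  \<comment> \<open>A side of at most one third of the radii keeps the square inside both continuity
    balls, as the distance is below \<open>2 * h\<close>; the bound by \<open>1 - y\<close> keeps it
    inside the strip.\<close>
  define h where "h = min (min d1 d2) (1 - y) / 3"
  have h: "0 < h" "3 * h \<le> d1" "3 * h \<le> d2" "3 * h \<le> 1 - y" using d1 d2 y by (auto simp: h_def)
  then have "y + h < 1" by linarith
  note h = h this
  have near: "dist (s, t) (x, y) < d1 \<and> dist (s, t) (x, y) < d2" if "x < s" "s < x + h" "y < t" "t < y + h" for s t
  proof -
    have "dist (s, t) (x, y) \<le> \<bar>s - x\<bar> + \<bar>t - y\<bar>"
      using sqrt_sum_squares_le_sum_abs[of "s - x" "t - y"] by (simp add: dist_prod_def dist_real_def)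
    then show ?thesis using that h by auto
  qed
  define q where "q = f (x + h) (y + h) - f (x + h) y - f x (y + h) + f x y"
  have "\<exists>s. x < s \<and> s < x + h \<and> (f (x + h) (y + h) - f (x + h) y) - (f x (y + h) - f x y) = (x + h - x) * (f1 s (y + h) - f1 s y)"
    by (rule MVT2) (use h y in \<open>auto intro!: derivative_eq_intros f1\<close>)
  then obtain s1 where s1: "x < s1" "s1 < x + h" "q = h * (f1 s1 (y + h) - f1 s1 y)" by (auto simp: q_def)
  have "\<exists>t. y < t \<and> t < y + h \<and> f1 s1 (y + h) - f1 s1 y = (y + h - y) * f12 s1 t"
    by (rule MVT2) (use h y in \<open>auto intro!: f12\<close>)
  then obtain t1 where t1: "y < t1" "t1 < y + h" "q = h * (h * f12 s1 t1)" using s1(3) by auto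
  have "\<exists>t. y < t \<and> t < y + h \<and> (f (x + h) (y + h) - f x (y + h)) - (f (x + h) y - f x y) = (y + h - y) * (f2 (x + h) t - f2 x t)"
    by (rule MVT2) (use h y in \<open>auto intro!: derivative_eq_intros f2\<close>)
  then obtain t2 where t2: "y < t2" "t2 < y + h" "q = h * (f2 (x + h) t2 - f2 x t2)" by (auto simp: q_def)
  have "\<exists>s. x < s \<and> s < x + h \<and> f2 (x + h) t2 - f2 x t2 = (x + h - x) * f21 s t2"
    by (rule MVT2) (use h y t2 in \<open>auto intro!: f21\<close>)
  then obtain s2 where s2: "x < s2" "s2 < x + h" "q = h * (h * f21 s2 t2)" using t2(3) by auto
  have "f12 s1 t1 = f21 s2 t2" using t1(3) s2(3) h(1) by simp
  moreover have "\<bar>f12 s1 t1 - f12 x y\<bar> < e" using d1(2)[of t1 s1] near[of s1 t1] s1 t1 y h by auto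
  moreover have "\<bar>f21 s2 t2 - f21 x y\<bar> < e" using d2(2)[of t2 s2] near[of s2 t2] s2 t2 y h by auto
  ultimately show False by (auto simp: e_def abs_if split: if_splits)
qed

lemma C2_closure_strip_coordinates:
  assumes "C2_closure strip f"
  obtains f1 f2 f11 f12 f22 where
    "continuous_on_strip (\<lambda>x y. f (point x y))" "continuous_on_strip f1" "continuous_on_strip f2"
    "continuous_on_strip f11" "continuous_on_strip f12" "continuous_on_strip f22"
    "\<And>x y. 0 < y \<Longrightarrow> y < 1 \<Longrightarrow> ((\<lambda>s. f (point s y)) has_real_derivative f1 x y) (at x)"
    "\<And>x y. 0 < y \<Longrightarrow> y < 1 \<Longrightarrow> ((\<lambda>s. f (point x s)) has_real_derivative f2 x y) (at y)"
    "\<And>x y. 0 < y \<Longrightarrow> y < 1 \<Longrightarrow> ((\<lambda>s. f1 s y) has_real_derivative f11 x y) (at x)"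
    "\<And>x y. 0 < y \<Longrightarrow> y < 1 \<Longrightarrow> ((\<lambda>s. f1 x s) has_real_derivative f12 x y) (at y)"
    "\<And>x y. 0 < y \<Longrightarrow> y < 1 \<Longrightarrow> ((\<lambda>s. f2 s y) has_real_derivative f12 x y) (at x)"
    "\<And>x y. 0 < y \<Longrightarrow> y < 1 \<Longrightarrow> ((\<lambda>s. f2 x s) has_real_derivative f22 x y) (at y)"
    "\<And>x y. 0 < y \<Longrightarrow> y < 1 \<Longrightarrow> partial 1 f (point x y) = f1 x y"
    "\<And>x y. 0 < y \<Longrightarrow> y < 1 \<Longrightarrow> partial 2 f (point x y) = f2 x y"
proof -
  from assms obtain g h where cf: "continuous_on (closure strip) f"
    and cg: "\<And>i. continuous_on (closure strip) (g i)" and dg: "\<And>i x. x \<in> strip \<Longrightarrow> has_partial f i (g i x) x"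
    and ch: "\<And>i j. continuous_on (closure strip) (h i j)" and dh: "\<And>i j x. x \<in> strip \<Longrightarrow> has_partial (g i) j (h i j x) x"
    unfolding C2_closure_def by blast
  have p: "point x y \<in> strip" if "0 < y" "y < 1" for x y using that by (simp add: point_in_strip)
  have d1: "((\<lambda>s. f (point s y)) has_real_derivative g 1 (point x y)) (at x)"
    and d2: "((\<lambda>s. f (point x s)) has_real_derivative g 2 (point x y)) (at y)"
    and d11: "((\<lambda>s. g i (point s y)) has_real_derivative h i 1 (point x y)) (at x)"
    and d12: "((\<lambda>s. g i (point x s)) has_real_derivative h i 2 (point x y)) (at y)"
    if "0 < y" "y < 1" for x y i
    using dg[OF p[OF that]] dh[OF p[OF that]] has_partial_point by blast+
  have mixed: "h 2 1 (point x y) = h 1 2 (point x y)" if "0 < y" "y < 1" for x y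
    by (rule mixed_partials_eq[where f = "\<lambda>x y. f (point x y)" and ?f1.0 = "\<lambda>x y. g 1 (point x y)"
       and ?f2.0 = "\<lambda>x y. g 2 (point x y)" and ?f12.0 = "\<lambda>x y. h 1 2 (point x y)" and ?f21.0 = "\<lambda>x y. h 2 1 (point x y)", symmetric])
      (use d1 d2 d11 d12 that continuous_on_strip_point[OF ch] in auto)
  show thesis
  proof (rule that[of "\<lambda>x y. g 1 (point x y)" "\<lambda>x y. g 2 (point x y)" "\<lambda>x y. h 1 1 (point x y)"
      "\<lambda>x y. h 1 2 (point x y)" "\<lambda>x y. h 2 2 (point x y)"])
    show "((\<lambda>s. g 2 (point s y)) has_real_derivative h 1 2 (point x y)) (at x)" if "0 < y" "y < 1" for x y
      using d11[OF that, of 2 x] mixed[OF that] by simp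
  qed (use d1 d2 d11 d12 has_partial_imp_partial[OF dg[OF p]] continuous_on_strip_point cf cg ch in auto)
qed

theorem theorem1p1:
  fixes v :: "real ^ 2 \<Rightarrow> real ^ 2" and p :: "real ^ 2 \<Rightarrow> real"
  assumes "\<And>i. C2_closure strip (\<lambda>x. v x $ i)"
    and "steady_euler strip v p"
    and "\<And>x. x \<in> frontier strip \<Longrightarrow> v x $ 2 = 0"
    and "(INF x\<in>strip. norm (v x)) > 0"
  shows "(\<forall>x\<in>closure strip. v x $ 2 = 0) \<and>
         (\<exists>U :: real \<Rightarrow> real. \<forall>x\<in>closure strip. v x $ 1 = U (x $ 2))"
proof -
  obtain a1 a2 a11 a12 a22 where a:
    "continuous_on_strip (\<lambda>x y. v (point x y) $ 1)" "continuous_on_strip a1" "continuous_on_strip a2"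
    "continuous_on_strip a11" "continuous_on_strip a12" "continuous_on_strip a22"
    "\<And>x y. 0 < y \<Longrightarrow> y < 1 \<Longrightarrow> ((\<lambda>s. v (point s y) $ 1) has_real_derivative a1 x y) (at x)"
    "\<And>x y. 0 < y \<Longrightarrow> y < 1 \<Longrightarrow> ((\<lambda>s. v (point x s) $ 1) has_real_derivative a2 x y) (at y)"
    "\<And>x y. 0 < y \<Longrightarrow> y < 1 \<Longrightarrow> ((\<lambda>s. a1 s y) has_real_derivative a11 x y) (at x)"
    "\<And>x y. 0 < y \<Longrightarrow> y < 1 \<Longrightarrow> ((\<lambda>s. a1 x s) has_real_derivative a12 x y) (at y)"
    "\<And>x y. 0 < y \<Longrightarrow> y < 1 \<Longrightarrow> ((\<lambda>s. a2 s y) has_real_derivative a12 x y) (at x)"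
    "\<And>x y. 0 < y \<Longrightarrow> y < 1 \<Longrightarrow> ((\<lambda>s. a2 x s) has_real_derivative a22 x y) (at y)"
    and pa: "\<And>x y. 0 < y \<Longrightarrow> y < 1 \<Longrightarrow> partial 1 (\<lambda>x. v x $ 1) (point x y) = a1 x y"
      "\<And>x y. 0 < y \<Longrightarrow> y < 1 \<Longrightarrow> partial 2 (\<lambda>x. v x $ 1) (point x y) = a2 x y"
  proof (rule C2_closure_strip_coordinates[OF assms(1)[of 1]], goal_cases)
    case (1 f1 f2 f11 f12 f22)
    from 1(2-) show ?case by (rule that[of f1 f2 f11 f12 f22])
  qed
  obtain b1 b2 b11 b12 b22 where b:
    "continuous_on_strip (\<lambda>x y. v (point x y) $ 2)" "continuous_on_strip b1" "continuous_on_strip b2"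
    "continuous_on_strip b11" "continuous_on_strip b12" "continuous_on_strip b22"
    "\<And>x y. 0 < y \<Longrightarrow> y < 1 \<Longrightarrow> ((\<lambda>s. v (point s y) $ 2) has_real_derivative b1 x y) (at x)"
    "\<And>x y. 0 < y \<Longrightarrow> y < 1 \<Longrightarrow> ((\<lambda>s. v (point x s) $ 2) has_real_derivative b2 x y) (at y)"
    "\<And>x y. 0 < y \<Longrightarrow> y < 1 \<Longrightarrow> ((\<lambda>s. b1 s y) has_real_derivative b11 x y) (at x)"
    "\<And>x y. 0 < y \<Longrightarrow> y < 1 \<Longrightarrow> ((\<lambda>s. b1 x s) has_real_derivative b12 x y) (at y)"
    "\<And>x y. 0 < y \<Longrightarrow> y < 1 \<Longrightarrow> ((\<lambda>s. b2 s y) has_real_derivative b12 x y) (at x)"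
    "\<And>x y. 0 < y \<Longrightarrow> y < 1 \<Longrightarrow> ((\<lambda>s. b2 x s) has_real_derivative b22 x y) (at y)"
    and pb: "\<And>x y. 0 < y \<Longrightarrow> y < 1 \<Longrightarrow> partial 1 (\<lambda>x. v x $ 2) (point x y) = b1 x y"
      "\<And>x y. 0 < y \<Longrightarrow> y < 1 \<Longrightarrow> partial 2 (\<lambda>x. v x $ 2) (point x y) = b2 x y"
  proof (rule C2_closure_strip_coordinates[OF assms(1)[of 2]], goal_cases)
    case (1 f1 f2 f11 f12 f22)
    from 1(2-) show ?case by (rule that[of f1 f2 f11 f12 f22])
  qed
  define A B where "A x y = v (point x y) $ 1" and "B x y = v (point x y) $ 2" for x y
  note a = a[folded A_def] and b = b[folded B_def]
  have in_strip: "point x y \<in> strip" if "0 < y" "y < 1" for x y using that by (simp add: point_in_strip)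
  have div: "a1 x y + b2 x y = 0" if y: "0 < y" "y < 1" for x y
    using assms(2) in_strip[OF y, of x] pa[OF y, of x] pb[OF y, of x]
    by (auto simp: steady_euler_def divergence_def sum_2)
  have pressure: "((\<lambda>s. p (point s y)) has_real_derivative - (A x y * a1 x y + B x y * a2 x y)) (at x)"
    "((\<lambda>s. p (point x s)) has_real_derivative - (A x y * b1 x y + B x y * b2 x y)) (at y)" if y: "0 < y" "y < 1" for x y
  proof -
    obtain D E where DE: "has_partial p 1 D (point x y)" "has_partial p 2 E (point x y)"
      using assms(2) in_strip[OF y, of x] unfolding steady_euler_def by blast
    have "advection v (point x y) + gradient p (point x y) = 0"
      using assms(2) in_strip[OF y, of x] unfolding steady_euler_def by blast
    then have "A x y * a1 x y + B x y * a2 x y + D = 0" "A x y * b1 x y + B x y * b2 x y + E = 0"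
      using pa[OF y, of x] pb[OF y, of x] has_partial_imp_partial[OF DE(1)] has_partial_imp_partial[OF DE(2)]
      by (simp_all add: vec_eq_iff forall_2 advection_def gradient_def sum_2 A_def B_def)
    then have "D = - (A x y * a1 x y + B x y * a2 x y)" "E = - (A x y * b1 x y + B x y * b2 x y)" by linarith+
    then show "((\<lambda>s. p (point s y)) has_real_derivative - (A x y * a1 x y + B x y * a2 x y)) (at x)"
      "((\<lambda>s. p (point x s)) has_real_derivative - (A x y * b1 x y + B x y * b2 x y)) (at y)"
      using DE by (simp_all add: has_partial_point)
  qed
  have vorticity: "A x y * (b11 x y - a12 x y) + B x y * (b12 x y - a22 x y) = 0" if y: "0 < y" "y < 1" for x y
  proof -
    have "- (a2 x y * a1 x y + A x y * a12 x y + (b2 x y * a2 x y + B x y * a22 x y)) =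
       - (a1 x y * b1 x y + A x y * b11 x y + (b1 x y * b2 x y + B x y * b12 x y))"
    proof (rule mixed_partials_eq[where f = "\<lambda>x y. p (point x y)" and x = x and y = y
        and ?f1.0 = "\<lambda>x y. - (A x y * a1 x y + B x y * a2 x y)" and ?f2.0 = "\<lambda>x y. - (A x y * b1 x y + B x y * b2 x y)"
        and ?f12.0 = "\<lambda>x y. - (a2 x y * a1 x y + A x y * a12 x y + (b2 x y * a2 x y + B x y * a22 x y))"
        and ?f21.0 = "\<lambda>x y. - (a1 x y * b1 x y + A x y * b11 x y + (b1 x y * b2 x y + B x y * b12 x y))"])
      fix x y :: real assume y: "0 < y" "y < 1"
      show "((\<lambda>s. - (A x s * a1 x s + B x s * a2 x s)) has_real_derivative
          - (a2 x y * a1 x y + A x y * a12 x y + (b2 x y * a2 x y + B x y * a22 x y))) (at y)"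
        using y by (auto intro!: derivative_eq_intros a b)
      show "((\<lambda>s. - (A s y * b1 s y + B s y * b2 s y)) has_real_derivative
          - (a1 x y * b1 x y + A x y * b11 x y + (b1 x y * b2 x y + B x y * b12 x y))) (at x)"
        using y by (auto intro!: derivative_eq_intros a b)
    qed (use y pressure in \<open>auto intro!: continuous_intros a b\<close>)
    \<comment> \<open>Equality of the mixed derivatives of the pressure is the curl of the momentum
      equation; the quadratic terms collect into minus divergence times vorticity.\<close>
    then have "A x y * (b11 x y - a12 x y) + B x y * (b12 x y - a22 x y) = (a1 x y + b2 x y) * (a2 x y - b1 x y)"
      by (simp add: algebra_simps)
    then show ?thesis using div[OF y] by simp
  qed
  have div_closed: "b2 x y = - a1 x y" if y: "0 \<le> y" "y \<le> 1" for x y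
  proof (rule strip_boundary_limit[OF _ _ _ y, of "b2 x" "\<lambda>y. - a1 x y"])
    show "b2 x s = - a1 x s" if "0 < s" "s < 1" for s using div[OF that, of x] by linarith
  qed (auto intro!: continuous_on_strip_compose[OF b(3)] continuous_on_strip_compose[OF a(2)] continuous_intros)
  have div_deriv: "b12 x y = - a11 x y" "b22 x y = - a12 x y" if y: "0 < y" "y < 1" for x y
  proof -
    have "((\<lambda>s. - a1 s y) has_real_derivative b12 x y) (at x)"
      using b(11)[OF y, of x] div_closed[of y] y by simp
    then show "b12 x y = - a11 x y" using DERIV_minus[OF a(9)[OF y, of x]] DERIV_unique by blast
    have "((\<lambda>s. - a1 x s) has_real_derivative b22 x y) (at y)"
      by (rule has_field_derivative_transform_within_open[OF b(12)[OF y], where S = "{0<..<1}"])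
        (use y div_closed in auto)
    then show "b22 x y = - a12 x y" using DERIV_minus[OF a(10)[OF y, of x]] DERIV_unique by blast
  qed
  define \<eta> where "\<eta> = (INF x\<in>strip. norm (v x))"
  have eta_pos: "\<eta> > 0" using assms(4) by (simp add: \<eta>_def)
  have eta: "\<eta>\<^sup>2 \<le> (A x y)\<^sup>2 + (B x y)\<^sup>2" if y: "0 \<le> y" "y \<le> 1" for x y
  proof (rule continuous_ge_on_closure[of "{0<..<1}" "\<lambda>y. (A x y)\<^sup>2 + (B x y)\<^sup>2"])
    show "continuous_on (closure {0<..<1}) (\<lambda>y. (A x y)\<^sup>2 + (B x y)\<^sup>2)"
      by (simp, intro continuous_intros continuous_on_strip_compose[OF a(1)] continuous_on_strip_compose[OF b(1)]) auto
    show "\<eta>\<^sup>2 \<le> (A x s)\<^sup>2 + (B x s)\<^sup>2" if "s \<in> {0<..<1}" for s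
    proof -
      have "\<eta> \<le> norm (v (point x s))" unfolding \<eta>_def
        using that by (intro cINF_lower in_strip bdd_belowI2[of _ 0]) auto
      then have "\<eta>\<^sup>2 \<le> (norm (v (point x s)))\<^sup>2" using eta_pos by (intro power_mono) auto
      then show ?thesis by (simp add: norm_vec_def L2_set_def sum_2 A_def B_def)
    qed
  qed (use y in auto)
  have boundary: "B x 0 = 0" "B x 1 = 0" for x
    using assms(3) point_in_frontier_strip by (auto simp: B_def)
  obtain u where u: "continuous_on_strip u" "\<And>x. u x 0 = 0"
    "\<And>x y. 0 \<le> y \<Longrightarrow> y \<le> 1 \<Longrightarrow> ((\<lambda>s. u s y) has_real_derivative - B x y) (at x)"
    "\<And>x y. 0 \<le> y \<Longrightarrow> y \<le> 1 \<Longrightarrow> ((\<lambda>s. u x s) has_real_derivative A x y) (at y within {0..1})"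
  \<comment> \<open>The closedness condition for the field \<open>(- B, A)\<close> is
    incompressibility, with \<open>a1\<close> as the common derivative.\<close>
  proof (rule strip_potential[of "\<lambda>x y. - B x y" A a1])
    show "((\<lambda>s. - B x s) has_real_derivative a1 x y) (at y)" if "0 < y" "y < 1" for x y
      using DERIV_minus[OF b(8)[OF that, of x]] div_closed[of y x] that by simp
    show "continuous_on_strip (\<lambda>x y. - B x y)" by (intro continuous_intros b)
  qed (use a boundary that in auto)
  interpret strip_flow A B a1 a2 b1 b2 a11 a12 a22 b11 b12 b22 u \<eta>
    by unfold_locales
      (fact a b div_closed div_deriv vorticity boundary eta_pos eta u)+
  have "v x $ 2 = 0 \<and> v x $ 1 = A 0 (x $ 2)" if "x \<in> closure strip" for x
    using shear_flow[of "x $ 2" "x $ 1"] that point_in_closure_strip[of "x $ 1" "x $ 2"]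
    by (simp add: A_def B_def point_eta)
  then show ?thesis by (intro conjI exI[of _ "A 0"]) auto
qed

end
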